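(* Let $f \in \mathbb{R}[x]$, $x=(x_1,\dots,x_n)$, and let $G \in \mathcal{S}^m\mathbb{R}[x]$ be an $m\times m$ symmetric polynomial matrix. Consider $\min f(x)$ s.t. $G(x)\succeq 0$ $(\mathrm{P})$, with optimal value $f_{\min}$. Suppose the quadratic module $\mathrm{QM}[G]$ is Archimedean, and the nondegeneracy condition, strict complementarity condition and second order sufficient condition hold at every minimizer of $(\mathrm{P})$. Then: (i) the support $\mathrm{supp}(M)=M\cap(-M)$ is a zero dimensional ideal, where $M=\mathrm{QM}[G]+\langle f-f_{\min}\rangle$; (ii) when the relaxation order $k$ is sufficiently large, every minimizer $y^*$ of the $k$th order moment relaxation has a flat truncation, i.e., there is an integer $t\in[d_G,k]$ with $\mathrm{rank}\,M_t[y^*]=\mathrm{rank}\,M_{t-d_G}[y^*]$.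
   Context: A minimizer means a global minimizer of $(\mathrm{P})$. $\Sigma[x]$ is the set of sums of squares of polynomials. $\mathrm{QM}[G]=\{\sigma+\sum_{t=1}^r v_t^TGv_t : \sigma\in\Sigma[x],\ v_t\in\mathbb{R}[x]^m,\ r\in\mathbb{N}\}$; it is Archimedean if $R-\|x\|^2\in\mathrm{QM}[G]$ for some $R>0$. $\mathrm{QM}[G]_{2k}$ consists of those elements with $\deg\sigma\le 2k$, $\deg(v_t^TGv_t)\le2k$. $\langle f-f_{\min}\rangle$ is the ideal generated by $f-f_{\min}$; an ideal is zero dimensional if its complex variety is finite. For $y\in\mathbb{R}^{\mathbb{N}^n_{2k}}$, $\mathscr{L}_y(\sum_\alpha p_\alpha x^\alpha)=\sum_\alpha p_\alpha y_\alpha$. The $k$th order moment relaxation is $\min\{\mathscr{L}_y(f): y\in\mathbb{R}^{\mathbb{N}^n_{2k}},\ \mathscr{L}_y(1)=1,\ \mathscr{L}_y(p)\ge0\ \forall p\in\mathrm{QM}[G]_{2k}\}$. For $t\le k$, $M_t[y]=\mathscr{L}_y([x]_t[x]_t^T)$ (entrywise) is the moment matrix, where $[x]_t$ is the vector of monomials of degree $\le t$. $d_G=\max\{\lceil \deg(G_{ij})/2\rceil: 1\le i\le j\le m\}$. Optimality conditions at feasible $u$: $\nabla G(u)[d]=\sum_i d_i\partial_{x_i}G(u)$, adjoint $\nabla G(u)^*[X]=(\langle\partial_{x_i}G(u),X\rangle)_{i=1}^n$, $\langle W,Y\rangle=\mathrm{tr}(WY^T)$; $E$ has columns forming a basis of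 $\ker G(u)$. NDC: $\mathrm{Im}\,\nabla G(u)+\{N\in\mathcal{S}^m:E^TNE=0\}=\mathcal{S}^m$. Under NDC at a local minimizer there is a unique $\Lambda\in\mathcal{S}^m$ with $\nabla f(u)-\nabla G(u)^*[\Lambda]=0$, $\Lambda\succeq0$, $\langle\Lambda,G(u)\rangle=0$. SCC: $\mathrm{rank}\,G(u)+\mathrm{rank}\,\Lambda=m$. SOSC: $h^T(\nabla^2L(u,\Lambda)+H(u,\Lambda))h>0$ for all $0\neq h\in\mathcal{N}(u)=\{h:\sum_ih_iE^T\partial_{x_i}G(u)E=0\}$, where $L(x,\Lambda)=f(x)-\langle\Lambda,G(x)\rangle$ and $H(x,Q)_{ij}=2\langle Q,\partial_{x_i}G(x)G(x)^\dagger\partial_{x_j}G(x)\rangle$ ($\dagger$ = Moore–Penrose inverse). *)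

theory Defs
  imports Complex_Main "HOL-Library.Poly_Mapping" "Jordan_Normal_Form.Matrix"
    "Jordan_Normal_Form.DL_Rank" "Jordan_Normal_Form.Matrix_Kernel"
begin

text \<open>A monomial is a finitely supported exponent vector; a real polynomial is a finitely
supported map from monomials to real coefficients (convolution product = polynomial product).
The polynomial ring R[x_1..x_n] is the set of such maps whose monomials only involve the
first n variables (indices 0..n-1).\<close>

type_synonym mon = "nat \<Rightarrow>\<^sub>0 nat"
type_synonym rpoly = "mon \<Rightarrow>\<^sub>0 real"

definition mdeg :: "mon \<Rightarrow> nat" where
  "mdeg \<alpha> = (\<Sum>i\<in>Poly_Mapping.keys \<alpha>. Poly_Mapping.lookup \<alpha> i)"

definition pdeg :: "rpoly \<Rightarrow> nat" where
  "pdeg p = Max (insert 0 (mdeg ` Poly_Mapping.keys p))"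

definition is_poly :: "nat \<Rightarrow> rpoly \<Rightarrow> bool" where
  "is_poly n p \<longleftrightarrow> (\<forall>\<alpha>\<in>Poly_Mapping.keys p. Poly_Mapping.keys \<alpha> \<subseteq> {..<n})"

definition peval :: "rpoly \<Rightarrow> (nat \<Rightarrow> 'a::{real_algebra_1,comm_ring_1}) \<Rightarrow> 'a" where
  "peval p x = (\<Sum>\<alpha>\<in>Poly_Mapping.keys p. of_real (Poly_Mapping.lookup p \<alpha>) * (\<Prod>i\<in>Poly_Mapping.keys \<alpha>. x i ^ Poly_Mapping.lookup \<alpha> i))"

definition pvar :: "nat \<Rightarrow> rpoly" where
  "pvar i = Poly_Mapping.single (Poly_Mapping.single i 1) 1"

definition pconst :: "real \<Rightarrow> rpoly" where
  "pconst c = Poly_Mapping.single 0 c"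

definition pdiff :: "nat \<Rightarrow> rpoly \<Rightarrow> rpoly" where
  "pdiff i p = (\<Sum>\<alpha>\<in>Poly_Mapping.keys p. Poly_Mapping.single (\<alpha> - Poly_Mapping.single i 1)
                                   (Poly_Mapping.lookup p \<alpha> * real (Poly_Mapping.lookup \<alpha> i)))"

text \<open>Points of R^n (resp. C^n): coordinates outside 0..n-1 are zero.\<close>
definition pts :: "nat \<Rightarrow> (nat \<Rightarrow> 'a::zero) set" where
  "pts n = {u. \<forall>i\<ge>n. u i = 0}"

definition sos :: "nat \<Rightarrow> rpoly \<Rightarrow> bool" where
  "sos n \<sigma> \<longleftrightarrow> (\<exists>qs. (\<forall>q\<in>set qs. is_poly n q) \<and> \<sigma> = (\<Sum>q\<leftarrow>qs. q * q))"

definition qform :: "rpoly mat \<Rightarrow> rpoly vec \<Rightarrow> rpoly" where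
  "qform G v = v \<bullet> (G *\<^sub>v v)"

definition polyvec :: "nat \<Rightarrow> nat \<Rightarrow> rpoly vec \<Rightarrow> bool" where
  "polyvec n m v \<longleftrightarrow> v \<in> carrier_vec m \<and> (\<forall>i<m. is_poly n (v $ i))"

definition qmod :: "nat \<Rightarrow> rpoly mat \<Rightarrow> rpoly set" where
  "qmod n G = {\<sigma> + (\<Sum>t<r. qform G (v t)) | \<sigma> (r::nat) v.
       sos n \<sigma> \<and> (\<forall>t<r. polyvec n (dim_row G) (v t))}"

definition qmod_trunc :: "nat \<Rightarrow> rpoly mat \<Rightarrow> nat \<Rightarrow> rpoly set" where
  "qmod_trunc n G k = {\<sigma> + (\<Sum>t<r. qform G (v t)) | \<sigma> (r::nat) v.
       sos n \<sigma> \<and> pdeg \<sigma> \<le> 2 * k \<and>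
       (\<forall>t<r. polyvec n (dim_row G) (v t) \<and> pdeg (qform G (v t)) \<le> 2 * k)}"

definition archimedean :: "nat \<Rightarrow> rpoly mat \<Rightarrow> bool" where
  "archimedean n G \<longleftrightarrow> (\<exists>R>0. pconst R - (\<Sum>i<n. pvar i * pvar i) \<in> qmod n G)"

definition principal_ideal :: "nat \<Rightarrow> rpoly \<Rightarrow> rpoly set" where
  "principal_ideal n h = {q * h | q. is_poly n q}"

definition supp :: "rpoly set \<Rightarrow> rpoly set" where
  "supp M = M \<inter> uminus ` M"

definition is_ideal :: "nat \<Rightarrow> rpoly set \<Rightarrow> bool" where
  "is_ideal n I \<longleftrightarrow> I \<subseteq> {p. is_poly n p} \<and> 0 \<in> I \<and> (\<forall>a\<in>I. \<forall>b\<in>I. a + b \<in> I) \<and>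
     (\<forall>a\<in>I. \<forall>q. is_poly n q \<longrightarrow> q * a \<in> I)"

definition cvariety :: "nat \<Rightarrow> rpoly set \<Rightarrow> (nat \<Rightarrow> complex) set" where
  "cvariety n I = {z \<in> pts n. \<forall>p\<in>I. peval p z = 0}"

definition zero_dimensional :: "nat \<Rightarrow> rpoly set \<Rightarrow> bool" where
  "zero_dimensional n I \<longleftrightarrow> finite (cvariety n I)"

definition evalm :: "rpoly mat \<Rightarrow> (nat \<Rightarrow> real) \<Rightarrow> real mat" where
  "evalm G u = map_mat (\<lambda>p. peval p u) G"

definition psd :: "real mat \<Rightarrow> bool" where
  "psd A \<longleftrightarrow> A \<in> carrier_mat (dim_row A) (dim_row A) \<and> A\<^sup>T = A \<and>
     (\<forall>v\<in>carrier_vec (dim_row A). 0 \<le> v \<bullet> (A *\<^sub>v v))"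

definition mrank :: "real mat \<Rightarrow> nat" where
  "mrank A = vec_space.rank (dim_row A) A"

definition mtrace :: "real mat \<Rightarrow> real" where
  "mtrace A = (\<Sum>i<dim_row A. A $$ (i,i))"

definition minner :: "real mat \<Rightarrow> real mat \<Rightarrow> real" where
  "minner W Y = mtrace (W * Y\<^sup>T)"

definition mp_inverse :: "real mat \<Rightarrow> real mat" where
  "mp_inverse A = (THE X. X \<in> carrier_mat (dim_col A) (dim_row A) \<and> A * X * A = A \<and>
      X * A * X = X \<and> (A * X)\<^sup>T = A * X \<and> (X * A)\<^sup>T = X * A)"

definition ker_basis_mat :: "real mat \<Rightarrow> real mat \<Rightarrow> bool" where
  "ker_basis_mat A E \<longleftrightarrow> dim_row E = dim_col A \<and> distinct (cols E) \<and>
     kernel.basis (dim_col A) A (set (cols E))"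

definition feasible :: "nat \<Rightarrow> rpoly mat \<Rightarrow> (nat \<Rightarrow> real) set" where
  "feasible n G = {u \<in> pts n. psd (evalm G u)}"

definition fmin :: "nat \<Rightarrow> rpoly \<Rightarrow> rpoly mat \<Rightarrow> real" where
  "fmin n f G = Inf ((\<lambda>u. peval f u) ` feasible n G)"

definition minimizers :: "nat \<Rightarrow> rpoly \<Rightarrow> rpoly mat \<Rightarrow> (nat \<Rightarrow> real) set" where
  "minimizers n f G = {u \<in> feasible n G. \<forall>x\<in>feasible n G. peval f u \<le> peval f x}"

definition dG :: "rpoly mat \<Rightarrow> nat \<Rightarrow> (nat \<Rightarrow> real) \<Rightarrow> real mat" where
  "dG G i u = evalm (map_mat (pdiff i) G) u"

definition ddG :: "rpoly mat \<Rightarrow> nat \<Rightarrow> nat \<Rightarrow> (nat \<Rightarrow> real) \<Rightarrow> real mat" where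
  "ddG G i j u = evalm (map_mat (\<lambda>p. pdiff i (pdiff j p)) G) u"

definition gradG :: "nat \<Rightarrow> rpoly mat \<Rightarrow> (nat \<Rightarrow> real) \<Rightarrow> (nat \<Rightarrow> real) \<Rightarrow> real mat" where
  "gradG n G u d = mat (dim_row G) (dim_col G) (\<lambda>(a,b). \<Sum>i<n. d i * dG G i u $$ (a,b))"

definition NDC :: "nat \<Rightarrow> rpoly mat \<Rightarrow> (nat \<Rightarrow> real) \<Rightarrow> real mat \<Rightarrow> bool" where
  "NDC n G u E \<longleftrightarrow> (let m = dim_row G; r = dim_col E in
     \<forall>N. N \<in> carrier_mat m m \<and> N\<^sup>T = N \<longrightarrow>
       (\<exists>d N2. N2 \<in> carrier_mat m m \<and> N2\<^sup>T = N2 \<and> E\<^sup>T * N2 * E = 0\<^sub>m r r \<and>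
              N = gradG n G u d + N2))"

definition KKT :: "nat \<Rightarrow> rpoly \<Rightarrow> rpoly mat \<Rightarrow> (nat \<Rightarrow> real) \<Rightarrow> real mat \<Rightarrow> bool" where
  "KKT n f G u \<Lambda> \<longleftrightarrow> \<Lambda> \<in> carrier_mat (dim_row G) (dim_row G) \<and>
     (\<forall>i<n. peval (pdiff i f) u - minner (dG G i u) \<Lambda> = 0) \<and>
     psd \<Lambda> \<and> minner \<Lambda> (evalm G u) = 0"

definition SCC :: "rpoly mat \<Rightarrow> (nat \<Rightarrow> real) \<Rightarrow> real mat \<Rightarrow> bool" where
  "SCC G u \<Lambda> \<longleftrightarrow> mrank (evalm G u) + mrank \<Lambda> = dim_row G"

text \<open>Hessian of the Lagrangian L(x,Lambda) = f(x) - <Lambda, G(x)> at u, and H(u,Lambda).\<close>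
definition hessL :: "rpoly \<Rightarrow> rpoly mat \<Rightarrow> (nat \<Rightarrow> real) \<Rightarrow> real mat \<Rightarrow> nat \<Rightarrow> nat \<Rightarrow> real" where
  "hessL f G u \<Lambda> i j = peval (pdiff i (pdiff j f)) u - minner \<Lambda> (ddG G i j u)"

definition Hterm :: "rpoly mat \<Rightarrow> (nat \<Rightarrow> real) \<Rightarrow> real mat \<Rightarrow> nat \<Rightarrow> nat \<Rightarrow> real" where
  "Hterm G u Q i j = 2 * minner Q (dG G i u * mp_inverse (evalm G u) * dG G j u)"

definition crit_cone :: "nat \<Rightarrow> rpoly mat \<Rightarrow> (nat \<Rightarrow> real) \<Rightarrow> real mat \<Rightarrow> (nat \<Rightarrow> real) set" where
  "crit_cone n G u E = {h \<in> pts n. mat (dim_col E) (dim_col E)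
       (\<lambda>(a,b). \<Sum>i<n. h i * (E\<^sup>T * dG G i u * E) $$ (a,b)) = 0\<^sub>m (dim_col E) (dim_col E)}"

definition SOSC :: "nat \<Rightarrow> rpoly \<Rightarrow> rpoly mat \<Rightarrow> (nat \<Rightarrow> real) \<Rightarrow> real mat \<Rightarrow> real mat \<Rightarrow> bool" where
  "SOSC n f G u \<Lambda> E \<longleftrightarrow> (\<forall>h\<in>crit_cone n G u E. h \<noteq> (\<lambda>_. 0) \<longrightarrow>
     (\<Sum>i<n. \<Sum>j<n. h i * h j * (hessL f G u \<Lambda> i j + Hterm G u \<Lambda> i j)) > 0)"

text \<open>NDC, SCC and SOSC at u (E a matrix whose columns are a basis of ker G(u);
the conditions do not depend on the choice of E; Lambda the KKT multiplier,
which is unique under NDC).\<close>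
definition opt_conds :: "nat \<Rightarrow> rpoly \<Rightarrow> rpoly mat \<Rightarrow> (nat \<Rightarrow> real) \<Rightarrow> bool" where
  "opt_conds n f G u \<longleftrightarrow> (\<exists>E. ker_basis_mat (evalm G u) E \<and> NDC n G u E \<and>
      (\<exists>\<Lambda>. KKT n f G u \<Lambda> \<and> SCC G u \<Lambda> \<and> SOSC n f G u \<Lambda> E))"

definition Mset :: "nat \<Rightarrow> rpoly \<Rightarrow> rpoly mat \<Rightarrow> rpoly set" where
  "Mset n f G = {a + b | a b. a \<in> qmod n G \<and> b \<in> principal_ideal n (f - pconst (fmin n f G))}"

definition mons :: "nat \<Rightarrow> nat \<Rightarrow> mon set" where
  "mons n t = {\<alpha>. Poly_Mapping.keys \<alpha> \<subseteq> {..<n} \<and> mdeg \<alpha> \<le> t}"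

definition Ly :: "(mon \<Rightarrow> real) \<Rightarrow> rpoly \<Rightarrow> real" where
  "Ly y p = (\<Sum>\<alpha>\<in>Poly_Mapping.keys p. Poly_Mapping.lookup p \<alpha> * y \<alpha>)"

text \<open>y in R^(N^n_(2k)), represented as a function vanishing outside N^n_(2k).\<close>
definition tms :: "nat \<Rightarrow> nat \<Rightarrow> (mon \<Rightarrow> real) set" where
  "tms n k = {y. \<forall>\<alpha>. \<alpha> \<notin> mons n (2 * k) \<longrightarrow> y \<alpha> = 0}"

definition mom_feasible :: "nat \<Rightarrow> rpoly mat \<Rightarrow> nat \<Rightarrow> (mon \<Rightarrow> real) set" where
  "mom_feasible n G k = {y \<in> tms n k. Ly y 1 = 1 \<and> (\<forall>p\<in>qmod_trunc n G k. Ly y p \<ge> 0)}"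

definition mom_minimizer :: "nat \<Rightarrow> rpoly \<Rightarrow> rpoly mat \<Rightarrow> nat \<Rightarrow> (mon \<Rightarrow> real) \<Rightarrow> bool" where
  "mom_minimizer n f G k y \<longleftrightarrow> y \<in> mom_feasible n G k \<and>
     (\<forall>z\<in>mom_feasible n G k. Ly y f \<le> Ly z f)"

definition moment_mat :: "nat \<Rightarrow> nat \<Rightarrow> (mon \<Rightarrow> real) \<Rightarrow> real mat" where
  "moment_mat n t y = (let ms = sorted_list_of_set (mons n t) in
     mat (length ms) (length ms) (\<lambda>(i,j). y (ms ! i + ms ! j)))"

definition dGdeg :: "rpoly mat \<Rightarrow> nat" where
  "dGdeg G = Max (insert 0 {(pdeg (G $$ (i,j)) + 1) div 2 | i j. i \<le> j \<and> j < dim_row G})"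

end

(*
  Let F = f - f_min. At a minimizer u the multiplier gives squares v^T G v whose difference with F
  has zero gradient at u. Choosing the linear part of v so as to complete the square turns the
  Hessian of that difference into the matrix of the second order condition plus an arbitrarily large
  penalty off the critical cone (strict complementarity makes the penalty vanish exactly there);
  hence it can be made equal to a small multiple of the identity.

  Interpolation glues these local certificates: with q ranging over products of (x_i - u_i) and
  polynomials vanishing at the other minimizers, and p the sum of the q^2, the polynomial F is
  a module element plus c p plus a form in the q whose coefficients vanish at the minimizers.
  Splitting F by 1 = T^(2K) + p kappa with T = 1 - gamma p makes all coefficients small or positive
  on the feasible set, and the archimedean Positivstellensatz yields F - eps p in QM[G].

  Consequently every -q^2 lies in M, so the support vanishes only at the minimizers. Every minimizing y
  of a high relaxation satisfies L_y(q^2) = 0, hence L_y annihilates the ideal generated by the q in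
  bounded degree; this ideal contains a monic univariate polynomial in each variable, so the rank of
  the moment matrix stabilises.
*)
theory Submission
  imports Defs "HOL-Analysis.Analysis"
begin

hide_const (open) Finite_Cartesian_Product.vec Finite_Cartesian_Product.mat Finite_Cartesian_Product.row
  Determinants.det
hide_type (open) Finite_Cartesian_Product.vec

subsection \<open>Polynomials\<close>

text \<open>A quadratic module need not be closed under products, and the Positivstellensatz only
  yields membership of polynomials that are strictly positive on the feasible set, whereas
  \<open>F\<close> vanishes at the minimizers. Every defect is therefore brought to the shape of a
  form in the \<open>q u i\<close>: their squares may be multiplied by any module element, in
  particular by the strictly positive \<open>d\<close>, and mixed products are dominated by squares
  (\<open>form_mem\<close>). The exponents follow from this. With
  \<open>q u i = P u * P u * xi u i\<close> a product of two with the same \<open>u\<close> vanishes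
  to order four at the other minimizers, so \<open>p\<close> behaves at \<open>u\<close> like
  \<open>P u ^ 4\<close> times the squared distance. A remainder expressed in the
  \<open>xi u i\<close> is multiplied by \<open>P u ^ 6\<close>: four factors are absorbed by two
  \<open>q\<close>, the last two make the coefficient vanish at the other minimizers. The identity
  \<open>(\<Sum>u\<in>U. \<alpha> u * P u ^ 6) = 1\<close> is one of polynomials and not merely of
  values on \<open>U\<close>, so it can be evaluated at complex points and multiplied by the product
  of the \<open>xi v i\<close>, which is what the variety and the moment matrices require.\<close>

abbreviation (input) "mkeys \<equiv> Poly_Mapping.keys"
abbreviation (input) "coef \<equiv> Poly_Mapping.lookup"

lemma poly_mapping_sum_single:
  "(\<Sum>\<alpha>\<in>mkeys p. Poly_Mapping.single \<alpha> (coef p \<alpha>)) = p"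
proof (rule poly_mapping_eqI)
  fix \<beta>
  have "coef (\<Sum>\<alpha>\<in>mkeys p. Poly_Mapping.single \<alpha> (coef p \<alpha>)) \<beta>
      = (\<Sum>\<alpha>\<in>mkeys p. if \<alpha> = \<beta> then coef p \<alpha> else 0)"
    by (simp add: lookup_sum lookup_single when_def)
  also have "\<dots> = coef p \<beta>"
    by (simp add: in_keys_iff)
  finally show "coef (\<Sum>\<alpha>\<in>mkeys p. Poly_Mapping.single \<alpha> (coef p \<alpha>)) \<beta> = coef p \<beta>" .
qed

lemma additive_eq_sum_single:
  fixes F :: "('a \<Rightarrow>\<^sub>0 'b::comm_monoid_add) \<Rightarrow> 'c::comm_monoid_add"
  assumes "\<And>p q. F (p + q) = F p + F q" "F 0 = 0"
  shows "F p = (\<Sum>\<alpha>\<in>mkeys p. F (Poly_Mapping.single \<alpha> (coef p \<alpha>)))"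
proof -
  have "F (\<Sum>\<alpha>\<in>A. h \<alpha>) = (\<Sum>\<alpha>\<in>A. F (h \<alpha>))" if "finite A" for A and h :: "'a \<Rightarrow> ('a \<Rightarrow>\<^sub>0 'b)"
    using that by (induction A) (auto simp: assms)
  from this[of "mkeys p" "\<lambda>\<alpha>. Poly_Mapping.single \<alpha> (coef p \<alpha>)"] show ?thesis
    by (simp add: poly_mapping_sum_single)
qed

text \<open>Both sides are sums of their values on single terms. Product rules are thereby checked
  on monomials instead of on the convolution sum.\<close>

lemma additive_cong:
  fixes F H :: "('a \<Rightarrow>\<^sub>0 'b::comm_monoid_add) \<Rightarrow> 'c::comm_monoid_add"
  assumes "\<And>p q. F (p + q) = F p + F q" "F 0 = 0"
    and "\<And>p q. H (p + q) = H p + H q" "H 0 = 0"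
    and "\<And>\<alpha> c. F (Poly_Mapping.single \<alpha> c) = H (Poly_Mapping.single \<alpha> c)"
  shows "F p = H p"
  using additive_eq_sum_single[of F p] additive_eq_sum_single[of H p] assms by simp

definition mval :: "mon \<Rightarrow> (nat \<Rightarrow> 'a::comm_monoid_mult) \<Rightarrow> 'a" where
  "mval \<alpha> x = (\<Prod>i\<in>mkeys \<alpha>. x i ^ coef \<alpha> i)"

text \<open>The additional indices contribute factors with exponent 0. Passing to a common finite
  index set makes sums comparable term by term; the other \<open>superset\<close> lemmas serve the
  same purpose.\<close>

lemma mval_superset:
  assumes "finite K" "mkeys \<alpha> \<subseteq> K"
  shows "mval \<alpha> x = (\<Prod>i\<in>K. x i ^ coef \<alpha> i)"
  unfolding mval_def
  by (rule prod.mono_neutral_left) (use assms in \<open>auto simp: in_keys_iff\<close>)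

lemma mval_add: "mval (\<alpha> + \<beta>) x = mval \<alpha> x * mval \<beta> x"
proof -
  let ?K = "mkeys \<alpha> \<union> mkeys \<beta>"
  have "mval (\<alpha> + \<beta>) x = (\<Prod>i\<in>?K. x i ^ coef (\<alpha> + \<beta>) i)"
    by (rule mval_superset) (simp_all add: Poly_Mapping.keys_add)
  also have "\<dots> = (\<Prod>i\<in>?K. x i ^ coef \<alpha> i) * (\<Prod>i\<in>?K. x i ^ coef \<beta> i)"
    by (simp add: lookup_add power_add prod.distrib)
  also have "\<dots> = mval \<alpha> x * mval \<beta> x"
    by (subst (1 2) mval_superset[of ?K]) auto
  finally show ?thesis .
qed

lemma mval_0 [simp]: "mval 0 x = 1"
  by (simp add: mval_def)

lemma mval_single: "mval (Poly_Mapping.single i k) x = x i ^ k"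
  by (simp add: mval_def)

lemma peval_superset:
  assumes "finite K" "mkeys p \<subseteq> K"
  shows "peval p x = (\<Sum>\<alpha>\<in>K. of_real (coef p \<alpha>) * mval \<alpha> x)"
  unfolding peval_def mval_def
  by (rule sum.mono_neutral_left) (use assms in \<open>auto simp: in_keys_iff\<close>)

lemma peval_0 [simp]: "peval 0 x = 0"
  by (simp add: peval_def)

lemma peval_add [simp]: "peval (p + q) x = peval p x + peval q x"
proof -
  let ?K = "mkeys p \<union> mkeys q"
  have "peval (p + q) x = (\<Sum>\<alpha>\<in>?K. of_real (coef (p + q) \<alpha>) * mval \<alpha> x)"
    by (rule peval_superset) (simp_all add: Poly_Mapping.keys_add)
  also have "\<dots> = (\<Sum>\<alpha>\<in>?K. of_real (coef p \<alpha>) * mval \<alpha> x) + (\<Sum>\<alpha>\<in>?K. of_real (coef q \<alpha>) * mval \<alpha> x)"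
    by (simp add: lookup_add distrib_right sum.distrib)
  also have "\<dots> = peval p x + peval q x"
    by (subst (1 2) peval_superset[of ?K]) auto
  finally show ?thesis .
qed

lemma peval_single: "peval (Poly_Mapping.single \<alpha> c) x = of_real c * mval \<alpha> x"
  by (simp add: peval_def mval_def)

lemma peval_mult [simp]: "peval (p * q) x = peval p x * peval q x"
proof (rule additive_cong[where p = p and F = "\<lambda>p. peval (p * q) x" and H = "\<lambda>p. peval p x * peval q x"])
  fix \<alpha> c
  show "peval (Poly_Mapping.single \<alpha> c * q) x = peval (Poly_Mapping.single \<alpha> c) x * peval q x"
    by (rule additive_cong[where p = q])
       (auto simp: distrib_left mult_single peval_single mval_add algebra_simps)
qed (auto simp: distrib_right)

lemma peval_pconst [simp]: "peval (pconst c) x = of_real c"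
  by (simp add: pconst_def peval_single)

lemma peval_1 [simp]: "peval 1 x = 1"
  using peval_pconst[of 1 x] by (simp add: pconst_def)

lemma peval_pvar [simp]: "peval (pvar i) x = x i"
  by (simp add: pvar_def peval_single mval_single)

lemma peval_uminus [simp]: "peval (- p) x = - peval p x"
  using peval_add[of p "-p" x] by (simp add: eq_neg_iff_add_eq_0 add.commute)

lemma peval_diff [simp]: "peval (p - q) x = peval p x - peval q x"
  using peval_add[of p "-q" x] by simp

lemma peval_sum [simp]: "peval (\<Sum>i\<in>I. h i) x = (\<Sum>i\<in>I. peval (h i) x)"
  by (induction I rule: infinite_finite_induct) auto

lemma peval_prod [simp]: "peval (\<Prod>i\<in>I. h i) x = (\<Prod>i\<in>I. peval (h i) x)"
  by (induction I rule: infinite_finite_induct) auto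

lemma peval_power [simp]: "peval (p ^ k) x = peval p x ^ k"
  by (induction k) auto

lemma peval_sum_list: "peval (sum_list ps) x = (\<Sum>p\<leftarrow>ps. peval p x)"
  by (induction ps) auto

lemma pconst_0 [simp]: "pconst 0 = 0" and pconst_1 [simp]: "pconst 1 = 1"
  and pconst_add: "pconst (a + b) = pconst a + pconst b"
  and pconst_diff: "pconst (a - b) = pconst a - pconst b"
  and pconst_uminus: "pconst (- a) = - pconst a"
  and pconst_mult: "pconst (a * b) = pconst a * pconst b"
  by (auto simp: pconst_def single_add single_diff single_uminus mult_single)

lemma pconst_numeral: "pconst (numeral k) = numeral k"
  by (simp add: pconst_def)

lemma is_poly_0 [simp]: "is_poly n 0" and is_poly_1 [simp]: "is_poly n 1"
  and is_poly_pconst [simp]: "is_poly n (pconst c)"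
  by (auto simp: is_poly_def pconst_def split: if_splits)

lemma is_poly_pvar [simp]: "i < n \<Longrightarrow> is_poly n (pvar i)"
  by (auto simp: is_poly_def pvar_def)

lemma is_poly_add [simp]: "is_poly n p \<Longrightarrow> is_poly n q \<Longrightarrow> is_poly n (p + q)"
  using Poly_Mapping.keys_add[of p q] by (auto simp: is_poly_def)

lemma is_poly_uminus [simp]: "is_poly n (- p) \<longleftrightarrow> is_poly n p"
  by (auto simp: is_poly_def in_keys_iff)

lemma is_poly_diff [simp]: "is_poly n p \<Longrightarrow> is_poly n q \<Longrightarrow> is_poly n (p - q)"
  using is_poly_add[of n p "-q"] by simp

lemma is_poly_mult [simp]: "is_poly n p \<Longrightarrow> is_poly n q \<Longrightarrow> is_poly n (p * q)"
  unfolding is_poly_def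
proof
  fix \<gamma> assume p: "\<forall>\<alpha>\<in>mkeys p. mkeys \<alpha> \<subseteq> {..<n}" and q: "\<forall>\<alpha>\<in>mkeys q. mkeys \<alpha> \<subseteq> {..<n}"
    and "\<gamma> \<in> mkeys (p * q)"
  then obtain \<alpha> \<beta> where "\<gamma> = \<alpha> + \<beta>" "\<alpha> \<in> mkeys p" "\<beta> \<in> mkeys q"
    using keys_mult[of p q] by blast
  then show "mkeys \<gamma> \<subseteq> {..<n}"
    using p q Poly_Mapping.keys_add[of \<alpha> \<beta>] by blast
qed

lemma is_poly_sum: "(\<And>i. i \<in> I \<Longrightarrow> is_poly n (h i)) \<Longrightarrow> is_poly n (\<Sum>i\<in>I. h i)"
  by (induction I rule: infinite_finite_induct) auto

lemma is_poly_prod: "(\<And>i. i \<in> I \<Longrightarrow> is_poly n (h i)) \<Longrightarrow> is_poly n (\<Prod>i\<in>I. h i)"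
  by (induction I rule: infinite_finite_induct) auto

lemma is_poly_power [simp]: "is_poly n p \<Longrightarrow> is_poly n (p ^ k)"
  by (induction k) auto

lemma is_poly_sum_list: "(\<And>p. p \<in> set ps \<Longrightarrow> is_poly n p) \<Longrightarrow> is_poly n (sum_list ps)"
  by (induction ps) auto

lemma pvar_power: "pvar i ^ k = Poly_Mapping.single (Poly_Mapping.single i k) 1"
  by (induction k) (auto simp: pvar_def mult_single single_add[symmetric])

lemma single_mon_eq:
  assumes "finite K" "mkeys \<alpha> \<subseteq> K"
  shows "Poly_Mapping.single \<alpha> c = pconst c * (\<Prod>i\<in>K. pvar i ^ coef \<alpha> i)"
proof -
  have *: "(\<Prod>i\<in>K. pvar i ^ coef \<alpha> i) = Poly_Mapping.single (\<Sum>i\<in>K. Poly_Mapping.single i (coef \<alpha> i)) 1"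
    using assms(1) by (induction K) (auto simp: pvar_power mult_single)
  have "(\<Sum>i\<in>K. Poly_Mapping.single i (coef \<alpha> i)) = (\<Sum>i\<in>mkeys \<alpha>. Poly_Mapping.single i (coef \<alpha> i))"
    by (rule sum.mono_neutral_right) (use assms in \<open>auto simp: in_keys_iff\<close>)
  then show ?thesis
    unfolding * by (simp add: poly_mapping_sum_single pconst_def mult_single)
qed

text \<open>The polynomials in the first \<open>n\<close> variables form the ring generated by the
  constants and these variables. Boundedness, values in a maximal module and Taylor expansion are
  all proved by this induction.\<close>

lemma is_poly_induct [consumes 1, case_names const var add mult]:
  assumes "is_poly n p"
    and const: "\<And>c. P (pconst c)"
    and var: "\<And>i. i < n \<Longrightarrow> P (pvar i)"
    and add: "\<And>p q. is_poly n p \<Longrightarrow> is_poly n q \<Longrightarrow> P p \<Longrightarrow> P q \<Longrightarrow> P (p + q)"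
    and mult: "\<And>p q. is_poly n p \<Longrightarrow> is_poly n q \<Longrightarrow> P p \<Longrightarrow> P q \<Longrightarrow> P (p * q)"
  shows "P p"
proof -
  have pw: "P (pvar i ^ k)" if "i < n" for i k
    using that
  proof (induction k)
    case 0 then show ?case using const[of 1] by simp
  next
    case (Suc k) then show ?case using mult[of "pvar i" "pvar i ^ k"] var[of i] by simp
  qed
  have pr: "P (\<Prod>i\<in>I. pvar i ^ k i)" if "finite I" "I \<subseteq> {..<n}" for I and k :: "nat \<Rightarrow> nat"
    using that
  proof (induction I)
    case empty then show ?case using const[of 1] by simp
  next
    case (insert i I)
    moreover have "is_poly n (\<Prod>i\<in>I. pvar i ^ k i)"
      using insert.prems by (intro is_poly_prod is_poly_power is_poly_pvar) auto
    ultimately show ?case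
      using mult[of "pvar i ^ k i" "\<Prod>i\<in>I. pvar i ^ k i"] pw by simp
  qed
  have sg: "is_poly n (Poly_Mapping.single \<alpha> c) \<and> P (Poly_Mapping.single \<alpha> c)" if "mkeys \<alpha> \<subseteq> {..<n}" for \<alpha> c
  proof -
    have q: "is_poly n (\<Prod>i<n. pvar i ^ coef \<alpha> i)"
      by (intro is_poly_prod is_poly_power is_poly_pvar) auto
    show ?thesis
      using mult[OF is_poly_pconst q const pr, of c] q single_mon_eq[OF finite_lessThan that, of c]
      by simp
  qed
  have "is_poly n (\<Sum>\<alpha>\<in>A. Poly_Mapping.single \<alpha> (coef p \<alpha>)) \<and> P (\<Sum>\<alpha>\<in>A. Poly_Mapping.single \<alpha> (coef p \<alpha>))"
    if "finite A" "A \<subseteq> mkeys p" for A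
    using that
  proof (induction A)
    case empty then show ?case using const[of 0] by simp
  next
    case (insert \<alpha> A)
    have "mkeys \<alpha> \<subseteq> {..<n}" using insert.prems assms(1) by (auto simp: is_poly_def)
    then show ?case using insert sg[of \<alpha> "coef p \<alpha>"] add by simp
  qed
  from this[of "mkeys p"] show ?thesis by (simp add: poly_mapping_sum_single)
qed

lemma mdeg_superset:
  assumes "finite K" "mkeys \<alpha> \<subseteq> K"
  shows "mdeg \<alpha> = (\<Sum>i\<in>K. coef \<alpha> i)"
  unfolding mdeg_def by (rule sum.mono_neutral_left) (use assms in \<open>auto simp: in_keys_iff\<close>)

lemma mdeg_add: "mdeg (\<alpha> + \<beta>) = mdeg \<alpha> + mdeg \<beta>"
proof -
  let ?K = "mkeys \<alpha> \<union> mkeys \<beta>"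
  have "mdeg (\<alpha> + \<beta>) = (\<Sum>i\<in>?K. coef (\<alpha> + \<beta>) i)"
    by (rule mdeg_superset) (simp_all add: Poly_Mapping.keys_add)
  also have "\<dots> = (\<Sum>i\<in>?K. coef \<alpha> i) + (\<Sum>i\<in>?K. coef \<beta> i)"
    by (simp add: lookup_add sum.distrib)
  also have "\<dots> = mdeg \<alpha> + mdeg \<beta>"
    by (subst (1 2) mdeg_superset[of ?K]) auto
  finally show ?thesis .
qed

lemma mdeg_0 [simp]: "mdeg 0 = 0"
  by (simp add: mdeg_def)

lemma mdeg_single [simp]: "mdeg (Poly_Mapping.single i k) = k"
  by (simp add: mdeg_def)

lemma pdeg_le_iff: "pdeg p \<le> d \<longleftrightarrow> (\<forall>\<alpha>\<in>mkeys p. mdeg \<alpha> \<le> d)"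
  by (auto simp: pdeg_def)

lemma pdeg_add_le: "pdeg p \<le> d \<Longrightarrow> pdeg q \<le> d \<Longrightarrow> pdeg (p + q) \<le> d"
  using Poly_Mapping.keys_add[of p q] by (auto simp: pdeg_le_iff)

lemma pdeg_uminus [simp]: "pdeg (- p) = pdeg p"
  by (simp add: pdeg_def)

lemma pdeg_diff_le: "pdeg p \<le> d \<Longrightarrow> pdeg q \<le> d \<Longrightarrow> pdeg (p - q) \<le> d"
  using pdeg_add_le[of p d "-q"] by simp


lemma pdeg_mult_le: "pdeg (p * q) \<le> pdeg p + pdeg q"
  unfolding pdeg_le_iff
proof
  fix \<gamma> assume "\<gamma> \<in> mkeys (p * q)"
  then obtain \<alpha> \<beta> where *: "\<gamma> = \<alpha> + \<beta>" "\<alpha> \<in> mkeys p" "\<beta> \<in> mkeys q"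
    using keys_mult[of p q] by blast
  then have "mdeg \<alpha> \<le> pdeg p" "mdeg \<beta> \<le> pdeg q"
    using pdeg_le_iff[of p "pdeg p"] pdeg_le_iff[of q "pdeg q"] by auto
  then show "mdeg \<gamma> \<le> pdeg p + pdeg q" by (simp add: * mdeg_add)
qed

lemma pdeg_pconst [simp]: "pdeg (pconst c) = 0"
  by (auto simp: pdeg_def pconst_def)

lemma pdeg_0 [simp]: "pdeg 0 = 0"
  using pdeg_pconst[of 0] by simp

lemma pdeg_1 [simp]: "pdeg 1 = 0"
  using pdeg_pconst[of 1] by simp

lemma pdeg_sum_le: "(\<And>i. i \<in> I \<Longrightarrow> pdeg (h i) \<le> d) \<Longrightarrow> pdeg (\<Sum>i\<in>I. h i) \<le> d"
  by (induction I rule: infinite_finite_induct) (auto intro!: pdeg_add_le)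

lemma pdiff_superset:
  assumes "finite K" "mkeys p \<subseteq> K"
  shows "pdiff i p = (\<Sum>\<alpha>\<in>K. Poly_Mapping.single (\<alpha> - Poly_Mapping.single i 1) (coef p \<alpha> * real (coef \<alpha> i)))"
  unfolding pdiff_def by (rule sum.mono_neutral_left) (use assms in \<open>auto simp: in_keys_iff\<close>)

lemma pdiff_0 [simp]: "pdiff i 0 = 0"
  by (simp add: pdiff_def)

lemma pdiff_add [simp]: "pdiff i (p + q) = pdiff i p + pdiff i q"
proof -
  let ?K = "mkeys p \<union> mkeys q"
  have "pdiff i (p + q) = (\<Sum>\<alpha>\<in>?K. Poly_Mapping.single (\<alpha> - Poly_Mapping.single i 1) (coef (p + q) \<alpha> * real (coef \<alpha> i)))"
    by (rule pdiff_superset) (simp_all add: Poly_Mapping.keys_add)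
  also have "\<dots> = pdiff i p + pdiff i q"
    by (simp add: pdiff_superset[of ?K] lookup_add distrib_right single_add sum.distrib)
  finally show ?thesis .
qed

lemma pdiff_single: "pdiff i (Poly_Mapping.single \<alpha> c) =
    Poly_Mapping.single (\<alpha> - Poly_Mapping.single i 1) (c * real (coef \<alpha> i))"
  by (simp add: pdiff_def)

lemma pdiff_mult: "pdiff i (p * q) = pdiff i p * q + p * pdiff i q"
proof (rule additive_cong[where p = p])
  fix \<alpha> c
  show "pdiff i (Poly_Mapping.single \<alpha> c * q) = pdiff i (Poly_Mapping.single \<alpha> c) * q + Poly_Mapping.single \<alpha> c * pdiff i q"
  proof (rule additive_cong[where p = q])
    fix \<beta> d
    \<comment> \<open>Subtraction of exponents is truncated, so the shift is correct only for a
      positive exponent of \<open>i\<close>. In the remaining case the coefficient of the term is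
      0.\<close>
    have shift: "(\<alpha>' :: mon) + \<beta>' - Poly_Mapping.single i 1 = \<alpha>' - Poly_Mapping.single i 1 + \<beta>'" if "coef \<alpha>' i \<noteq> 0" for \<alpha>' \<beta>'
      by (rule poly_mapping_eqI) (use that in \<open>auto simp: lookup_add lookup_minus lookup_single when_def\<close>)
    have 1: "Poly_Mapping.single (\<alpha> + \<beta> - Poly_Mapping.single i 1) (c * d * real (coef \<alpha> i))
        = Poly_Mapping.single (\<alpha> - Poly_Mapping.single i 1 + \<beta>) (c * d * real (coef \<alpha> i))"
      by (cases "coef \<alpha> i = 0") (simp_all only: shift not_False_eq_True of_nat_0 mult_zero_right single_zero)
    have 2: "Poly_Mapping.single (\<alpha> + \<beta> - Poly_Mapping.single i 1) (c * d * real (coef \<beta> i))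
        = Poly_Mapping.single (\<alpha> + (\<beta> - Poly_Mapping.single i 1)) (c * d * real (coef \<beta> i))"
      using shift[of \<beta> \<alpha>] by (cases "coef \<beta> i = 0") (simp_all only: add.commute not_False_eq_True of_nat_0 mult_zero_right single_zero)
    have "pdiff i (Poly_Mapping.single \<alpha> c * Poly_Mapping.single \<beta> d)
      = Poly_Mapping.single (\<alpha> + \<beta> - Poly_Mapping.single i 1) (c * d * real (coef \<alpha> i))
      + Poly_Mapping.single (\<alpha> + \<beta> - Poly_Mapping.single i 1) (c * d * real (coef \<beta> i))"
      by (simp add: mult_single pdiff_single lookup_add distrib_left flip: single_add)
    then show "pdiff i (Poly_Mapping.single \<alpha> c * Poly_Mapping.single \<beta> d) =
        pdiff i (Poly_Mapping.single \<alpha> c) * Poly_Mapping.single \<beta> d + Poly_Mapping.single \<alpha> c * pdiff i (Poly_Mapping.single \<beta> d)"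
      unfolding 1 2 by (simp add: mult_single pdiff_single ac_simps)
  qed (auto simp: algebra_simps)
qed (auto simp: algebra_simps)

lemma pdiff_pconst [simp]: "pdiff i (pconst c) = 0"
  by (simp add: pconst_def pdiff_single)

lemma pdiff_pvar: "pdiff i (pvar j) = (if i = j then 1 else 0)"
  by (simp add: pvar_def pdiff_single lookup_single)

lemma Ly_superset:
  assumes "finite K" "mkeys p \<subseteq> K"
  shows "Ly y p = (\<Sum>\<alpha>\<in>K. coef p \<alpha> * y \<alpha>)"
  unfolding Ly_def by (rule sum.mono_neutral_left) (use assms in \<open>auto simp: in_keys_iff\<close>)

lemma Ly_0 [simp]: "Ly y 0 = 0"
  by (simp add: Ly_def)

lemma Ly_add [simp]: "Ly y (p + q) = Ly y p + Ly y q"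
proof -
  let ?K = "mkeys p \<union> mkeys q"
  have "Ly y (p + q) = (\<Sum>\<alpha>\<in>?K. coef (p + q) \<alpha> * y \<alpha>)"
    by (rule Ly_superset) (simp_all add: Poly_Mapping.keys_add)
  also have "\<dots> = Ly y p + Ly y q"
    by (simp add: Ly_superset[of ?K] lookup_add distrib_right sum.distrib)
  finally show ?thesis .
qed

lemma Ly_uminus [simp]: "Ly y (- p) = - Ly y p"
  using Ly_add[of y p "-p"] by (simp del: Ly_add)

lemma Ly_diff [simp]: "Ly y (p - q) = Ly y p - Ly y q"
  using Ly_add[of y p "-q"] by simp

lemma Ly_sum [simp]: "Ly y (\<Sum>i\<in>I. h i) = (\<Sum>i\<in>I. Ly y (h i))"
  by (induction I rule: infinite_finite_induct) auto

lemma Ly_single [simp]: "Ly y (Poly_Mapping.single \<alpha> c) = c * y \<alpha>"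
  by (simp add: Ly_def)

lemma Ly_pconst_mult [simp]: "Ly y (pconst c * p) = c * Ly y p"
  by (rule additive_cong[where p = p]) (auto simp: distrib_left pconst_def mult_single)

lemma continuous_on_peval [continuous_intros]: "continuous_on X (\<lambda>x. peval p x :: real)"
  unfolding peval_def
  by (intro continuous_intros continuous_on_subset[OF continuous_on_product_coordinates]) auto

subsection \<open>Archimedean quadratic modules and the Positivstellensatz\<close>

lemma sos_0 [simp]: "sos n 0"
  unfolding sos_def by (rule exI[of _ "[]"]) auto

lemma sos_square: "is_poly n q \<Longrightarrow> sos n (q * q)"
  unfolding sos_def by (rule exI[of _ "[q]"]) auto

lemma sos_add: "sos n s \<Longrightarrow> sos n t \<Longrightarrow> sos n (s + t)"
  unfolding sos_def
proof (elim exE conjE)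
  fix ps qs
  assume "\<forall>q\<in>set ps. is_poly n q" "s = (\<Sum>q\<leftarrow>ps. q * q)" "\<forall>q\<in>set qs. is_poly n q" "t = (\<Sum>q\<leftarrow>qs. q * q)"
  then show "\<exists>qs. (\<forall>q\<in>set qs. is_poly n q) \<and> s + t = (\<Sum>q\<leftarrow>qs. q * q)"
    by (intro exI[of _ "ps @ qs"]) auto
qed

lemma sos_sum: "(\<And>i. i \<in> I \<Longrightarrow> sos n (h i)) \<Longrightarrow> sos n (\<Sum>i\<in>I. h i)"
  by (induction I rule: infinite_finite_induct) (auto intro: sos_add)

lemma sos_square_mult: "is_poly n a \<Longrightarrow> sos n s \<Longrightarrow> sos n (a * a * s)"
proof -
  assume a: "is_poly n a" and "sos n s"
  then obtain qs where qs: "\<forall>q\<in>set qs. is_poly n q" "s = (\<Sum>q\<leftarrow>qs. q * q)"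
    by (auto simp: sos_def)
  have "a * a * s = (\<Sum>q\<leftarrow>map ((*) a) qs. q * q)"
    unfolding qs(2) by (simp add: sum_list_const_mult[symmetric] o_def mult_ac)
  then show ?thesis
    unfolding sos_def by (intro exI[of _ "map ((*) a) qs"]) (use a qs(1) in auto)
qed

lemma sos_is_poly: "sos n s \<Longrightarrow> is_poly n s"
  unfolding sos_def by (auto intro!: is_poly_sum_list)

text \<open>Several modules occur: QM[G], the set M of the theorem, extensions by one generator,
  unions of chains and maximal modules. The locale treats them alike.\<close>

locale quadratic_module =
  fixes n :: nat and M :: "rpoly set"
  assumes is_polyD: "m \<in> M \<Longrightarrow> is_poly n m"
    and one_mem: "1 \<in> M"
    and add_mem: "a \<in> M \<Longrightarrow> b \<in> M \<Longrightarrow> a + b \<in> M"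
    and square_mult_mem: "is_poly n a \<Longrightarrow> m \<in> M \<Longrightarrow> a * a * m \<in> M"
begin

lemma zero_mem: "0 \<in> M"
  using square_mult_mem[of 0 1] one_mem by simp

lemma square_mem: "is_poly n a \<Longrightarrow> a * a \<in> M"
  using square_mult_mem[of a 1] one_mem by simp

lemma sum_mem: "(\<And>i. i \<in> I \<Longrightarrow> h i \<in> M) \<Longrightarrow> (\<Sum>i\<in>I. h i) \<in> M"
  by (induction I rule: infinite_finite_induct) (auto intro: add_mem zero_mem)

lemma sos_mult_mem: "sos n s \<Longrightarrow> m \<in> M \<Longrightarrow> s * m \<in> M"
proof -
  assume "sos n s" and m: "m \<in> M"
  then obtain qs where qs: "\<forall>q\<in>set qs. is_poly n q" "s = (\<Sum>q\<leftarrow>qs. q * q)"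
    by (auto simp: sos_def)
  show ?thesis
    unfolding qs(2) using qs(1)
    by (induction qs) (auto simp: zero_mem distrib_right intro!: add_mem square_mult_mem m)
qed

lemma sos_mem: "sos n s \<Longrightarrow> s \<in> M"
  using sos_mult_mem[OF _ one_mem] by simp

lemma scale_mem: "c \<ge> 0 \<Longrightarrow> m \<in> M \<Longrightarrow> pconst c * m \<in> M"
  using square_mult_mem[of "pconst (sqrt c)" m] by (simp flip: pconst_mult)

lemma pconst_mem: "c \<ge> 0 \<Longrightarrow> pconst c \<in> M"
  using scale_mem[OF _ one_mem, of c] by simp

lemma pconst_mono: "pconst a + m \<in> M \<Longrightarrow> a \<le> b \<Longrightarrow> pconst b + m \<in> M"
  using add_mem[OF pconst_mem[of "b - a"], of "pconst a + m"] by (simp add: pconst_diff)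

lemma neg_one_mem: "pconst c \<in> M \<Longrightarrow> c < 0 \<Longrightarrow> - 1 \<in> M"
  using scale_mem[of "1 / - c" "pconst c"] by (simp add: pconst_mult[symmetric] pconst_uminus)

lemma bounded_square:
  assumes N: "N > 0" and a: "is_poly n a" "pconst N - a \<in> M" "pconst N + a \<in> M"
  shows "pconst (N * N) - a * a \<in> M"
proof -
  define e h where "e = pconst N" and "h = pconst (1 / (2 * N))"
  have eh: "2 * e * h = 1"
    using N unfolding e_def h_def by (simp flip: pconst_mult pconst_numeral)
  have "(e - a) * (e - a) * (e + a) + (e + a) * (e + a) * (e - a) \<in> M"
    using a by (intro add_mem[OF square_mult_mem square_mult_mem]) (auto simp: e_def)
  then have "h * ((e - a) * (e - a) * (e + a) + (e + a) * (e + a) * (e - a)) \<in> M"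
    unfolding h_def using N by (intro scale_mem) auto
  also have "h * ((e - a) * (e - a) * (e + a) + (e + a) * (e + a) * (e - a)) = (2 * e * h) * (e * e - a * a)"
    by (simp add: algebra_simps)
  finally show ?thesis unfolding eh by (simp add: e_def pconst_mult)
qed

text \<open>Rests on \<open>(N^2 - a^2) + (N - a)^2 = 2 N (N - a)\<close>.\<close>

lemma bounded_of_square:
  assumes N: "N > 0" and a: "is_poly n a" "pconst (N * N) - a * a \<in> M"
  shows "pconst N - a \<in> M"
proof -
  define e h where "e = pconst N" and "h = pconst (1 / (2 * N))"
  have eh: "2 * e * h = 1"
    using N unfolding e_def h_def by (simp flip: pconst_mult pconst_numeral)
  have "(e * e - a * a) + (e - a) * (e - a) \<in> M"
    using a by (intro add_mem square_mem) (auto simp: e_def pconst_mult)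
  then have "h * ((e * e - a * a) + (e - a) * (e - a)) \<in> M"
    unfolding h_def using N by (intro scale_mem) auto
  also have "h * ((e * e - a * a) + (e - a) * (e - a)) = (2 * e * h) * (e - a)"
    by (simp add: algebra_simps)
  finally show ?thesis unfolding eh by (simp add: e_def)
qed

text \<open>This is the least quadratic module containing \<open>M\<close> and \<open>a\<close>. It
  is used with both signs of a polynomial to exploit maximality, and with \<open>- p\<close> in the
  Positivstellensatz.\<close>

lemma adjoin:
  assumes "is_poly n a"
  shows "quadratic_module n {m + a * s | m s. m \<in> M \<and> sos n s}" (is "quadratic_module n ?M'")
proof
  have adj: "m + a * s \<in> ?M'" if "m \<in> M" "sos n s" for m s using that by blast
  show "is_poly n m" if "m \<in> ?M'" for m
    using that assms by (auto intro!: is_poly_add is_poly_mult dest: is_polyD sos_is_poly)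
  show "1 \<in> ?M'"
    using adj[OF one_mem sos_0] by simp
  show "b + c \<in> ?M'" if "b \<in> ?M'" "c \<in> ?M'" for b c
  proof -
    from that obtain m1 s1 m2 s2 where *: "b = m1 + a * s1" "c = m2 + a * s2" "m1 \<in> M" "m2 \<in> M" "sos n s1" "sos n s2"
      by auto
    have "b + c = (m1 + m2) + a * (s1 + s2)" using * by (simp add: algebra_simps)
    moreover have "(m1 + m2) + a * (s1 + s2) \<in> ?M'"
      by (rule adj) (use * in \<open>auto intro: add_mem sos_add\<close>)
    ultimately show ?thesis by (simp only:)
  qed
  show "b * b * m \<in> ?M'" if "is_poly n b" "m \<in> ?M'" for b m
  proof -
    from that obtain m1 s1 where *: "m = m1 + a * s1" "m1 \<in> M" "sos n s1" by auto
    have "b * b * m = b * b * m1 + a * (b * b * s1)" using * by (simp add: algebra_simps)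
    moreover have "b * b * m1 + a * (b * b * s1) \<in> ?M'"
      by (rule adj) (use * that(1) in \<open>auto intro: square_mult_mem sos_square_mult\<close>)
    ultimately show ?thesis by (simp only:)
  qed
qed

lemma adjoin_superset: "M \<subseteq> {m + a * s | m s. m \<in> M \<and> sos n s}"
proof
  fix m assume "m \<in> M"
  then have "m + a * 0 \<in> {m + a * s | m s. m \<in> M \<and> sos n s}"
    using sos_0 by blast
  then show "m \<in> {m + a * s | m s. m \<in> M \<and> sos n s}" by simp
qed

lemma adjoin_mem: "a \<in> {m + a * s | m s. m \<in> M \<and> sos n s}"
proof -
  have "0 + a * (1 * 1) \<in> {m + a * s | m s. m \<in> M \<and> sos n s}"
    using zero_mem sos_square[OF is_poly_1] by blast
  then show ?thesis by simp
qed

text \<open>Every polynomial is a difference of squares, so multiplication by it preserves the support.\<close>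

lemma supp_mult:
  assumes "is_poly n q" "a \<in> M" "- a \<in> M"
  shows "q * a \<in> M"
proof -
  let ?u = "pconst (1/2) * (q + 1)" and ?v = "pconst (1/2) * (q - 1)"
  have half: "pconst (1/2) + pconst (1/2) = 1"
    by (simp flip: pconst_add)
  then have h: "pconst (1/2) * x + pconst (1/2) * x = x" for x
    by (simp flip: distrib_right)
  have "?u * ?u - ?v * ?v = (pconst (1/2) + pconst (1/2)) * ((pconst (1/2) + pconst (1/2)) * q)"
    by (simp add: algebra_simps)
  then have q: "q = ?u * ?u - ?v * ?v"
    by (simp add: half)
  have "?u * ?u * a + ?v * ?v * (- a) \<in> M"
    using assms by (intro add_mem square_mult_mem) auto
  also have "?u * ?u * a + ?v * ?v * (- a) = (?u * ?u - ?v * ?v) * a"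
    by (simp add: algebra_simps)
  finally show ?thesis using q by simp
qed

end

locale archimedean_module = quadratic_module +
  assumes arch: "\<exists>R>0. pconst R - (\<Sum>i<n. pvar i * pvar i) \<in> M"
begin

text \<open>The polynomials that are bounded on both sides modulo \<open>M\<close> form a ring; it
  contains the constants and, by the Archimedean property, the variables.\<close>

lemma bounded:
  assumes "is_poly n a"
  shows "\<exists>N>0. pconst N - a \<in> M \<and> pconst N + a \<in> M"
  using assms
proof (induction rule: is_poly_induct)
  case (const c)
  show ?case
    by (rule exI[of _ "\<bar>c\<bar> + 1"]) (auto simp flip: pconst_add pconst_diff intro!: pconst_mem)
next
  case (var i)
  obtain R where R: "R > 0" "pconst R - (\<Sum>i<n. pvar i * pvar i) \<in> M" using arch by blast
  \<comment> \<open>The square of \<open>max R 1\<close> dominates \<open>R\<close>, also for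
    \<open>R < 1\<close>.\<close>
  let ?N = "max R 1"
  have "pconst R - (\<Sum>i<n. pvar i * pvar i) + (\<Sum>j\<in>{..<n}-{i}. pvar j * pvar j) \<in> M"
    by (intro add_mem R sum_mem square_mem) auto
  also have "pconst R - (\<Sum>i<n. pvar i * pvar i) + (\<Sum>j\<in>{..<n}-{i}. pvar j * pvar j) = pconst R + - (pvar i * pvar i)"
    using var by (subst sum.remove[of "{..<n}" i]) auto
  finally have "pconst (?N * ?N) + - (pvar i * pvar i) \<in> M"
    by (rule pconst_mono) (use R mult_left_mono[of 1 ?N ?N] in auto)
  then have 1: "pconst (?N * ?N) - pvar i * pvar i \<in> M" by simp
  have "pconst ?N - pvar i \<in> M" "pconst ?N - - pvar i \<in> M"
    by (rule bounded_of_square; use R var 1 in auto)+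
  then show ?case using R by (intro exI[of _ ?N]) auto
next
  case (add p q)
  then obtain N K where "N > 0" "K > 0" and *: "pconst N - p \<in> M" "pconst N + p \<in> M" "pconst K - q \<in> M" "pconst K + q \<in> M"
    by blast
  then show ?case
    using add_mem[OF *(1,3)] add_mem[OF *(2,4)]
    by (intro exI[of _ "N + K"]) (auto simp: algebra_simps pconst_add)
next
  case (mult p q)
  then obtain N K where NK: "N > 0" "K > 0" and *: "pconst N - p \<in> M" "pconst N + p \<in> M" "pconst K - q \<in> M" "pconst K + q \<in> M"
    by blast
  \<comment> \<open>Polarisation: \<open>4 p q\<close> is the difference of the squares of
    \<open>p + q\<close> and \<open>p - q\<close>. One of these squares is bounded by
    \<open>?e\<close>, the other one lies in \<open>M\<close>.\<close>
  let ?e = "pconst ((N + K) * (N + K))"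
  have "pconst ((N + K) * (N + K)) - (p + q) * (p + q) \<in> M"
    by (rule bounded_square) (use NK mult add_mem[OF *(1,3)] add_mem[OF *(2,4)] in \<open>auto simp: algebra_simps pconst_add\<close>)
  then have 1: "?e - (p + q) * (p + q) + (p - q) * (p - q) \<in> M"
    using mult by (intro add_mem square_mem) auto
  have "pconst ((N + K) * (N + K)) - (p - q) * (p - q) \<in> M"
    by (rule bounded_square) (use NK mult add_mem[OF *(1,4)] add_mem[OF *(2,3)] in \<open>auto simp: algebra_simps pconst_add\<close>)
  then have 2: "?e - (p - q) * (p - q) + (p + q) * (p + q) \<in> M"
    using mult by (intro add_mem square_mem) auto
  have q4: "pconst (1/4) * (4 * x) = x" for x :: rpoly
    using pconst_mult[of "1/4" 4] by (simp add: pconst_numeral flip: mult.assoc)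
  have e4: "pconst (1/4) * ?e = pconst ((N + K) * (N + K) / 4)"
    by (simp flip: pconst_mult)
  have "pconst (1/4) * (?e - (p + q) * (p + q) + (p - q) * (p - q)) = pconst ((N + K) * (N + K) / 4) - p * q"
    using q4[of "p * q"] unfolding e4[symmetric] by (simp add: algebra_simps)
  moreover have "pconst (1/4) * (?e - (p - q) * (p - q) + (p + q) * (p + q)) = pconst ((N + K) * (N + K) / 4) + p * q"
    using q4[of "p * q"] unfolding e4[symmetric] by (simp add: algebra_simps)
  ultimately show ?case
    using scale_mem[OF _ 1, of "1/4"] scale_mem[OF _ 2, of "1/4"] NK
    by (intro exI[of _ "(N + K) * (N + K) / 4"]) auto
qed

end

section \<open>Maximal proper modules and the points they define\<close>

definition nonneg_set :: "nat \<Rightarrow> rpoly set \<Rightarrow> (nat \<Rightarrow> real) set" where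
  "nonneg_set n M = {x \<in> pts n. \<forall>m\<in>M. 0 \<le> peval m x}"

locale maximal_module = archimedean_module +
  assumes proper: "- 1 \<notin> M"
    and maximal: "quadratic_module n Q \<Longrightarrow> M \<subseteq> Q \<Longrightarrow> - 1 \<notin> Q \<Longrightarrow> Q = M"
begin

text \<open>If both signs failed, adjoining each of them would produce \<open>- 1\<close>. Weighting
  the two representations by \<open>s2\<close> and \<open>s1\<close> cancels the terms with
  \<open>a\<close>, which puts \<open>- s1\<close> into \<open>M\<close>; then \<open>s1\<close> is
  in the support, so \<open>a * s1\<close> and finally \<open>- 1\<close> lie in
  \<open>M\<close>.\<close>

lemma total:
  assumes a: "is_poly n a"
  shows "a \<in> M \<or> - a \<in> M"
proof (rule ccontr)
  have sep: "\<exists>m s. m \<in> M \<and> sos n s \<and> - 1 = m + b * s" if "b \<notin> M" "is_poly n b" for b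
  proof -
    have "- 1 \<in> {m + b * s | m s. m \<in> M \<and> sos n s}"
      using maximal[OF adjoin[OF that(2)] adjoin_superset] adjoin_mem[of b] that(1) by blast
    then show ?thesis by blast
  qed
  assume "\<not> (a \<in> M \<or> - a \<in> M)"
  then obtain q1 s1 q2 s2 where 1: "q1 \<in> M" "sos n s1" "- 1 = q1 + a * s1"
    and 2: "q2 \<in> M" "sos n s2" "- 1 = q2 + (- a) * s2"
    using sep[of a] sep[of "- a"] a by auto
  have "s2 * q1 + s1 * q2 + s2 \<in> M"
    using 1 2 by (intro add_mem[OF add_mem] sos_mult_mem) (auto intro: sos_mem)
  also have "s2 * q1 + s1 * q2 + s2 = s2 * (q1 + a * s1) + s1 * (q2 + (- a) * s2) + s2"
    by (simp add: algebra_simps)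
  also have "\<dots> = - s1"
    unfolding 1(3)[symmetric] 2(3)[symmetric] by simp
  finally have "- s1 \<in> M" .
  then have "a * s1 \<in> M"
    using a sos_mem[OF 1(2)] by (intro supp_mult) auto
  then have "- 1 \<in> M" using add_mem[OF 1(1)] 1(3) by simp
  with proper show False ..
qed

text \<open>In a maximal proper module every polynomial has a value: the cut it makes in the constants.\<close>

definition has_value :: "rpoly \<Rightarrow> real \<Rightarrow> bool" where
  "has_value a t \<longleftrightarrow> is_poly n a \<and> (\<forall>\<epsilon>>0. pconst (\<epsilon> - t) + a \<in> M \<and> pconst (\<epsilon> + t) - a \<in> M)"

lemma pconst_mem_iff: "pconst c \<in> M \<longleftrightarrow> c \<ge> 0"
  using neg_one_mem[of c] pconst_mem[of c] proper by force

lemma has_value_exists: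
  assumes a: "is_poly n a"
  shows "\<exists>t. has_value a t"
proof -
  obtain N where N: "pconst N - a \<in> M" "pconst N + a \<in> M"
    using bounded[OF a] by blast
  \<comment> \<open>The lower cut of \<open>a\<close>. By totality a constant above the supremum
    satisfies the opposite membership, so the supremum is a value from both sides.\<close>
  let ?S = "{r. a - pconst r \<in> M}"
  have ne: "- N \<in> ?S"
    using N by (simp add: pconst_uminus add.commute)
  have bdd: "r \<le> N" if "r \<in> ?S" for r
    using add_mem[OF N(1), of "a - pconst r"] that by (simp add: pconst_mem_iff flip: pconst_diff)
  have bdd': "bdd_above ?S" using bdd by (auto simp: bdd_above_def)
  have "has_value a (Sup ?S)"
    unfolding has_value_def
  proof (intro conjI allI impI)
    fix e :: real assume e: "e > 0"
    obtain r where r: "r \<in> ?S" "r > Sup ?S - e"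
      using less_cSup_iff[OF _ bdd', of "Sup ?S - e"] ne e by (metis diff_less_eq empty_iff less_add_same_cancel1)
    have "pconst (- r) + a \<in> M" using r(1) by (simp add: pconst_uminus)
    then show "pconst (e - Sup ?S) + a \<in> M"
      by (rule pconst_mono) (use r in auto)
    have "Sup ?S + e \<notin> ?S"
      using cSup_upper[OF _ bdd', of "Sup ?S + e"] e by auto
    then have "- (a - pconst (Sup ?S + e)) \<in> M"
      using total[of "a - pconst (Sup ?S + e)"] a by auto
    then show "pconst (e + Sup ?S) - a \<in> M" by (simp add: add.commute)
  qed (rule a)
  then show ?thesis ..
qed

lemma has_value_pconst: "has_value (pconst c) c"
  by (auto simp: has_value_def pconst_mem_iff simp flip: pconst_add pconst_diff)

lemma has_value_add:
  assumes "has_value a s" "has_value b t"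
  shows "has_value (a + b) (s + t)"
  unfolding has_value_def
proof (intro conjI allI impI)
  fix e :: real assume "e > 0"
  then have "pconst (e/2 - s) + a \<in> M" "pconst (e/2 + s) - a \<in> M" "pconst (e/2 - t) + b \<in> M" "pconst (e/2 + t) - b \<in> M"
    using assms by (auto simp: has_value_def)
  note * = add_mem[OF this(1,3)] add_mem[OF this(2,4)]
  have eqs: "e/2 - s + (e/2 - t) = e - (s + t)" "e/2 + s + (e/2 + t) = e + (s + t)" by auto
  have "pconst (e/2 - s) + a + (pconst (e/2 - t) + b) = pconst (e/2 - s) + pconst (e/2 - t) + (a + b)"
       "pconst (e/2 + s) - a + (pconst (e/2 + t) - b) = pconst (e/2 + s) + pconst (e/2 + t) - (a + b)"
    by (simp_all add: algebra_simps)
  then show "pconst (e - (s + t)) + (a + b) \<in> M" "pconst (e + (s + t)) - (a + b) \<in> M"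
    using * by (simp_all only: eqs flip: pconst_add)
qed (use assms in \<open>auto simp: has_value_def\<close>)

lemma has_value_uminus: "has_value a s \<Longrightarrow> has_value (- a) (- s)"
  by (auto simp: has_value_def)

lemma has_value_scale:
  assumes "has_value a s"
  shows "has_value (pconst c * a) (c * s)"
proof -
  have pos: "has_value (pconst c * a) (c * s)" if c: "c > 0" for c
    unfolding has_value_def
  proof (intro conjI allI impI)
    fix e :: real assume "e > 0"
    then have "pconst (e/c - s) + a \<in> M" "pconst (e/c + s) - a \<in> M"
      using assms c by (auto simp: has_value_def)
    from this[THEN scale_mem[rotated], of c] c
    show "pconst (e - c * s) + pconst c * a \<in> M" "pconst (e + c * s) - pconst c * a \<in> M"
      by (simp_all add: distrib_left right_diff_distrib flip: pconst_mult)
  qed (use assms in \<open>auto simp: has_value_def\<close>)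
  consider "c > 0" | "c = 0" | "c < 0" by linarith
  then show ?thesis
  proof cases
    case 1 then show ?thesis by (rule pos)
  next
    case 2 then show ?thesis using has_value_pconst[of 0] by simp
  next
    case 3
    then have "has_value (pconst (- c) * a) (- c * s)" by (intro pos) simp
    from has_value_uminus[OF this] show ?thesis by (simp add: pconst_uminus)
  qed
qed

text \<open>The bound \<open>sqrt e\<close> on \<open>a\<close> yields the bound \<open>e\<close> on
  \<open>a * a\<close>. Centring at the value extends this to all squares, and polarisation extends
  it to products.\<close>

lemma has_value_square_0:
  assumes "has_value a 0"
  shows "has_value (a * a) 0"
  unfolding has_value_def
proof (intro conjI allI impI)
  have a: "is_poly n a" using assms by (simp add: has_value_def)
  then show "is_poly n (a * a)" by simp
  fix e :: real assume e: "e > 0"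
  show "pconst (e - 0) + a * a \<in> M"
    using e a by (intro add_mem square_mem pconst_mem) auto
  have "pconst (sqrt e * sqrt e) - a * a \<in> M"
    by (rule bounded_square) (use e a assms in \<open>auto simp: has_value_def\<close>)
  then show "pconst (e + 0) - a * a \<in> M" using e by simp
qed

lemma has_value_square:
  assumes a: "has_value a s"
  shows "has_value (a * a) (s * s)"
proof -
  have "has_value (a + pconst (- s)) (s + (- s))"
    by (intro has_value_add has_value_pconst a)
  then have "has_value ((a + pconst (- s)) * (a + pconst (- s))) 0"
    by (intro has_value_square_0) auto
  then have "has_value ((a + pconst (- s)) * (a + pconst (- s)) + pconst (2 * s) * a + pconst (- (s * s))) (0 + (2 * s) * s + (- (s * s)))"
    by (intro has_value_add has_value_scale has_value_pconst a)
  also have "(a + pconst (- s)) * (a + pconst (- s)) + pconst (2 * s) * a + pconst (- (s * s)) = a * a"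
    by (simp add: algebra_simps pconst_uminus pconst_mult pconst_numeral)
  finally show ?thesis by simp
qed

lemma has_value_mult:
  assumes a: "has_value a s" and b: "has_value b t"
  shows "has_value (a * b) (s * t)"
proof -
  let ?v = "\<lambda>a b. pconst (1/4) * ((a + b) * (a + b) + - ((a + - b) * (a + - b)))"
  have "has_value (?v a b) ((1/4) * ((s + t) * (s + t) + - ((s + - t) * (s + - t))))"
    by (intro has_value_scale has_value_add has_value_uminus has_value_square a b)
  also have "?v a b = pconst (1/4) * (pconst 4 * (a * b))"
    by (simp add: algebra_simps pconst_numeral)
  also have "\<dots> = a * b" by (simp flip: mult.assoc pconst_mult)
  also have "(1/4) * ((s + t) * (s + t) + - ((s + - t) * (s + - t))) = s * t"
    by (simp add: algebra_simps)
  finally show ?thesis .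
qed

text \<open>The values of the variables are the coordinates of a point. Values respect sums and
  products, so every polynomial has its evaluation at this point as value; a member with negative
  evaluation would put a negative constant into \<open>M\<close>.\<close>

lemma nonneg_set_nonempty: "nonneg_set n M \<noteq> {}"
proof -
  define x where "x i = (if i < n then SOME t. has_value (pvar i) t else 0)" for i
  have x: "has_value (pvar i) (x i)" if "i < n" for i
    using someI_ex[OF has_value_exists[OF is_poly_pvar[OF that]]] that by (simp add: x_def)
  have val: "has_value p (peval p x)" if "is_poly n p" for p
    using that by (induction rule: is_poly_induct) (auto intro: x has_value_pconst has_value_add has_value_mult)
  have "0 \<le> peval m x" if m: "m \<in> M" for m
  proof (rule ccontr)
    assume neg: "\<not> 0 \<le> peval m x"
    define e where "e = - peval m x / 2"
    have "e > 0" "e + peval m x < 0" using neg by (auto simp: e_def)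
    then have "pconst (e + peval m x) - m \<in> M"
      using val[OF is_polyD[OF m]] by (auto simp: has_value_def)
    from add_mem[OF this m] have "e + peval m x \<ge> 0" by (simp add: pconst_mem_iff)
    with \<open>e + peval m x < 0\<close> show False by simp
  qed
  moreover have "x \<in> pts n" by (simp add: pts_def x_def)
  ultimately show ?thesis by (auto simp: nonneg_set_def)
qed

end

context archimedean_module
begin

text \<open>Zorn's lemma extends \<open>M\<close> to a maximal module without \<open>- 1\<close>,
  and a larger module has a smaller nonnegativity set.\<close>

lemma nonneg_set_nonempty:
  assumes proper: "- 1 \<notin> M"
  shows "nonneg_set n M \<noteq> {}"
proof -
  let ?A = "{Q. quadratic_module n Q \<and> M \<subseteq> Q \<and> - 1 \<notin> Q}"
  have "?A \<noteq> {}" using quadratic_module_axioms proper by blast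
  moreover have "\<Union>C \<in> ?A" if "C \<noteq> {}" "subset.chain ?A C" for C
  proof -
    have C: "quadratic_module n Q" "M \<subseteq> Q" "- 1 \<notin> Q" if "Q \<in> C" for Q
      using that \<open>subset.chain ?A C\<close> by (auto simp: subset.chain_def)
    have two: "\<exists>Q\<in>C. a \<in> Q \<and> b \<in> Q" if "a \<in> \<Union>C" "b \<in> \<Union>C" for a b
    proof -
      from that obtain Q1 Q2 where "Q1 \<in> C" "a \<in> Q1" "Q2 \<in> C" "b \<in> Q2" by blast
      moreover have "Q1 \<subseteq> Q2 \<or> Q2 \<subseteq> Q1"
        using \<open>subset.chain ?A C\<close> \<open>Q1 \<in> C\<close> \<open>Q2 \<in> C\<close> by (auto simp: subset.chain_def)
      ultimately show ?thesis by blast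
    qed
    have "quadratic_module n (\<Union>C)"
    proof
      show "is_poly n m" if "m \<in> \<Union>C" for m
        using that C(1) quadratic_module.is_polyD by blast
      show "1 \<in> \<Union>C"
        using \<open>C \<noteq> {}\<close> C(1) quadratic_module.one_mem by blast
      show "a + b \<in> \<Union>C" if "a \<in> \<Union>C" "b \<in> \<Union>C" for a b
        using two[OF that] C(1) quadratic_module.add_mem by blast
      show "a * a * m \<in> \<Union>C" if "is_poly n a" "m \<in> \<Union>C" for a m
        using that C(1) quadratic_module.square_mult_mem by blast
    qed
    then show ?thesis using C \<open>C \<noteq> {}\<close> by blast
  qed
  ultimately obtain Q where Q: "Q \<in> ?A" and max: "\<forall>X\<in>?A. Q \<subseteq> X \<longrightarrow> X = Q"
    using subset_Zorn_nonempty[of ?A] by blast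
  interpret Q: quadratic_module n Q using Q by blast
  interpret Q: maximal_module n Q
  proof
    show "\<exists>R>0. pconst R - (\<Sum>i<n. pvar i * pvar i) \<in> Q" using arch Q by blast
    show "- 1 \<notin> Q" using Q by blast
    show "X = Q" if "quadratic_module n X" "Q \<subseteq> X" "- 1 \<notin> X" for X
      using max that Q by blast
  qed
  show ?thesis
    using Q.nonneg_set_nonempty Q by (auto simp: nonneg_set_def)
qed

text \<open>If the extension by \<open>- p\<close> were proper, it would have a point in the
  nonnegativity set of \<open>M\<close> at which \<open>p\<close> is not positive. So it contains
  \<open>- 1\<close>, which gives a sum of squares \<open>s\<close> with \<open>s * p - 1\<close> in
  \<open>M\<close>. The factor \<open>s\<close> is then removed by lowering a constant
  \<open>r\<close> with \<open>r + p\<close> in \<open>M\<close> down to 0.\<close>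

theorem positivstellensatz:
  assumes p: "is_poly n p" and pos: "\<And>x. x \<in> nonneg_set n M \<Longrightarrow> peval p x > 0"
  shows "p \<in> M"
proof -
  let ?Q = "{m + (- p) * s | m s. m \<in> M \<and> sos n s}"
  interpret Q: quadratic_module n ?Q by (rule adjoin) (simp add: p)
  interpret Q: archimedean_module n ?Q
    by standard (use arch adjoin_superset in blast)
  have "- 1 \<in> ?Q"
  proof (rule ccontr)
    assume "- 1 \<notin> ?Q"
    then obtain x where x: "x \<in> nonneg_set n ?Q" using Q.nonneg_set_nonempty by blast
    then have "x \<in> nonneg_set n M" using adjoin_superset[of "- p"] by (auto simp: nonneg_set_def)
    moreover have "0 \<le> peval (- p) x"
      using x adjoin_mem[of "- p"] unfolding nonneg_set_def by blast
    ultimately show False using pos[of x] by simp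
  qed
  then obtain m s where m: "m \<in> M" and s: "sos n s" and eq: "- 1 = m + (- p) * s" by blast
  have "p * s - 1 = m" using eq by (simp add: algebra_simps eq_diff_eq)
  then have ps: "s * p - 1 \<in> M" using m by (simp add: mult.commute)
  have sp: "is_poly n s" using s by (rule sos_is_poly)
  obtain r0 where r0: "r0 > 0" "pconst r0 + p \<in> M" using bounded[OF p] by blast
  obtain N where N: "N > 0" "pconst N - s * s * (pconst r0 + p) \<in> M"
    using bounded[of "s * s * (pconst r0 + p)"] p sp by auto
  \<comment> \<open>Chosen so that \<open>N - 2 * k = - 1\<close>, the constant that survives in the
    identity for one step.\<close>
  define k where "k = (N + 1) / 2"
  have k: "k > 0" using N by (simp add: k_def)
  have kN: "pconst N = 2 * pconst k - 1"
  proof -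
    have "N = k + k - 1" by (simp add: k_def)
    then show ?thesis by (simp only: pconst_add pconst_diff pconst_1 mult_2)
  qed
  txt \<open>The decrement \<open>1 / k\<^sup>2\<close> is the same for all \<open>r\<close>, so finitely many steps bring the constant down to \<open>0\<close>.\<close>
  have step: "pconst (r - 1 / (k * k)) + p \<in> M" if r: "0 \<le> r" "r \<le> r0" "pconst r + p \<in> M" for r
  proof -
    let ?k = "pconst k" and ?r = "pconst r" and ?t = "pconst r0"
    have "pconst N - s * s * (?t + p) + s * s * pconst (r0 - r) \<in> M"
      using r by (intro add_mem N(2) square_mult_mem pconst_mem) (auto simp: sp)
    \<comment> \<open>Expanding \<open>(k - s)^2 (r + p)\<close>, the part linear in
      \<open>s\<close> is cancelled by \<open>2 k (s p - 1)\<close> and \<open>2 k r s\<close>. The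
      part quadratic in \<open>s\<close> is cancelled by the bound \<open>N - s^2 (r0 + p)\<close>
      together with \<open>s^2 (r0 - r)\<close>.\<close>
    then have "(?k - s) * (?k - s) * (?r + p) + (pconst (2 * k) * (s * p - 1) + (pconst (2 * k * r) * s
      + (pconst N - s * s * (?t + p) + s * s * pconst (r0 - r)))) \<in> M"
      using r k by (intro add_mem[OF square_mult_mem[OF _ r(3)] add_mem[OF scale_mem[OF _ ps] add_mem[OF scale_mem[OF _ sos_mem[OF s]]]]]) (auto simp: sp)
    also have "(?k - s) * (?k - s) * (?r + p) + (pconst (2 * k) * (s * p - 1) + (pconst (2 * k * r) * s
      + (pconst N - s * s * (?t + p) + s * s * pconst (r0 - r)))) = pconst (k * k) * (?r + p) - 1"
      unfolding kN pconst_diff pconst_mult pconst_numeral by (simp add: algebra_simps)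
    finally have "pconst (1 / (k * k)) * (pconst (k * k) * (?r + p) - 1) \<in> M"
      using k by (intro scale_mem) auto
    also have "pconst (1 / (k * k)) * (pconst (k * k) * (?r + p) - 1) = pconst (r - 1 / (k * k)) + p"
      using k by (simp add: right_diff_distrib pconst_diff flip: mult.assoc pconst_mult)
    finally show ?thesis .
  qed
  have kk: "1 / (k * k) > 0" using k by (intro divide_pos_pos mult_pos_pos) auto
  have iter: "pconst (max 0 (r0 - real j / (k * k))) + p \<in> M" for j
  proof (induction j)
    case 0 then show ?case using r0 by simp
  next
    case (Suc j)
    have "pconst (max 0 (r0 - real j / (k * k)) - 1 / (k * k)) + p \<in> M"
      by (rule step) (use r0 k Suc in auto)
    moreover have "real (Suc j) / (k * k) = 1 / (k * k) + real j / (k * k)"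
      by (simp add: add_divide_distrib)
    then have "max 0 (r0 - real j / (k * k)) - 1 / (k * k) \<le> max 0 (r0 - real (Suc j) / (k * k))"
      using kk by linarith
    ultimately show ?case by (rule pconst_mono)
  qed
  obtain j :: nat where "real j \<ge> r0 * (k * k)" using real_arch_simple by blast
  then have "r0 - real j / (k * k) \<le> 0" using k by (simp add: field_simps)
  then show ?thesis using iter[of j] by (simp add: max_absorb1)
qed

end

subsection \<open>Positive semidefinite forms and second order vanishing\<close>

text \<open>For small \<open>s\<close> of the sign opposite to \<open>\<beta>\<close> the linear
  term would dominate. It is applied to isotropic vectors of a semidefinite form and to polynomials
  on which a moment functional degenerates.\<close>

lemma linear_term_eq_0:
  fixes \<beta> \<gamma> :: real
  assumes "\<And>s. 0 \<le> 2 * s * \<beta> + s * s * \<gamma>"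
  shows "\<beta> = 0"
proof (rule ccontr)
  assume b: "\<beta> \<noteq> 0"
  define d where "d = \<bar>\<gamma>\<bar> + 1"
  have d: "d > 0" "\<gamma> < d" by (auto simp: d_def)
  have "2 * (- \<beta> / d) * \<beta> + (- \<beta> / d) * (- \<beta> / d) * \<gamma> = \<beta> * \<beta> / (d * d) * (\<gamma> - 2 * d)"
    using d by (simp add: field_simps)
  also have "\<dots> < 0"
  proof (rule mult_pos_neg)
    have "\<beta> * \<beta> > 0" using b not_real_square_gt_zero by blast
    then show "\<beta> * \<beta> / (d * d) > 0" using d by simp
  qed (use d in simp)
  finally show False using assms[of "- \<beta> / d"] by simp
qed

definition bil :: "nat \<Rightarrow> (nat \<Rightarrow> nat \<Rightarrow> real) \<Rightarrow> (nat \<Rightarrow> real) \<Rightarrow> (nat \<Rightarrow> real) \<Rightarrow> real" where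
  "bil n b x y = (\<Sum>i<n. \<Sum>j<n. b i j * x i * y j)"

definition psd_form :: "nat \<Rightarrow> (nat \<Rightarrow> nat \<Rightarrow> real) \<Rightarrow> bool" where
  "psd_form n b \<longleftrightarrow> (\<forall>i<n. \<forall>j<n. b i j = b j i) \<and> (\<forall>h. 0 \<le> bil n b h h)"

lemma bil_add_left: "bil n b (\<lambda>i. x i + x' i) y = bil n b x y + bil n b x' y"
  by (simp add: bil_def algebra_simps sum.distrib)

lemma bil_add_right: "bil n b x (\<lambda>i. y i + y' i) = bil n b x y + bil n b x y'"
  by (simp add: bil_def algebra_simps sum.distrib)

lemma bil_scale_left: "bil n b (\<lambda>i. s * x i) y = s * bil n b x y"
  by (simp add: bil_def sum_distrib_left algebra_simps)

lemma bil_scale_right: "bil n b x (\<lambda>i. s * y i) = s * bil n b x y"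
  by (simp add: bil_def sum_distrib_left algebra_simps)

lemma bil_commute:
  assumes "\<forall>i<n. \<forall>j<n. b i j = b j i"
  shows "bil n b x y = bil n b y x"
proof -
  have "bil n b x y = (\<Sum>j<n. \<Sum>i<n. b i j * x i * y j)"
    unfolding bil_def by (rule sum.swap)
  also have "\<dots> = bil n b y x"
    unfolding bil_def using assms by (intro sum.cong refl) auto
  finally show ?thesis .
qed

lemma bil_quadratic:
  assumes "\<forall>i<n. \<forall>j<n. b i j = b j i"
  shows "bil n b (\<lambda>i. x i + s * y i) (\<lambda>i. x i + s * y i) = bil n b x x + 2 * s * bil n b y x + s * s * bil n b y y"
  by (simp add: bil_add_left bil_add_right bil_scale_left bil_scale_right bil_commute[OF assms, of x y] algebra_simps)

lemma psd_form_isotropic: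
  assumes "psd_form n b" "bil n b x x = 0"
  shows "bil n b y x = 0"
proof (rule linear_term_eq_0)
  fix s
  have "0 \<le> bil n b (\<lambda>i. x i + s * y i) (\<lambda>i. x i + s * y i)"
    using assms(1) by (simp add: psd_form_def)
  also have "\<dots> = 2 * s * bil n b y x + s * s * bil n b y y"
    using assms by (subst bil_quadratic) (auto simp: psd_form_def)
  finally show "0 \<le> 2 * s * bil n b y x + s * s * bil n b y y" .
qed

lemma bil_unit_left: "k < n \<Longrightarrow> bil n b (\<lambda>i. of_bool (i = k)) y = (\<Sum>j<n. b k j * y j)"
proof -
  assume k: "k < n"
  have "bil n b (\<lambda>i. of_bool (i = k)) y = (\<Sum>i<n. if k = i then \<Sum>j<n. b i j * y j else 0)"
    unfolding bil_def by (intro sum.cong refl) auto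
  then show ?thesis using k by simp
qed

lemma bil_unit: "k < n \<Longrightarrow> l < n \<Longrightarrow> bil n b (\<lambda>i. of_bool (i = k)) (\<lambda>i. of_bool (i = l)) = b k l"
  by (simp only: bil_unit_left) (simp add: of_bool_def if_distrib cong: if_cong)

text \<open>Cholesky elimination, one row at a time.\<close>

lemma psd_form_decomp:
  assumes a: "psd_form n a"
  shows "\<exists>l. \<forall>i<n. \<forall>j<n. a i j = (\<Sum>k<n. l k i * l k j)"
proof -
  have "\<exists>l b. (\<forall>i<n. \<forall>j<n. a i j = (\<Sum>t<k. l t i * l t j) + b i j) \<and> psd_form n b \<and> (\<forall>i<k. \<forall>j<n. b i j = 0)"
    if "k \<le> n" for k
    using that
  proof (induction k)
    case 0
    then show ?case using a by (intro exI[of _ "\<lambda>_ _. 0"] exI[of _ a]) auto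
  next
    case (Suc k)
    then obtain l b where eq: "\<And>i j. i < n \<Longrightarrow> j < n \<Longrightarrow> a i j = (\<Sum>t<k. l t i * l t j) + b i j"
      and b: "psd_form n b" and z: "\<And>i j. i < k \<Longrightarrow> j < n \<Longrightarrow> b i j = 0" and k: "k < n"
      by (metis Suc_leD Suc_le_lessD)
    have sym: "\<And>i j. i < n \<Longrightarrow> j < n \<Longrightarrow> b i j = b j i" using b by (auto simp: psd_form_def)
    let ?e = "\<lambda>i. of_bool (i = k) :: real"
    show ?case
    proof (cases "b k k = 0")
      case True
      \<comment> \<open>A zero pivot means that the unit vector is isotropic, so its whole row
        vanishes already and nothing has to be eliminated.\<close>
      have "b k j = 0" if "j < n" for j
        using psd_form_isotropic[OF b, of ?e "\<lambda>i. of_bool (i = j)"] True bil_unit[OF k k, of b] bil_unit[OF that k, of b]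
          sym[OF k that] by simp
      then show ?thesis
        using eq b z by (intro exI[of _ "l(k := \<lambda>_. 0)"] exI[of _ b]) (auto simp: less_Suc_eq)
    next
      case False
      have "b k k \<ge> 0" using b bil_unit[OF k k, of b] unfolding psd_form_def by metis
      with False have pos: "b k k > 0" by simp
      \<comment> \<open>The Schur complement of the pivot. Its value at \<open>h\<close> is the
        value of \<open>b\<close> at \<open>h\<close> minus \<open>\<beta> / b k k\<close> times the
        unit vector, hence nonnegative.\<close>
      define b' where "b' i j = b i j - b k i * b k j / b k k" for i j
      have "psd_form n b'"
        unfolding psd_form_def
      proof (intro conjI allI impI)
        show "b' i j = b' j i" if "i < n" "j < n" for i j
          using sym[OF that] by (simp add: b'_def)
        fix h
        define \<beta> where "\<beta> = (\<Sum>j<n. b k j * h j)"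
        have \<beta>: "bil n b ?e h = \<beta>" using k by (simp add: bil_unit_left \<beta>_def)
        have "0 \<le> bil n b (\<lambda>i. h i + (- \<beta> / b k k) * ?e i) (\<lambda>i. h i + (- \<beta> / b k k) * ?e i)"
          using b by (simp add: psd_form_def)
        also have "\<dots> = bil n b h h + 2 * (- \<beta> / b k k) * \<beta> + (- \<beta> / b k k) * (- \<beta> / b k k) * b k k"
          by (subst bil_quadratic) (use sym in \<open>auto simp: \<beta> bil_unit[OF k k]\<close>)
        also have "\<dots> = bil n b h h - \<beta> * \<beta> / b k k"
          using pos by (simp add: field_simps)
        also have "\<beta> * \<beta> / b k k = (\<Sum>i<n. \<Sum>j<n. b k i * b k j / b k k * h i * h j)"
          unfolding \<beta>_def sum_product by (simp add: sum_divide_distrib algebra_simps)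
        also have "bil n b h h - \<dots> = bil n b' h h"
          unfolding bil_def b'_def by (simp add: sum_subtractf algebra_simps)
        finally show "0 \<le> bil n b' h h" .
      qed
      moreover have "b' i j = 0" if "i < Suc k" "j < n" for i j
      proof (cases "i = k")
        case True then show ?thesis using pos by (simp add: b'_def)
      next
        case False
        then have i: "i < k" using that by simp
        then show ?thesis using z[OF i that(2)] z[OF i k] sym[of k i] k by (simp add: b'_def)
      qed
      moreover define l' where "l' = l(k := \<lambda>i. b k i / sqrt (b k k))"
      have "a i j = (\<Sum>t<Suc k. l' t i * l' t j) + b' i j" if "i < n" "j < n" for i j
        using eq[OF that] pos by (simp add: b'_def l'_def)
      ultimately show ?thesis by (intro exI[of _ l'] exI[of _ b']) auto
    qed
  qed
  from this[of n] show ?thesis by fastforce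
qed

section \<open>Expansion of polynomials in coordinates centred at a point\<close>

definition xi :: "(nat \<Rightarrow> real) \<Rightarrow> nat \<Rightarrow> rpoly" where
  "xi u i = pvar i - pconst (u i)"

lemma peval_xi [simp]: "peval (xi u i) x = x i - of_real (u i)"
  by (simp add: xi_def)

lemma is_poly_xi [simp]: "i < n \<Longrightarrow> is_poly n (xi u i)"
  by (simp add: xi_def)

lemma pdiff_uminus [simp]: "pdiff i (- p) = - pdiff i p"
  using pdiff_add[of i p "- p"] by (simp add: eq_neg_iff_add_eq_0 add.commute del: pdiff_add)

lemma pdiff_diff [simp]: "pdiff i (p - q) = pdiff i p - pdiff i q"
  using pdiff_add[of i p "- q"] by simp

lemma pdiff_sum [simp]: "pdiff i (\<Sum>k\<in>I. h k) = (\<Sum>k\<in>I. pdiff i (h k))"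
  by (induction I rule: infinite_finite_induct) auto

lemma pdiff_1 [simp]: "pdiff i 1 = 0"
  using pdiff_pconst[of i 1] by simp

lemma pdiff_xi [simp]: "pdiff i (xi u j) = (if i = j then 1 else 0)"
  by (simp add: xi_def pdiff_pvar)

text \<open>Hadamard's lemma for polynomials. Products are handled by
  \<open>p q - p(u) q(u) = p(u) (q - q(u)) + (p - p(u)) q\<close>.\<close>

lemma vanish_expand:
  assumes "is_poly n p"
  shows "\<exists>b. (\<forall>i<n. is_poly n (b i)) \<and> p = pconst (peval p u) + (\<Sum>i<n. b i * xi u i)"
  using assms
proof (induction rule: is_poly_induct)
  case (const c)
  then show ?case by (intro exI[of _ "\<lambda>_. 0"]) auto
next
  case (var i)
  have "(\<Sum>j<n. (if i = j then 1 else 0) * xi u j) = (\<Sum>j<n. if i = j then xi u j else 0)"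
    by (intro sum.cong refl) auto
  then show ?case using var
    by (intro exI[of _ "\<lambda>j. if i = j then 1 else 0"]) (auto simp: xi_def)
next
  case (add p q)
  then obtain b c where "\<forall>i<n. is_poly n (b i)" "p = pconst (peval p u) + (\<Sum>i<n. b i * xi u i)"
    "\<forall>i<n. is_poly n (c i)" "q = pconst (peval q u) + (\<Sum>i<n. c i * xi u i)" by blast
  note h = this
  have "p + q = pconst (peval (p + q) u) + (\<Sum>i<n. (b i + c i) * xi u i)"
    by (subst h(2), subst h(4)) (simp add: pconst_add sum.distrib algebra_simps)
  then show ?case using h(1,3) by (intro exI[of _ "\<lambda>i. b i + c i"]) auto
next
  case (mult p q)
  then obtain b c where h: "\<forall>i<n. is_poly n (b i)" "p = pconst (peval p u) + (\<Sum>i<n. b i * xi u i)"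
    "\<forall>i<n. is_poly n (c i)" "q = pconst (peval q u) + (\<Sum>i<n. c i * xi u i)" by blast
  have "p * q = pconst (peval p u) * (q - pconst (peval q u)) + (p - pconst (peval p u)) * q + pconst (peval p u) * pconst (peval q u)"
    by (simp add: algebra_simps)
  also have "q - pconst (peval q u) = (\<Sum>i<n. c i * xi u i)" using h(4) by (simp add: algebra_simps)
  also have "p - pconst (peval p u) = (\<Sum>i<n. b i * xi u i)" using h(2) by (simp add: algebra_simps)
  finally have "p * q = pconst (peval (p * q) u) + (\<Sum>i<n. (pconst (peval p u) * c i + b i * q) * xi u i)"
    by (simp add: pconst_mult sum.distrib sum_distrib_left sum_distrib_right algebra_simps)
  then show ?case using h(1,3) mult by (intro exI[of _ "\<lambda>i. pconst (peval p u) * c i + b i * q"]) auto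
qed

lemma vanish_expand_0:
  assumes "is_poly n p" "peval p u = 0"
  obtains b where "\<And>i. i < n \<Longrightarrow> is_poly n (b i)" "p = (\<Sum>i<n. b i * xi u i)"
  using vanish_expand[OF assms(1), of u] assms(2) by auto

text \<open>Membership in the cube of the maximal ideal of the point \<open>u\<close>.\<close>

definition cubic :: "nat \<Rightarrow> (nat \<Rightarrow> real) \<Rightarrow> rpoly \<Rightarrow> bool" where
  "cubic n u R \<longleftrightarrow> (\<exists>C. (\<forall>i<n. \<forall>j<n. is_poly n (C i j) \<and> peval (C i j) u = 0) \<and>
     R = (\<Sum>i<n. \<Sum>j<n. C i j * (xi u i * xi u j)))"

lemma cubic_0 [simp]: "cubic n u 0"
  unfolding cubic_def by (intro exI[of _ "\<lambda>_ _. 0"]) auto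

lemma cubic_add: "cubic n u p \<Longrightarrow> cubic n u q \<Longrightarrow> cubic n u (p + q)"
  unfolding cubic_def
proof (elim exE conjE)
  fix C D
  assume "\<forall>i<n. \<forall>j<n. is_poly n (C i j) \<and> peval (C i j) u = 0" "p = (\<Sum>i<n. \<Sum>j<n. C i j * (xi u i * xi u j))"
     "\<forall>i<n. \<forall>j<n. is_poly n (D i j) \<and> peval (D i j) u = 0" "q = (\<Sum>i<n. \<Sum>j<n. D i j * (xi u i * xi u j))"
  then show "\<exists>C. (\<forall>i<n. \<forall>j<n. is_poly n (C i j) \<and> peval (C i j) u = 0) \<and> p + q = (\<Sum>i<n. \<Sum>j<n. C i j * (xi u i * xi u j))"
    by (intro exI[of _ "\<lambda>i j. C i j + D i j"]) (simp add: distrib_right sum.distrib)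
qed

lemma cubic_mult: "is_poly n p \<Longrightarrow> cubic n u q \<Longrightarrow> cubic n u (p * q)"
  unfolding cubic_def
proof (elim exE conjE)
  fix C
  assume "is_poly n p" "\<forall>i<n. \<forall>j<n. is_poly n (C i j) \<and> peval (C i j) u = 0" "q = (\<Sum>i<n. \<Sum>j<n. C i j * (xi u i * xi u j))"
  then show "\<exists>C. (\<forall>i<n. \<forall>j<n. is_poly n (C i j) \<and> peval (C i j) u = 0) \<and> p * q = (\<Sum>i<n. \<Sum>j<n. C i j * (xi u i * xi u j))"
    by (intro exI[of _ "\<lambda>i j. p * C i j"]) (simp add: sum_distrib_left mult.assoc)
qed

lemma cubic_uminus: "cubic n u p \<Longrightarrow> cubic n u (- p)"
  using cubic_mult[of n "pconst (-1)" u p] by (simp add: pconst_uminus)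

lemma cubic_diff: "cubic n u p \<Longrightarrow> cubic n u q \<Longrightarrow> cubic n u (p - q)"
  using cubic_add[of n u p "- q"] cubic_uminus[of n u q] by simp

lemma cubic_sum: "(\<And>i. i \<in> I \<Longrightarrow> cubic n u (h i)) \<Longrightarrow> cubic n u (\<Sum>i\<in>I. h i)"
  by (induction I rule: infinite_finite_induct) (auto intro: cubic_add)

text \<open>Two factors are expanded to supply the \<open>xi\<close>, and the third remains in the
  coefficient and makes it vanish at \<open>u\<close>.\<close>

lemma cubic_mult3:
  assumes "is_poly n a" "is_poly n b" "is_poly n c" "peval a u = 0" "peval b u = 0" "peval c u = 0"
  shows "cubic n u (a * b * c)"
proof -
  obtain A where A: "\<And>i. i < n \<Longrightarrow> is_poly n (A i)" "a = (\<Sum>i<n. A i * xi u i)"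
    using vanish_expand_0 assms(1,4) by metis
  obtain B where B: "\<And>i. i < n \<Longrightarrow> is_poly n (B i)" "b = (\<Sum>i<n. B i * xi u i)"
    using vanish_expand_0 assms(2,5) by metis
  have "a * b = (\<Sum>i<n. \<Sum>j<n. (A i * xi u i) * (B j * xi u j))"
    by (simp only: A(2) B(2) sum_product)
  then have "a * b * c = (\<Sum>i<n. \<Sum>j<n. (c * A i * B j) * (xi u i * xi u j))"
    by (simp add: sum_distrib_left mult_ac)
  then show ?thesis
    unfolding cubic_def using A B assms by (intro exI[of _ "\<lambda>i j. c * A i * B j"]) auto
qed

text \<open>Two expansions give coefficients \<open>c i j\<close> that need not be symmetric. The
  second derivatives at \<open>u\<close> only see \<open>c i j + c j i\<close>, which is why the
  second order hypothesis is a sum and why the symmetrised coefficients \<open>C\<close> are the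
  ones that vanish at \<open>u\<close>.\<close>

lemma cubicI:
  assumes R: "is_poly n R" "peval R u = 0"
    and d1: "\<And>i. i < n \<Longrightarrow> peval (pdiff i R) u = 0"
    and d2: "\<And>i j. i < n \<Longrightarrow> j < n \<Longrightarrow> peval (pdiff i (pdiff j R)) u + peval (pdiff j (pdiff i R)) u = 0"
  shows "cubic n u R"
proof -
  obtain b where b: "\<And>i. i < n \<Longrightarrow> is_poly n (b i)" "R = (\<Sum>i<n. b i * xi u i)"
    using vanish_expand_0[OF R] by metis
  have pb: "pdiff l R = b l + (\<Sum>i<n. pdiff l (b i) * xi u i)" if "l < n" for l
  proof -
    have "pdiff l R = (\<Sum>i<n. pdiff l (b i) * xi u i) + (\<Sum>i<n. b i * (if l = i then 1 else 0))"
      unfolding b(2) by (simp only: pdiff_sum pdiff_mult pdiff_xi sum.distrib)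
    moreover have "(\<Sum>i<n. b i * (if l = i then 1 else 0)) = b l"
      using that by (simp add: if_distrib cong: if_cong)
    ultimately show ?thesis by simp
  qed
  have b0: "peval (b l) u = 0" if "l < n" for l
    using d1[OF that] unfolding pb[OF that] by simp
  have "\<forall>i. \<exists>c. i < n \<longrightarrow> (\<forall>j<n. is_poly n (c j)) \<and> b i = (\<Sum>j<n. c j * xi u j)"
    using vanish_expand_0[OF b(1) b0] by metis
  then obtain c where c: "\<And>i j. i < n \<Longrightarrow> j < n \<Longrightarrow> is_poly n (c i j)" "\<And>i. i < n \<Longrightarrow> b i = (\<Sum>j<n. c i j * xi u j)"
    by metis
  have delta: "(\<Sum>i<n. a i * peval (if k = i then 1 else 0) u) = a k" if "k < n" for k and a :: "nat \<Rightarrow> real"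
  proof -
    have "(\<Sum>i<n. a i * peval (if k = i then 1 else 0) u) = (\<Sum>i<n. if k = i then a i else 0)"
      by (intro sum.cong refl) simp
    then show ?thesis using that by simp
  qed
  have dc: "peval (pdiff k (b i)) u = peval (c i k) u" if "i < n" "k < n" for i k
  proof -
    have "pdiff k (b i) = (\<Sum>j<n. pdiff k (c i j) * xi u j + c i j * (if k = j then 1 else 0))"
      unfolding c(2)[OF that(1)] by (simp only: pdiff_sum pdiff_mult pdiff_xi)
    then have "peval (pdiff k (b i)) u = (\<Sum>j<n. peval (c i j) u * peval (if k = j then 1 else 0) u)"
      by simp
    also have "\<dots> = peval (c i k) u" by (rule delta[OF that(2)])
    finally show ?thesis .
  qed
  have dd: "peval (pdiff k (pdiff l R)) u = peval (c l k) u + peval (c k l) u" if "k < n" "l < n" for k l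
  proof -
    have "pdiff k (pdiff l R) = pdiff k (b l) + (\<Sum>i<n. pdiff k (pdiff l (b i)) * xi u i + pdiff l (b i) * (if k = i then 1 else 0))"
      unfolding pb[OF that(2)] by (simp only: pdiff_add pdiff_sum pdiff_mult pdiff_xi)
    then have "peval (pdiff k (pdiff l R)) u = peval (pdiff k (b l)) u + (\<Sum>i<n. peval (pdiff l (b i)) u * peval (if k = i then 1 else 0) u)"
      by simp
    also have "\<dots> = peval (pdiff k (b l)) u + peval (pdiff l (b k)) u"
      by (simp only: delta[OF that(1)])
    also have "\<dots> = peval (c l k) u + peval (c k l) u"
      by (simp only: dc[OF that(1,2)] dc[OF that(2,1)])
    finally show ?thesis .
  qed
  have c0: "peval (c k l) u + peval (c l k) u = 0" if "k < n" "l < n" for k l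
    using d2[OF that] unfolding dd[OF that] dd[OF that(2,1)] by linarith
  define C where "C i j = pconst (1/2) * (c i j + c j i)" for i j
  have half: "pconst (1/2) * x + pconst (1/2) * x = x" for x
    by (simp flip: distrib_right pconst_add)
  have R2: "R = (\<Sum>i<n. \<Sum>j<n. c i j * (xi u i * xi u j))"
    unfolding b(2) by (intro sum.cong refl) (simp add: c(2) sum_distrib_left sum_distrib_right mult_ac)
  also have "\<dots> = (\<Sum>i<n. \<Sum>j<n. pconst (1/2) * (c i j * (xi u i * xi u j))) + (\<Sum>i<n. \<Sum>j<n. pconst (1/2) * (c i j * (xi u i * xi u j)))"
    by (simp only: half sum.distrib[symmetric])
  also have "(\<Sum>i<n. \<Sum>j<n. pconst (1/2) * (c i j * (xi u i * xi u j))) + (\<Sum>i<n. \<Sum>j<n. pconst (1/2) * (c i j * (xi u i * xi u j)))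
     = (\<Sum>i<n. \<Sum>j<n. pconst (1/2) * (c i j * (xi u i * xi u j))) + (\<Sum>j<n. \<Sum>i<n. pconst (1/2) * (c i j * (xi u i * xi u j)))"
    by (rule arg_cong2[where f = "(+)"], rule refl, rule sum.swap)
  also have "\<dots> = (\<Sum>i<n. \<Sum>j<n. C i j * (xi u i * xi u j))"
    unfolding sum.distrib[symmetric]
    by (intro sum.cong refl) (simp add: C_def algebra_simps)
  finally have "R = (\<Sum>i<n. \<Sum>j<n. C i j * (xi u i * xi u j))" .
  moreover have "is_poly n (C i j) \<and> peval (C i j) u = 0" if "i < n" "j < n" for i j
    using c(1)[OF that] c(1)[OF that(2,1)] c0[OF that] by (simp add: C_def)
  ultimately show ?thesis unfolding cubic_def by blast
qed

subsection \<open>Matrix rank and the Moore--Penrose inverse\<close>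

lemma mat_factor_through_cols:
  fixes X B :: "'a::field mat"
  assumes X: "X \<in> carrier_mat n k" and B: "B \<in> carrier_mat n r"
    and c: "\<And>j. j < k \<Longrightarrow> \<exists>c\<in>carrier_vec r. B *\<^sub>v c = col X j"
  shows "\<exists>C\<in>carrier_mat r k. X = B * C"
proof -
  obtain c where c: "\<And>j. j < k \<Longrightarrow> c j \<in> carrier_vec r" "\<And>j. j < k \<Longrightarrow> B *\<^sub>v c j = col X j"
    using c by metis
  let ?C = "mat_of_cols r (map c [0..<k])"
  have C: "?C \<in> carrier_mat r k" by (metis diff_zero length_map length_upt mat_of_cols_carrier(1))
  have colC: "col ?C j = c j" if "j < k" for j
    using that c(1) by simp
  have "X = B * ?C"
  proof (rule mat_col_eqI)
    fix j assume "j < dim_col (B * ?C)"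
    then have j: "j < k" using C by auto
    show "col X j = col (B * ?C) j"
      unfolding col_mult2[OF B C j] colC[OF j] c(2)[OF j] ..
  qed (use X B C in auto)
  then show ?thesis using C by blast
qed

lemma scalar_prod_self_eq_0:
  fixes v :: "real vec"
  assumes "v \<in> carrier_vec n" "v \<bullet> v = 0"
  shows "v = 0\<^sub>v n"
proof (rule eq_vecI)
  fix i assume "i < dim_vec (0\<^sub>v n :: real vec)"
  then have i: "i < n" by simp
  have "(\<Sum>i\<in>{0..<n}. v $ i * v $ i) = 0"
    using assms by (simp add: scalar_prod_def)
  then have "v $ i * v $ i = 0"
    using i by (subst (asm) sum_nonneg_eq_0_iff) auto
  then show "v $ i = 0\<^sub>v n $ i" using i by simp
qed (use assms in auto)

text \<open>\<open>B\<close> consists of a maximal independent set of columns of \<open>A\<close>.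
  The equation \<open>A = B * C\<close> serves upper bounds for ranks; \<open>B = A * S\<close> and
  injectivity of \<open>B\<close> relate the rank to the image of \<open>A\<close>.\<close>

lemma rank_factorization:
  fixes A :: "real mat"
  assumes A: "A \<in> carrier_mat n nc"
  defines "r \<equiv> vec_space.rank n A"
  obtains B C S where "B \<in> carrier_mat n r" "C \<in> carrier_mat r nc" "S \<in> carrier_mat nc r"
    "A = B * C" "B = A * S" "\<And>v. v \<in> carrier_vec r \<Longrightarrow> B *\<^sub>v v = 0\<^sub>v n \<Longrightarrow> v = 0\<^sub>v r"
proof -
  interpret vec_space "TYPE(real)" n .
  let ?P = "\<lambda>T. T \<subseteq> set (cols A) \<and> lin_indpt T"
  have cA: "set (cols A) \<subseteq> carrier_vec n" using cols_dim A by blast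
  have "lin_indpt {}" by (simp add: lin_dep_def)
  then obtain U where U: "finite U" "maximal U ?P"
    using maximal_exists_superset[of "set (cols A)" ?P "{}"] by auto
  have rU: "r = card U" unfolding r_def by (rule rank_card_indpt[OF A U(2)])
  have PU: "U \<subseteq> set (cols A)" "lin_indpt U" using U(2) by (auto simp: maximal_def)
  have cU: "U \<subseteq> carrier_vec n" using PU(1) cA by blast
  obtain us where us: "set us = U" "distinct us" using finite_distinct_list[OF U(1)] by blast
  have len: "length us = r" using us rU distinct_card by metis
  define B where "B = mat_of_cols n us"
  have B: "B \<in> carrier_mat n r" by (metis B_def len mat_of_cols_carrier(1))
  have colsB: "cols B = us" unfolding B_def using us cU by simp
  have span: "s \<in> span U" if "s \<in> set (cols A)" for s
  proof (cases "s \<in> U")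
    case True then show ?thesis using in_own_span[OF cU] by blast
  next
    case False
    have "lin_dep (U \<union> {s})"
      using U(2) False that PU(1) unfolding maximal_def by blast
    then show ?thesis
      using lin_dep_iff_in_span[of U s] PU cU cA that False by blast
  qed
  have "\<exists>c\<in>carrier_vec r. B *\<^sub>v c = col A j" if "j < nc" for j
  proof -
    have "col A j \<in> set (cols A)" using that A by (metis carrier_matD(2) cols_length cols_nth nth_mem)
    then obtain a where "lincomb a U = col A j"
      using finite_in_span[OF U(1) cU span] by auto
    then have "B *\<^sub>v vec r (\<lambda>i. a (col B i)) = col A j"
      using mat_mult_eq_lincomb[OF B, of a] colsB us by simp
    then show ?thesis by (metis vec_carrier)
  qed
  then obtain C where C: "C \<in> carrier_mat r nc" "A = B * C"
    using mat_factor_through_cols[OF A B] by blast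
  have "\<exists>c\<in>carrier_vec nc. A *\<^sub>v c = col B j" if "j < r" for j
  proof -
    have "col B j = us ! j" using that colsB B by (metis carrier_matD(2) cols_nth)
    then have "col B j \<in> set (cols A)" using that len PU(1) us(1) by auto
    then obtain i where i: "i < nc" "col B j = col A i"
      using A by (metis carrier_matD(2) cols_length cols_nth in_set_conv_nth)
    have "A *\<^sub>v unit_vec nc i = col A i"
      by (rule eq_vecI) (use A i in \<open>auto simp: scalar_prod_right_unit\<close>)
    then show ?thesis using i by (intro bexI[of _ "unit_vec nc i"]) auto
  qed
  then obtain S where S: "S \<in> carrier_mat nc r" "B = A * S"
    using mat_factor_through_cols[OF B A] by blast
  have inj: "v = 0\<^sub>v r" if "v \<in> carrier_vec r" "B *\<^sub>v v = 0\<^sub>v n" for v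
    using lin_depI[OF B that(1) _ that(2)] colsB us PU(2) by auto
  show ?thesis by (rule that[OF B C(1) S(1) C(2) S(2) inj])
qed


text \<open>A matrix with too few rows is padded with zero rows to a square one; its determinant
  vanishes, and a kernel vector of it contradicts injectivity.\<close>

lemma injective_mat_dim_le:
  fixes D :: "real mat"
  assumes D: "D \<in> carrier_mat r k" and inj: "\<And>v. v \<in> carrier_vec k \<Longrightarrow> D *\<^sub>v v = 0\<^sub>v r \<Longrightarrow> v = 0\<^sub>v k"
  shows "k \<le> r"
proof (rule ccontr)
  assume "\<not> k \<le> r"
  then have rk: "r < k" by simp
  define D' where "D' = mat k k (\<lambda>(i,j). if i < r then D $$ (i,j) else 0)"
  have D': "D' \<in> carrier_mat k k" by (simp add: D'_def)
  have "D'\<^sup>T *\<^sub>v unit_vec k r = 0\<^sub>v k"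
    by (rule eq_vecI) (use D' rk in \<open>auto simp: scalar_prod_right_unit D'_def\<close>)
  moreover have "unit_vec k r \<noteq> (0\<^sub>v k :: real vec)" using rk by simp
  ultimately have "det D'\<^sup>T = 0"
    using D' det_0_iff_vec_prod_zero_field[of "D'\<^sup>T" k] by (metis transpose_carrier_mat unit_vec_carrier)
  then have "det D' = 0" using Determinant.det_transpose[OF D'] by simp
  then obtain v where v: "v \<in> carrier_vec k" "v \<noteq> 0\<^sub>v k" "D' *\<^sub>v v = 0\<^sub>v k"
    using det_0_iff_vec_prod_zero_field[OF D'] by blast
  have "D *\<^sub>v v = 0\<^sub>v r"
  proof (rule eq_vecI)
    fix i assume "i < dim_vec (0\<^sub>v r :: real vec)"
    then have i: "i < r" by simp
    have "row D' i = row D i"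
      by (rule eq_vecI) (use i rk D D' in \<open>auto simp: D'_def\<close>)
    moreover have "(D' *\<^sub>v v) $ i = 0" using v(3) i rk by simp
    ultimately show "(D *\<^sub>v v) $ i = 0\<^sub>v r $ i" using i rk D D' by auto
  qed (use D in auto)
  then show False using inj v by blast
qed

lemma rank_mult_le:
  fixes B C :: "real mat"
  assumes B: "B \<in> carrier_mat n r" and C: "C \<in> carrier_mat r nc"
  shows "vec_space.rank n (B * C) \<le> r"
proof -
  let ?k = "vec_space.rank n (B * C)"
  have BC: "B * C \<in> carrier_mat n nc" using B C by auto
  obtain B' S where B': "B' \<in> carrier_mat n ?k" "S \<in> carrier_mat nc ?k" "B' = B * C * S"
    and inj: "\<And>v. v \<in> carrier_vec ?k \<Longrightarrow> B' *\<^sub>v v = 0\<^sub>v n \<Longrightarrow> v = 0\<^sub>v ?k"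
    using rank_factorization[OF BC] by metis
  have CS: "C * S \<in> carrier_mat r ?k" using C B' by auto
  have B'2: "B' = B * (C * S)" using B C B' by (metis assoc_mult_mat)
  show ?thesis
  proof (rule injective_mat_dim_le[OF CS])
    fix v :: "real vec" assume v: "v \<in> carrier_vec ?k" "(C * S) *\<^sub>v v = 0\<^sub>v r"
    have "B' *\<^sub>v v = B *\<^sub>v ((C * S) *\<^sub>v v)"
      unfolding B'2 by (rule assoc_mult_mat_vec[OF B CS v(1)])
    also have "\<dots> = 0\<^sub>v n" unfolding v(2) using B by (intro eq_vecI) auto
    finally show "v = 0\<^sub>v ?k" using inj v(1) by blast
  qed
qed

lemma symmetric_mat_adjoint:
  fixes A :: "real mat"
  assumes "A \<in> carrier_mat m m" "A\<^sup>T = A" "x \<in> carrier_vec m" "y \<in> carrier_vec m"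
  shows "(A *\<^sub>v x) \<bullet> y = x \<bullet> (A *\<^sub>v y)"
  using transpose_vec_mult_scalar[of A m m y x] assms by simp

text \<open>Since \<open>A * L = 0\<close>, the images of \<open>A\<close> and \<open>L\<close> are
  orthogonal, and by the rank condition they fill the space. A common kernel vector is orthogonal to
  both images, hence zero; and \<open>A x + L x = 0\<close> with orthogonal summands makes both of
  them vanish.\<close>

lemma complementary_sum_invertible:
  fixes A L :: "real mat"
  assumes A: "A \<in> carrier_mat m m" "A\<^sup>T = A" and L: "L \<in> carrier_mat m m" "L\<^sup>T = L"
    and AL: "A * L = 0\<^sub>m m m" and rk: "vec_space.rank m A + vec_space.rank m L = m"
  obtains S where "S \<in> carrier_mat m m" "(A + L) * S = 1\<^sub>m m" "S * (A + L) = 1\<^sub>m m"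
proof -
  have T: "A + L \<in> carrier_mat m m" using A L by auto
  have ALv: "A *\<^sub>v (L *\<^sub>v z) = 0\<^sub>v m" if "z \<in> carrier_vec m" for z
    using assoc_mult_mat_vec[OF A(1) L(1) that, symmetric] that unfolding AL by (auto intro!: eq_vecI)
  have ortho: "(A *\<^sub>v z) \<bullet> (L *\<^sub>v w) = 0" if "z \<in> carrier_vec m" "w \<in> carrier_vec m" for z w
    using symmetric_mat_adjoint[OF A that(1), of "L *\<^sub>v w"] ALv[OF that(2)] that L by simp
  have kerAL: "x = 0\<^sub>v m" if x: "x \<in> carrier_vec m" "A *\<^sub>v x = 0\<^sub>v m" "L *\<^sub>v x = 0\<^sub>v m" for x
  proof -
    let ?r1 = "vec_space.rank m A" and ?r2 = "vec_space.rank m L"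
    obtain B1 S1 where B1: "B1 \<in> carrier_mat m ?r1" "S1 \<in> carrier_mat m ?r1" "B1 = A * S1"
      and inj1: "\<And>v. v \<in> carrier_vec ?r1 \<Longrightarrow> B1 *\<^sub>v v = 0\<^sub>v m \<Longrightarrow> v = 0\<^sub>v ?r1"
      using rank_factorization[OF A(1)] by metis
    obtain B2 S2 where B2: "B2 \<in> carrier_mat m ?r2" "S2 \<in> carrier_mat m ?r2" "B2 = L * S2"
      and inj2: "\<And>v. v \<in> carrier_vec ?r2 \<Longrightarrow> B2 *\<^sub>v v = 0\<^sub>v m \<Longrightarrow> v = 0\<^sub>v ?r2"
      using rank_factorization[OF L(1)] by metis
    have B1v: "B1 *\<^sub>v y = A *\<^sub>v (S1 *\<^sub>v y)" "S1 *\<^sub>v y \<in> carrier_vec m" if "y \<in> carrier_vec ?r1" for y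
      using assoc_mult_mat_vec[OF A(1) B1(2) that] B1 that by auto
    have B2v: "B2 *\<^sub>v y = L *\<^sub>v (S2 *\<^sub>v y)" "S2 *\<^sub>v y \<in> carrier_vec m" if "y \<in> carrier_vec ?r2" for y
      using assoc_mult_mat_vec[OF L(1) B2(2) that] B2 that by auto
    let ?Z1 = "0\<^sub>m 0 ?r1 :: real mat" and ?Z2 = "0\<^sub>m 0 ?r2 :: real mat"
    \<comment> \<open>The bases of the two images side by side. The lower blocks have no rows and
      only serve the block format.\<close>
    define W where "W = four_block_mat B1 B2 ?Z1 ?Z2"
    have W: "W \<in> carrier_mat m m"
      unfolding W_def using four_block_carrier_mat[OF B1(1), of ?Z2 0 ?r2] rk by auto
    have Wv: "W *\<^sub>v (a @\<^sub>v d) = B1 *\<^sub>v a + B2 *\<^sub>v d" if "a \<in> carrier_vec ?r1" "d \<in> carrier_vec ?r2" for a d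
    proof -
      have "W *\<^sub>v (a @\<^sub>v d) = (B1 *\<^sub>v a + B2 *\<^sub>v d) @\<^sub>v (?Z1 *\<^sub>v a + ?Z2 *\<^sub>v d)"
        unfolding W_def by (rule four_block_mat_mult_vec[OF B1(1) B2(1) _ _ that]) auto
      then show ?thesis using B1 B2 by (auto intro!: eq_vecI)
    qed
    have split: "\<exists>a d. a \<in> carrier_vec ?r1 \<and> d \<in> carrier_vec ?r2 \<and> y = a @\<^sub>v d" if "y \<in> carrier_vec m" for y :: "real vec"
    proof -
      have "y \<in> carrier_vec (?r1 + ?r2)" using that rk by simp
      from vec_first_last_append[OF this] show ?thesis
        by (metis vec_first_carrier vec_last_carrier)
    qed
    have "det W \<noteq> 0"
    proof
      assume "det W = 0"
      then obtain y where y: "y \<in> carrier_vec m" "y \<noteq> 0\<^sub>v m" "W *\<^sub>v y = 0\<^sub>v m"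
        using det_0_iff_vec_prod_zero_field[OF W] by blast
      obtain a d where ad: "a \<in> carrier_vec ?r1" "d \<in> carrier_vec ?r2" "y = a @\<^sub>v d"
        using split[OF y(1)] by blast
      let ?p = "B1 *\<^sub>v a" and ?q = "B2 *\<^sub>v d"
      have pq: "?p \<in> carrier_vec m" "?q \<in> carrier_vec m"
        using mult_mat_vec_carrier[OF B1(1) ad(1)] mult_mat_vec_carrier[OF B2(1) ad(2)] .
      have sum0: "?p + ?q = 0\<^sub>v m" using y(3) Wv[OF ad(1,2)] ad(3) by simp
      have o: "?p \<bullet> ?q = 0" using ortho[OF B1v(2)[OF ad(1)] B2v(2)[OF ad(2)]] B1v(1)[OF ad(1)] B2v(1)[OF ad(2)] by simp
      have "?p \<bullet> (?p + ?q) = ?p \<bullet> ?p + ?p \<bullet> ?q" using pq by (metis scalar_prod_add_distrib)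
      then have "?p \<bullet> ?p = 0" using sum0 o pq by simp
      then have p0: "?p = 0\<^sub>v m" using scalar_prod_self_eq_0 pq by blast
      then have q0: "?q = 0\<^sub>v m" using sum0 pq by simp
      have "a = 0\<^sub>v ?r1" "d = 0\<^sub>v ?r2" using inj1 inj2 ad p0 q0 by blast+
      then have "y = 0\<^sub>v m" using ad(3) rk by (intro eq_vecI) auto
      then show False using y by simp
    qed
    then have "det W\<^sup>T \<noteq> 0" using Determinant.det_transpose[OF W] by simp
    have WTx: "W\<^sup>T *\<^sub>v x \<in> carrier_vec m" using W x by auto
    have WT0: "(W\<^sup>T *\<^sub>v x) \<bullet> y = 0" if y: "y \<in> carrier_vec m" for y
    proof -
      obtain a d where ad: "a \<in> carrier_vec ?r1" "d \<in> carrier_vec ?r2" "y = a @\<^sub>v d"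
        using split[OF y] by blast
      have "(W\<^sup>T *\<^sub>v x) \<bullet> y = x \<bullet> (W *\<^sub>v y)"
        by (rule transpose_vec_mult_scalar[OF W y x(1)])
      also have "\<dots> = x \<bullet> (B1 *\<^sub>v a) + x \<bullet> (B2 *\<^sub>v d)"
        unfolding ad(3) Wv[OF ad(1,2)] using x mult_mat_vec_carrier[OF B1(1) ad(1)] mult_mat_vec_carrier[OF B2(1) ad(2)]
        by (intro scalar_prod_add_distrib)
      also have "x \<bullet> (B1 *\<^sub>v a) = 0"
        using symmetric_mat_adjoint[OF A x(1) B1v(2)[OF ad(1)]] x(2) B1v[OF ad(1)] by simp
      also have "x \<bullet> (B2 *\<^sub>v d) = 0"
        using symmetric_mat_adjoint[OF L x(1) B2v(2)[OF ad(2)]] x(3) B2v[OF ad(2)] by simp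
      finally show ?thesis by simp
    qed
    have "W\<^sup>T *\<^sub>v x = 0\<^sub>v m"
      using scalar_prod_self_eq_0[OF WTx WT0[OF WTx]] .
    then show ?thesis
      using \<open>det W\<^sup>T \<noteq> 0\<close> det_0_iff_vec_prod_zero_field[of "W\<^sup>T" m] W x(1) by (metis transpose_carrier_mat)
  qed
  have "det (A + L) \<noteq> 0"
  proof
    assume "det (A + L) = 0"
    then obtain x where x: "x \<in> carrier_vec m" "x \<noteq> 0\<^sub>v m" "(A + L) *\<^sub>v x = 0\<^sub>v m"
      using det_0_iff_vec_prod_zero_field[OF T] by blast
    have eq: "A *\<^sub>v x + L *\<^sub>v x = 0\<^sub>v m"
      using add_mult_distrib_mat_vec[OF A(1) L(1) x(1)] x(3) by simp
    have Ax: "A *\<^sub>v x \<in> carrier_vec m" "L *\<^sub>v x \<in> carrier_vec m"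
      using mult_mat_vec_carrier[OF A(1) x(1)] mult_mat_vec_carrier[OF L(1) x(1)] .
    have "(A *\<^sub>v x) \<bullet> (A *\<^sub>v x + L *\<^sub>v x) = (A *\<^sub>v x) \<bullet> (A *\<^sub>v x) + (A *\<^sub>v x) \<bullet> (L *\<^sub>v x)"
      using Ax by (metis scalar_prod_add_distrib)
    then have "(A *\<^sub>v x) \<bullet> (A *\<^sub>v x) = 0" using eq ortho[OF x(1) x(1)] Ax by simp
    then have A0: "A *\<^sub>v x = 0\<^sub>v m" using scalar_prod_self_eq_0 Ax by blast
    then have "L *\<^sub>v x = 0\<^sub>v m" using eq Ax by simp
    then show False using kerAL x A0 by blast
  qed
  from det_non_zero_imp_unit[OF T this, unfolded Units_def, of "()"]
  obtain S where "S \<in> carrier_mat m m" "S * (A + L) = 1\<^sub>m m" "(A + L) * S = 1\<^sub>m m"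
    by (auto simp: ring_mat_def)
  then show ?thesis using that by blast
qed

text \<open>Needed because \<open>mp_inverse\<close> is a definite description. Transposition shows
  that \<open>A * X = A * Z\<close> and \<open>X * A = Z * A\<close>, and these products determine
  the inverse.\<close>

lemma mp_inverse_unique:
  fixes A X Z :: "real mat"
  assumes A: "A \<in> carrier_mat m m" and X: "X \<in> carrier_mat m m" and Z: "Z \<in> carrier_mat m m"
    and x: "A * X * A = A" "X * A * X = X" "(A * X)\<^sup>T = A * X" "(X * A)\<^sup>T = X * A"
    and z: "A * Z * A = A" "Z * A * Z = Z" "(A * Z)\<^sup>T = A * Z" "(Z * A)\<^sup>T = Z * A"
  shows "X = Z"
proof -
  note assoc = assoc_mult_mat[of _ m m _ m _ m]
  have AX: "A * X \<in> carrier_mat m m" "A * Z \<in> carrier_mat m m" "X * A \<in> carrier_mat m m" "Z * A \<in> carrier_mat m m"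
    using A X Z by auto
  have "A * X = (A * Z) * (A * X)"
    using arg_cong[OF z(1), of "\<lambda>M. M * X"] A X Z by (simp add: assoc)
  then have "(A * X)\<^sup>T = (A * X)\<^sup>T * (A * Z)\<^sup>T"
    using transpose_mult[OF AX(2) AX(1)] by simp
  then have "A * X = A * X * (A * Z)" unfolding x z .
  also have "\<dots> = A * Z"
    using arg_cong[OF x(1), of "\<lambda>M. M * Z"] A X Z by (simp add: assoc)
  finally have 1: "A * X = A * Z" .
  have "X * A = (X * A) * (Z * A)"
    using arg_cong[OF z(1), of "\<lambda>M. X * M"] A X Z by (simp add: assoc)
  then have "(X * A)\<^sup>T = (Z * A)\<^sup>T * (X * A)\<^sup>T"
    using transpose_mult[OF AX(3) AX(4)] by simp
  then have "X * A = Z * A * (X * A)" unfolding x z .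
  also have "\<dots> = Z * A"
    using arg_cong[OF x(1), of "\<lambda>M. Z * M"] A X Z by (simp add: assoc)
  finally have 2: "X * A = Z * A" .
  have "X = X * (A * X)" using x(2) A X by (simp add: assoc)
  also have "\<dots> = X * A * Z" unfolding 1 using A X Z by (simp add: assoc)
  also have "\<dots> = Z" unfolding 2 by (rule z(2))
  finally show ?thesis .
qed

text \<open>The inverse \<open>S\<close> of \<open>A + L\<close> commutes with \<open>A\<close> and
  with \<open>L\<close>, and \<open>S * A * S\<close> satisfies the four Penrose equations. On the
  kernel of \<open>A\<close> one has \<open>x = S (A + L) x = S L x = L S x\<close>, so this kernel
  is contained in the image of \<open>L\<close>.\<close>

lemma mp_inverse_complementary:
  fixes A L :: "real mat"
  assumes A: "A \<in> carrier_mat m m" "A\<^sup>T = A" and L: "L \<in> carrier_mat m m" "L\<^sup>T = L"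
    and AL: "A * L = 0\<^sub>m m m" and rk: "vec_space.rank m A + vec_space.rank m L = m"
  shows "mp_inverse A \<in> carrier_mat m m" "(mp_inverse A)\<^sup>T = mp_inverse A"
    "mp_inverse A * A * mp_inverse A = mp_inverse A"
    "\<And>x. x \<in> carrier_vec m \<Longrightarrow> A *\<^sub>v x = 0\<^sub>v m \<Longrightarrow> \<exists>y\<in>carrier_vec m. x = L *\<^sub>v y"
proof -
  obtain S where S: "S \<in> carrier_mat m m" and TS: "(A + L) * S = 1\<^sub>m m" and ST: "S * (A + L) = 1\<^sub>m m"
    using complementary_sum_invertible[OF assms] .
  note assoc = assoc_mult_mat[of _ m m _ m _ m]
  have cl: "P * Q \<in> carrier_mat m m" if "P \<in> carrier_mat m m" "Q \<in> carrier_mat m m" for P Q :: "real mat"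
    using that by auto
  have T: "A + L \<in> carrier_mat m m" and TT: "(A + L)\<^sup>T = A + L"
    using A L transpose_add[OF A(1) L(1)] by auto
  have LA: "L * A = 0\<^sub>m m m"
    using transpose_mult[OF A(1) L(1)] A L AL by simp
  have TA: "(A + L) * A = A * A" "A * (A + L) = A * A"
    using add_mult_distrib_mat[OF A(1) L(1) A(1)] mult_add_distrib_mat[OF A(1) A(1) L(1)] A cl[OF A(1) A(1)]
    by (simp_all add: LA AL)
  have TL: "(A + L) * L = L * L" "L * (A + L) = L * L"
    using add_mult_distrib_mat[OF A(1) L(1) L(1)] mult_add_distrib_mat[OF L(1) A(1) L(1)] L cl[OF L(1) L(1)]
    by (simp_all add: LA AL)
  have SAA: "S * (A * A) = A" using arg_cong[OF TA(1), of "\<lambda>M. S * M"] assoc_mult_mat[OF S T A(1)] ST A by simp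
  have AAS: "A * A * S = A" using arg_cong[OF TA(2), of "\<lambda>M. M * S"] assoc_mult_mat[OF A(1) T S] TS A by simp
  have SLL: "S * (L * L) = L" using arg_cong[OF TL(1), of "\<lambda>M. S * M"] assoc_mult_mat[OF S T L(1)] ST L by simp
  have LLS: "L * L * S = L" using arg_cong[OF TL(2), of "\<lambda>M. M * S"] assoc_mult_mat[OF L(1) T S] TS L by simp
  have SA: "S * A = A * S"
    using arg_cong[OF AAS, of "\<lambda>M. S * M"] assoc_mult_mat[OF S cl[OF A(1) A(1)] S] SAA by simp
  have SL: "S * L = L * S"
    using arg_cong[OF LLS, of "\<lambda>M. S * M"] assoc_mult_mat[OF S cl[OF L(1) L(1)] S] SLL by simp
  have ASA: "A * S * A = A"
    unfolding SA[symmetric] using assoc_mult_mat[OF S A(1) A(1)] SAA by simp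
  have "(A + L) * S\<^sup>T = 1\<^sub>m m"
    using transpose_mult[OF S T] ST TT by simp
  then have "S * ((A + L) * S\<^sup>T) = S" using S by simp
  then have sS: "S\<^sup>T = S"
    using assoc_mult_mat[OF S T, of "S\<^sup>T" m] ST S by simp
  define Y where "Y = S * A * S"
  have Y: "Y \<in> carrier_mat m m" unfolding Y_def using A S by auto
  have AY: "A * Y = A * S"
  proof -
    have "A * Y = A * S * A * S" unfolding Y_def using A S by (simp add: assoc)
    then show ?thesis using ASA by simp
  qed
  have YA: "Y * A = S * A"
  proof -
    have "Y * A = S * (A * S * A)" unfolding Y_def using A S by (simp add: assoc)
    then show ?thesis using ASA by simp
  qed
  have AST: "(A * S)\<^sup>T = A * S" "(S * A)\<^sup>T = S * A"
    using transpose_mult[OF A(1) S] transpose_mult[OF S A(1)] sS A SA by simp_all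
  have AYA: "A * Y * A = A" unfolding AY by (rule ASA)
  have YAY: "Y * A * Y = Y"
  proof -
    have "Y * A * Y = S * (A * S * A) * S" unfolding YA unfolding Y_def using A S by (simp add: assoc)
    then show ?thesis unfolding ASA Y_def .
  qed
  have YT: "Y\<^sup>T = Y"
  proof -
    have "Y\<^sup>T = S * (S * A)"
      unfolding Y_def using transpose_mult[OF cl[OF S A(1)] S] AST(2) sS by simp
    also have "\<dots> = S * (A * S)" by (simp only: SA)
    also have "\<dots> = Y" unfolding Y_def by (rule assoc_mult_mat[OF S A(1) S, symmetric])
    finally show ?thesis .
  qed
  have mp: "mp_inverse A = Y"
    unfolding mp_inverse_def
  proof (rule the_equality)
    show "Y \<in> carrier_mat (dim_col A) (dim_row A) \<and> A * Y * A = A \<and> Y * A * Y = Y \<and> (A * Y)\<^sup>T = A * Y \<and> (Y * A)\<^sup>T = Y * A"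
      using A Y AYA YAY AST by (auto simp: AY YA)
  next
    fix X assume "X \<in> carrier_mat (dim_col A) (dim_row A) \<and> A * X * A = A \<and> X * A * X = X \<and> (A * X)\<^sup>T = A * X \<and> (X * A)\<^sup>T = X * A"
    then show "X = Y"
      using mp_inverse_unique[OF A(1) _ Y, of X] A AYA YAY AST by (auto simp: AY YA)
  qed
  show "mp_inverse A \<in> carrier_mat m m" "(mp_inverse A)\<^sup>T = mp_inverse A"
    "mp_inverse A * A * mp_inverse A = mp_inverse A"
    unfolding mp by (fact Y YT YAY)+
  show "\<exists>y\<in>carrier_vec m. x = L *\<^sub>v y" if x: "x \<in> carrier_vec m" "A *\<^sub>v x = 0\<^sub>v m" for x
  proof (rule bexI[of _ "S *\<^sub>v x"])
    have "x = (S * (A + L)) *\<^sub>v x" using ST x by simp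
    also have "\<dots> = S *\<^sub>v (A *\<^sub>v x + L *\<^sub>v x)"
      using assoc_mult_mat_vec[OF S T x(1)] add_mult_distrib_mat_vec[OF A(1) L(1) x(1)] by simp
    also have "\<dots> = (S * L) *\<^sub>v x" using assoc_mult_mat_vec[OF S L(1) x(1)] x L by simp
    also have "\<dots> = L *\<^sub>v (S *\<^sub>v x)" unfolding SL by (rule assoc_mult_mat_vec[OF L(1) S x(1)])
    finally show "x = L *\<^sub>v (S *\<^sub>v x)" .
  qed (rule mult_mat_vec_carrier[OF S x(1)])
qed

subsection \<open>Compactness and completing the square\<close>

text \<open>Points are functions on all natural numbers with the product topology. Vanishing outside
  the first \<open>n\<close> coordinates makes the box a product of compact sets, so Tychonoff's
  theorem applies.\<close>

lemma compact_box: "compact {h \<in> pts n. \<forall>i<n. \<bar>h i :: real\<bar> \<le> R}"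
proof -
  have "{h \<in> pts n. \<forall>i<n. \<bar>h i\<bar> \<le> R} = PiE UNIV (\<lambda>i. if i < n then {- R..R} else {0::real})"
  proof (intro Set.set_eqI iffI)
    fix h assume "h \<in> PiE UNIV (\<lambda>i. if i < n then {- R..R} else {0::real})"
    then have h: "h i \<in> (if i < n then {- R..R} else {0})" for i by (auto simp: PiE_iff)
    have "h i = 0" if "i \<ge> n" for i using h[of i] that by simp
    moreover have "\<bar>h i\<bar> \<le> R" if "i < n" for i using h[of i] that by (simp add: abs_le_iff)
    ultimately show "h \<in> {h \<in> pts n. \<forall>i<n. \<bar>h i\<bar> \<le> R}" by (simp add: pts_def)
  qed (auto simp: pts_def PiE_iff abs_le_iff)
  moreover have "compactin (product_topology (\<lambda>_::nat. euclideanreal) UNIV) (PiE UNIV (\<lambda>i. if i < n then {- R..R} else {0}))"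
    by (subst compactin_PiE) auto
  ultimately show ?thesis
    by (simp add: euclidean_product_topology)
qed

text \<open>On the compact part where \<open>Q\<close> is not positive, \<open>P\<close> has a
  positive minimum, so a large multiple of \<open>P\<close> outweighs the minimum of
  \<open>Q\<close>. Compactness once more turns positivity into a uniform bound.\<close>

lemma penalty_compact:
  fixes Q P :: "'a::topological_space \<Rightarrow> real"
  assumes T: "compact T" and Q: "continuous_on T Q" and P: "continuous_on T P"
    and P0: "\<And>h. h \<in> T \<Longrightarrow> P h \<ge> 0" and QP: "\<And>h. h \<in> T \<Longrightarrow> P h = 0 \<Longrightarrow> Q h > 0"
  shows "\<exists>C c. c > 0 \<and> (\<forall>h\<in>T. c \<le> Q h + C * P h)"
proof (cases "T = {}")
  case True
  then show ?thesis by (auto intro: exI[of _ 1])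
next
  case False
  have "\<exists>C\<ge>0. \<forall>h\<in>T. 0 < Q h + C * P h"
  proof (cases "{h \<in> T. Q h \<le> 0} = {}")
    case True
    then show ?thesis by (intro exI[of _ 0]) (auto simp: not_le)
  next
    case ne: False
    have K: "compact {h \<in> T. Q h \<le> 0}"
    proof -
      have "closedin (top_of_set T) (T \<inter> Q -` {..0})"
        by (rule continuous_closedin_preimage[OF Q closed_atMost])
      moreover have "T \<inter> Q -` {..0} = {h \<in> T. Q h \<le> 0}" by auto
      ultimately show ?thesis using closedin_compact[OF T] by simp
    qed
    obtain h0 where h0: "h0 \<in> T" "Q h0 \<le> 0" "\<And>h. h \<in> T \<Longrightarrow> Q h \<le> 0 \<Longrightarrow> P h0 \<le> P h"
      using continuous_attains_inf[OF K ne continuous_on_subset[OF P]] by auto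
    obtain h1 where h1: "h1 \<in> T" "\<And>h. h \<in> T \<Longrightarrow> Q h1 \<le> Q h"
      using continuous_attains_inf[OF T False Q] by auto
    have p: "P h0 > 0" using P0[OF h0(1)] QP[OF h0(1)] h0(2) by fastforce
    define C where "C = (\<bar>Q h1\<bar> + 1) / P h0"
    have C: "C \<ge> 0" using p by (simp add: C_def)
    have "0 < Q h + C * P h" if h: "h \<in> T" for h
    proof (cases "Q h \<le> 0")
      case True
      have "C * P h \<ge> C * P h0" using h0(3)[OF h True] C by (rule mult_left_mono)
      moreover have "C * P h0 = \<bar>Q h1\<bar> + 1" using p by (simp add: C_def)
      ultimately show ?thesis using h1(2)[OF h] by linarith
    next
      case False
      then show ?thesis using mult_nonneg_nonneg[OF C P0[OF h]] by linarith
    qed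
    with C show ?thesis by blast
  qed
  then obtain C where C: "\<forall>h\<in>T. 0 < Q h + C * P h" by blast
  have "continuous_on T (\<lambda>h. Q h + C * P h)"
    by (intro continuous_intros Q P)
  from continuous_attains_inf[OF T False this] C show ?thesis by blast
qed

text \<open>With \<open>ip\<close> and \<open>entries\<close> this restates matrix algebra for
  functions on indices, where linear combinations and sums over parameters can be exchanged without
  carrier conditions.\<close>

definition mv :: "nat \<Rightarrow> (nat \<Rightarrow> nat \<Rightarrow> real) \<Rightarrow> (nat \<Rightarrow> real) \<Rightarrow> nat \<Rightarrow> real" where
  "mv m A x a = (\<Sum>b<m. A a b * x b)"

definition ip :: "nat \<Rightarrow> (nat \<Rightarrow> real) \<Rightarrow> (nat \<Rightarrow> real) \<Rightarrow> real" where
  "ip m x y = (\<Sum>a<m. x a * y a)"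

definition entries :: "real mat \<Rightarrow> nat \<Rightarrow> nat \<Rightarrow> real" where
  "entries A a b = A $$ (a, b)"

lemma ip_cong: "(\<And>a. a < m \<Longrightarrow> x a = x' a) \<Longrightarrow> (\<And>a. a < m \<Longrightarrow> y a = y' a) \<Longrightarrow> ip m x y = ip m x' y'"
  by (simp add: ip_def)

lemma mv_cong: "(\<And>b. b < m \<Longrightarrow> x b = x' b) \<Longrightarrow> mv m A x a = mv m A x' a"
  by (simp add: mv_def)

lemma ip_commute: "ip m x y = ip m y x"
  by (simp add: ip_def mult.commute)

lemma ip_mv: "ip m x (mv m A y) = bil m A x y"
  by (simp add: ip_def mv_def bil_def sum_distrib_left mult_ac)

lemma ip_mv_sym:
  assumes "\<And>a b. a < m \<Longrightarrow> b < m \<Longrightarrow> A a b = A b a"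
  shows "ip m (mv m A x) y = ip m x (mv m A y)"
  using bil_commute[of m A x y] assms by (simp add: ip_mv ip_commute[of m "mv m A x" y])

lemma ip_add_left: "ip m (\<lambda>a. x a + x' a) y = ip m x y + ip m x' y"
  by (simp add: ip_def algebra_simps sum.distrib)

lemma ip_scale_left: "ip m (\<lambda>a. s * x a) y = s * ip m x y"
  by (simp add: ip_def sum_distrib_left algebra_simps)

lemma ip_sum_left: "ip m (\<lambda>a. \<Sum>j\<in>J. x j a) y = (\<Sum>j\<in>J. ip m (x j) y)"
  by (simp add: ip_def sum_distrib_right sum.swap[of _ J])

lemma ip_sum_right: "ip m y (\<lambda>a. \<Sum>j\<in>J. x j a) = (\<Sum>j\<in>J. ip m y (x j))"
  by (simp add: ip_commute[of m y] ip_sum_left)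

lemma ip_scale_right: "ip m y (\<lambda>a. s * x a) = s * ip m y x"
  by (simp add: ip_commute[of m y] ip_scale_left)

lemma mv_sum_right: "mv m A (\<lambda>a. \<Sum>j\<in>J. x j a) a = (\<Sum>j\<in>J. mv m A (x j) a)"
  by (simp add: mv_def sum_distrib_left sum.swap[of _ J])

lemma mv_scale_right: "mv m A (\<lambda>a. s * x a) a = s * mv m A x a"
  by (simp add: mv_def sum_distrib_left algebra_simps)

lemma mv_add_right: "mv m A (\<lambda>a. x a + y a) a = mv m A x a + mv m A y a"
  by (simp add: mv_def sum.distrib algebra_simps)

lemma mv_sum_left: "mv m (\<lambda>a b. \<Sum>i\<in>I. h i * D i a b) x a = (\<Sum>i\<in>I. h i * mv m (D i) x a)"
  by (simp add: mv_def sum_distrib_left sum_distrib_right sum.swap[of _ I] mult.assoc)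

lemma mv_entries_mult:
  assumes "A \<in> carrier_mat m m" "B \<in> carrier_mat m m" "a < m"
  shows "mv m (entries (A * B)) x a = mv m (entries A) (mv m (entries B) x) a"
proof -
  have "entries (A * B) a b = (\<Sum>c<m. entries A a c * entries B c b)" if "b < m" for b
    using assms that by (simp add: entries_def scalar_prod_def lessThan_atLeast0)
  then have "mv m (entries (A * B)) x a = (\<Sum>b<m. (\<Sum>c<m. entries A a c * entries B c b) * x b)"
    by (simp add: mv_def)
  also have "\<dots> = (\<Sum>c<m. \<Sum>b<m. entries A a c * entries B c b * x b)"
    by (simp add: sum_distrib_right) (rule sum.swap)
  finally show ?thesis by (simp add: mv_def sum_distrib_left mult.assoc)
qed

lemma mult_mat_vec_entries:
  assumes "A \<in> carrier_mat m k" "v \<in> carrier_vec k" "a < m"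
  shows "(A *\<^sub>v v) $ a = (\<Sum>b<k. A $$ (a, b) * v $ b)"
  using assms by (simp add: scalar_prod_def lessThan_atLeast0)

lemma minner_eq:
  assumes "W \<in> carrier_mat m m" "Y \<in> carrier_mat m m"
  shows "minner W Y = (\<Sum>a<m. \<Sum>b<m. W $$ (a,b) * Y $$ (a,b))"
  unfolding minner_def mtrace_def using assms
  by (auto intro!: sum.cong simp: scalar_prod_def lessThan_atLeast0)

lemma psd_form_entries:
  assumes "psd A" "A \<in> carrier_mat m m"
  shows "psd_form m (entries A)"
  unfolding psd_form_def
proof (intro conjI allI impI)
  fix i j assume "i < m" "j < m"
  then show "entries A i j = entries A j i"
    using assms unfolding psd_def entries_def by (metis carrier_matD index_transpose_mat(1))
next
  fix h
  have "0 \<le> vec m h \<bullet> (A *\<^sub>v vec m h)"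
    using assms unfolding psd_def by auto
  also have "\<dots> = ip m h (mv m (entries A) h)"
    using assms(2) by (simp add: scalar_prod_def ip_def mv_def entries_def lessThan_atLeast0)
  finally show "0 \<le> bil m (entries A) h h" by (simp add: ip_mv)
qed

text \<open>Completing the square: \<open>w\<close> minimises \<open>w\<^sup>T A w + 2 l\<^sup>T B w\<close> on the image of \<open>A\<close> and runs far into
its kernel, spanned by the \<open>e j\<close>.\<close>

lemma complete_square:
  fixes l :: "nat \<Rightarrow> real" and C :: real
  assumes sym: "\<And>a b. a < m \<Longrightarrow> b < m \<Longrightarrow> A a b = A b a" "\<And>a b. a < m \<Longrightarrow> b < m \<Longrightarrow> B a b = B b a"
      "\<And>a b. a < m \<Longrightarrow> b < m \<Longrightarrow> Y a b = Y b a"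
    and YAY: "\<And>z a. a < m \<Longrightarrow> mv m Y (mv m A (mv m Y z)) a = mv m Y z a"
    and e: "\<And>j a. j < r \<Longrightarrow> a < m \<Longrightarrow> mv m A (e j) a = 0"
  defines "x \<equiv> mv m B l"
  defines "w \<equiv> (\<lambda>a. - (mv m Y x a + C * (\<Sum>j<r. ip m (e j) x * e j a)))"
  shows "2 * bil m A w w + 4 * bil m B l w = - 2 * ip m x (mv m Y x) - 4 * C * (\<Sum>j<r. (ip m (e j) x)\<^sup>2)"
proof -
  have w: "w = (\<lambda>a. (- 1) * (mv m Y x a + C * (\<Sum>j<r. ip m (e j) x * e j a)))"
    by (simp add: w_def)
  \<comment> \<open>The kernel part of \<open>w\<close> is invisible to \<open>A\<close>. It does
    not change the quadratic term, and the penalty comes from the linear term alone.\<close>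
  have Aw: "mv m A w a = - mv m A (mv m Y x) a" if "a < m" for a
    unfolding w mv_scale_right mv_add_right mv_sum_right using e that by simp
  have ew: "ip m (e j) (mv m A z) = 0" if "j < r" for j z
    using ip_mv_sym[of m A "e j" z] sym(1) e[OF that] by (simp add: ip_def)
  have "bil m A w w = ip m w (mv m A w)" by (simp add: ip_mv)
  also have "\<dots> = ip m w (\<lambda>a. (- 1) * mv m A (mv m Y x) a)"
    by (rule ip_cong) (simp_all add: Aw)
  also have "\<dots> = ip m (mv m Y x) (mv m A (mv m Y x)) + C * (\<Sum>j<r. ip m (e j) x * ip m (e j) (mv m A (mv m Y x)))"
    unfolding w ip_scale_right ip_scale_left ip_add_left ip_sum_left by simp
  also have "\<dots> = ip m (mv m Y x) (mv m A (mv m Y x))" using ew by simp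
  also have "\<dots> = ip m x (mv m Y (mv m A (mv m Y x)))"
    by (rule ip_mv_sym) (use sym in auto)
  also have "\<dots> = ip m x (mv m Y x)"
    by (rule ip_cong) (simp_all add: YAY)
  finally have 1: "bil m A w w = ip m x (mv m Y x)" .
  have "bil m B l w = ip m x w"
    unfolding x_def ip_mv[symmetric] by (rule ip_mv_sym[symmetric]) (use sym in auto)
  also have "\<dots> = ip m w x" by (rule ip_commute)
  also have "\<dots> = - (ip m (mv m Y x) x + C * (\<Sum>j<r. ip m (e j) x * ip m (e j) x))"
    unfolding w ip_scale_left ip_add_left ip_sum_left by simp
  finally have 2: "bil m B l w = - ip m x (mv m Y x) - C * (\<Sum>j<r. (ip m (e j) x)\<^sup>2)"
    by (simp add: ip_commute[of m "mv m Y x"] power2_eq_square)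
  show ?thesis unfolding 1 2 by (simp add: algebra_simps)
qed

subsection \<open>The local certificate at a minimizer\<close>

lemma index_mult_mat_sum:
  assumes "A \<in> carrier_mat p q" "B \<in> carrier_mat q s" "i < p" "j < s"
  shows "(A * B) $$ (i, j) = (\<Sum>b<q. A $$ (i, b) * B $$ (b, j))"
  using assms by (simp add: scalar_prod_def lessThan_atLeast0)

lemma sum_swap3:
  "(\<Sum>i\<in>I. \<Sum>j\<in>J. \<Sum>k\<in>K. X i j k) = (\<Sum>k\<in>K. \<Sum>i\<in>I. \<Sum>j\<in>J. X i j k)"
proof -
  have "(\<Sum>i\<in>I. \<Sum>j\<in>J. \<Sum>k\<in>K. X i j k) = (\<Sum>i\<in>I. \<Sum>k\<in>K. \<Sum>j\<in>J. X i j k)"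
    by (rule sum.cong[OF refl]) (rule sum.swap)
  also have "\<dots> = (\<Sum>k\<in>K. \<Sum>i\<in>I. \<Sum>j\<in>J. X i j k)"
    by (rule sum.swap)
  finally show ?thesis .
qed

lemma sum_swap5:
  "(\<Sum>i\<in>I. \<Sum>j\<in>J. \<Sum>t\<in>T. \<Sum>a\<in>A. \<Sum>b\<in>B. X i j t a b) = (\<Sum>t\<in>T. \<Sum>a\<in>A. \<Sum>b\<in>B. \<Sum>i\<in>I. \<Sum>j\<in>J. X i j t a b)"
proof -
  have "(\<Sum>i\<in>I. \<Sum>j\<in>J. \<Sum>t\<in>T. \<Sum>a\<in>A. \<Sum>b\<in>B. X i j t a b) = (\<Sum>t\<in>T. \<Sum>i\<in>I. \<Sum>j\<in>J. \<Sum>a\<in>A. \<Sum>b\<in>B. X i j t a b)"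
    by (rule sum_swap3)
  also have "\<dots> = (\<Sum>t\<in>T. \<Sum>a\<in>A. \<Sum>i\<in>I. \<Sum>j\<in>J. \<Sum>b\<in>B. X i j t a b)"
    by (rule sum.cong[OF refl]) (rule sum_swap3)
  also have "\<dots> = (\<Sum>t\<in>T. \<Sum>a\<in>A. \<Sum>b\<in>B. \<Sum>i\<in>I. \<Sum>j\<in>J. X i j t a b)"
    by (rule sum.cong[OF refl], rule sum.cong[OF refl]) (rule sum_swap3)
  finally show ?thesis .
qed

lemma sum_product_weighted:
  fixes h p q :: "nat \<Rightarrow> real"
  shows "(\<Sum>i<n. \<Sum>j<n. h i * h j * (p i * q j)) = (\<Sum>i<n. h i * p i) * (\<Sum>j<n. h j * q j)"
    "(\<Sum>i<n. \<Sum>j<n. h i * h j * (p j * q i)) = (\<Sum>i<n. h i * p i) * (\<Sum>j<n. h j * q j)"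
proof -
  show 1: "(\<Sum>i<n. \<Sum>j<n. h i * h j * (p i * q j)) = (\<Sum>i<n. h i * p i) * (\<Sum>j<n. h j * q j)" for p q :: "nat \<Rightarrow> real"
    by (simp add: sum_product mult_ac)
  have "(\<Sum>i<n. \<Sum>j<n. h i * h j * (p j * q i)) = (\<Sum>i<n. \<Sum>j<n. h i * h j * (q i * p j))"
    by (intro sum.cong refl) simp
  then show "(\<Sum>i<n. \<Sum>j<n. h i * h j * (p j * q i)) = (\<Sum>i<n. h i * p i) * (\<Sum>j<n. h j * q j)"
    using 1[of q p] by simp
qed

text \<open>The outer factors stand for affine entries of the vector in \<open>v^T G v\<close>;
  their first derivatives are constants, so only derivatives of \<open>g\<close> occur to second
  order.\<close>

lemma hessian_triple:
  fixes g v w :: rpoly and u :: "nat \<Rightarrow> real"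
  assumes "pdiff i v = pconst vi" "pdiff j v = pconst vj" "pdiff i w = pconst wi" "pdiff j w = pconst wj"
  shows "peval (pdiff i (pdiff j (v * (g * w)))) u =
     (vi * wj + vj * wi) * peval g u + vj * peval w u * peval (pdiff i g) u + vi * peval w u * peval (pdiff j g) u
     + peval v u * wj * peval (pdiff i g) u + peval v u * wi * peval (pdiff j g) u
     + peval v u * peval w u * peval (pdiff i (pdiff j g)) u"
  by (simp add: pdiff_mult assms algebra_simps)

text \<open>Contraction with \<open>h\<close> in both indices makes the mixed terms agree in pairs,
  which is the source of the factors 2, and splits them into derivatives in the direction
  \<open>h\<close>.\<close>

lemma hessian_triple_form:
  fixes h \<alpha> \<beta> \<gamma> :: "nat \<Rightarrow> real" and d :: "nat \<Rightarrow> nat \<Rightarrow> real"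
  shows "(\<Sum>i<n. \<Sum>j<n. h i * h j * ((\<alpha> i * \<beta> j + \<alpha> j * \<beta> i) * g + \<alpha> j * lb * \<gamma> i + \<alpha> i * lb * \<gamma> j
       + la * \<beta> j * \<gamma> i + la * \<beta> i * \<gamma> j + la * lb * d i j))
   = 2 * ((\<Sum>i<n. h i * \<alpha> i) * g * (\<Sum>i<n. h i * \<beta> i)) + 2 * ((\<Sum>i<n. h i * \<alpha> i) * (\<Sum>i<n. h i * \<gamma> i) * lb)
     + 2 * (la * (\<Sum>i<n. h i * \<gamma> i) * (\<Sum>i<n. h i * \<beta> i)) + la * lb * (\<Sum>i<n. \<Sum>j<n. h i * h j * d i j)"
proof -
  have "(\<Sum>i<n. \<Sum>j<n. h i * h j * ((\<alpha> i * \<beta> j + \<alpha> j * \<beta> i) * g + \<alpha> j * lb * \<gamma> i + \<alpha> i * lb * \<gamma> j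
       + la * \<beta> j * \<gamma> i + la * \<beta> i * \<gamma> j + la * lb * d i j))
    = (\<Sum>i<n. \<Sum>j<n. g * (h i * h j * (\<alpha> i * \<beta> j)) + g * (h i * h j * (\<alpha> j * \<beta> i))
       + lb * (h i * h j * (\<alpha> j * \<gamma> i)) + lb * (h i * h j * (\<alpha> i * \<gamma> j))
       + la * (h i * h j * (\<beta> j * \<gamma> i)) + la * (h i * h j * (\<beta> i * \<gamma> j)) + la * lb * (h i * h j * d i j))"
    by (intro sum.cong refl) (simp add: algebra_simps)
  also have "\<dots> = g * (\<Sum>i<n. \<Sum>j<n. h i * h j * (\<alpha> i * \<beta> j)) + g * (\<Sum>i<n. \<Sum>j<n. h i * h j * (\<alpha> j * \<beta> i))
       + lb * (\<Sum>i<n. \<Sum>j<n. h i * h j * (\<alpha> j * \<gamma> i)) + lb * (\<Sum>i<n. \<Sum>j<n. h i * h j * (\<alpha> i * \<gamma> j))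
       + la * (\<Sum>i<n. \<Sum>j<n. h i * h j * (\<beta> j * \<gamma> i)) + la * (\<Sum>i<n. \<Sum>j<n. h i * h j * (\<beta> i * \<gamma> j))
       + la * lb * (\<Sum>i<n. \<Sum>j<n. h i * h j * d i j)"
    by (simp only: sum.distrib sum_distrib_left)
  also have "\<dots> = 2 * ((\<Sum>i<n. h i * \<alpha> i) * g * (\<Sum>i<n. h i * \<beta> i)) + 2 * ((\<Sum>i<n. h i * \<alpha> i) * (\<Sum>i<n. h i * \<gamma> i) * lb)
     + 2 * (la * (\<Sum>i<n. h i * \<gamma> i) * (\<Sum>i<n. h i * \<beta> i)) + la * lb * (\<Sum>i<n. \<Sum>j<n. h i * h j * d i j)"
    unfolding sum_product_weighted by (simp add: algebra_simps)
  finally show ?thesis .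
qed

lemma qform_eq:
  assumes "G \<in> carrier_mat m m" "v \<in> carrier_vec m"
  shows "qform G v = (\<Sum>a<m. \<Sum>b<m. v $ a * (G $$ (a,b) * v $ b))"
  using assms by (simp add: qform_def scalar_prod_def lessThan_atLeast0 sum_distrib_left)

lemma bounded_below_on_sphere:
  fixes q :: "(nat \<Rightarrow> real) \<Rightarrow> real"
  assumes sph: "\<And>h. h \<in> pts n \<Longrightarrow> (\<Sum>i<n. h i * h i) = 1 \<Longrightarrow> c \<le> bil n H h h"
  shows "c * (\<Sum>i<n. h i * h i) \<le> bil n H h h"
proof (cases "(\<Sum>i<n. h i * h i) = 0")
  case True
  then have "h i = 0" if "i < n" for i
    using that by (subst (asm) sum_nonneg_eq_0_iff) auto
  then show ?thesis using True by (simp add: bil_def)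
next
  case False
  define r where "r = sqrt (\<Sum>i<n. h i * h i)"
  have s: "(\<Sum>i<n. h i * h i) > 0" using False sum_nonneg[of "{..<n}" "\<lambda>i. h i * h i"] by force
  have r: "r > 0" "r * r = (\<Sum>i<n. h i * h i)" using s by (auto simp: r_def)
  define h' where "h' i = (if i < n then h i / r else 0)" for i
  have "(\<Sum>i<n. h' i * h' i) = (\<Sum>i<n. h i * h i) / (r * r)"
    by (simp add: h'_def sum_divide_distrib)
  then have 1: "(\<Sum>i<n. h' i * h' i) = 1" using r s by simp
  have "bil n H h h = r * r * bil n H h' h'"
    unfolding bil_def sum_distrib_left using r(1) by (intro sum.cong refl) (simp add: h'_def)
  moreover have "c \<le> bil n H h' h'" by (rule sph) (use 1 in \<open>auto simp: pts_def h'_def\<close>)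
  ultimately show ?thesis using r(2) mult_left_mono[of c "bil n H h' h'" "r * r"] s by (simp add: mult.commute)
qed

lemma ker_basis_mat_col:
  assumes A: "A \<in> carrier_mat m m" and E: "ker_basis_mat A E" and j: "j < dim_col E"
  shows "col E j \<in> mat_kernel A"
proof -
  have col: "col E j \<in> set (cols E)"
    using j by (metis cols_length cols_nth nth_mem)
  have kb: "kernel.basis m A (set (cols E))"
    using E A unfolding ker_basis_mat_def by simp
  interpret kernel m m A by unfold_locales (rule A)
  have "set (cols E) \<subseteq> mat_kernel A"
    using kb unfolding Ker.basis_def by simp
  then show ?thesis using col by blast
qed

text \<open>The penalty \<open>P\<close> below vanishes exactly on the critical cone, because strict complementarity makes
the vectors \<open>l t\<close> with \<open>\<Lambda> = \<Sum> l\<^sub>t l\<^sub>t\<^sup>T\<close> span the kernel of \<open>G(u)\<close>.\<close>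

lemma local_certificate:
  fixes F :: rpoly and G :: "rpoly mat" and u :: "nat \<Rightarrow> real"
  assumes F: "is_poly n F" "peval F u = 0"
    and G: "G \<in> carrier_mat m m" "G\<^sup>T = G" "\<forall>i<m. \<forall>j<m. is_poly n (G $$ (i,j))"
    and feas: "psd (evalm G u)"
    and E: "ker_basis_mat (evalm G u) E"
    and kkt: "KKT n F G u \<Lambda>" and scc: "SCC G u \<Lambda>" and sosc: "SOSC n F G u \<Lambda> E"
  shows "\<exists>c0>0. \<forall>c. 0 < c \<and> c \<le> c0 \<longrightarrow>
    (\<exists>g\<in>qmod n G. peval g u = 0 \<and> cubic n u (F - g - pconst c * (\<Sum>i<n. xi u i * xi u i)))"
proof -
  define A where "A = evalm G u"
  have Ac: "A \<in> carrier_mat m m" using G by (simp add: A_def evalm_def)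
  have Gsym: "G $$ (a,b) = G $$ (b,a)" if "a < m" "b < m" for a b
    using G that by (metis carrier_matD index_transpose_mat(1))
  have A_eq: "A $$ (a,b) = peval (G $$ (a,b)) u" if "a < m" "b < m" for a b
    using G that by (simp add: A_def evalm_def)
  have AT: "A\<^sup>T = A" using feas by (simp add: A_def psd_def)
  have Lc: "\<Lambda> \<in> carrier_mat m m" and Lpsd: "psd \<Lambda>" and LA0: "minner \<Lambda> A = 0"
    and grad: "\<And>i. i < n \<Longrightarrow> peval (pdiff i F) u = minner (dG G i u) \<Lambda>"
    using kkt G by (auto simp: KKT_def A_def)
  have LT: "\<Lambda>\<^sup>T = \<Lambda>" using Lpsd by (simp add: psd_def)
  have Dc: "dG G i u \<in> carrier_mat m m" for i using G by (simp add: dG_def evalm_def)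
  define D where "D i a b = peval (pdiff i (G $$ (a,b))) u" for i a b
  have D_eq: "dG G i u $$ (a,b) = D i a b" if "a < m" "b < m" for i a b
    using G that by (simp add: dG_def evalm_def D_def)
  have Dsym: "D i a b = D i b a" if "a < m" "b < m" for i a b
    using Gsym[OF that] by (simp add: D_def)
  define DD where "DD i j a b = peval (pdiff i (pdiff j (G $$ (a,b)))) u" for i j a b
  have DD_eq: "ddG G i j u $$ (a,b) = DD i j a b" if "a < m" "b < m" for i j a b
    using G that by (simp add: ddG_def evalm_def DD_def)

  \<comment> \<open>Rank one factors of the multiplier and the kernel of the constraint
    matrix\<close>
  obtain l where l: "\<And>a b. a < m \<Longrightarrow> b < m \<Longrightarrow> \<Lambda> $$ (a,b) = (\<Sum>t<m. l t a * l t b)"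
    using psd_form_decomp[OF psd_form_entries[OF Lpsd Lc]] unfolding entries_def by blast
  \<comment> \<open>Turns every inner product with \<open>\<Lambda>\<close> into a sum of quadratic
    forms at the vectors \<open>l t\<close>.\<close>
  have Lsum: "(\<Sum>a<m. \<Sum>b<m. \<Lambda> $$ (a,b) * X a b) = (\<Sum>t<m. bil m X (l t) (l t))" for X
  proof -
    have "(\<Sum>a<m. \<Sum>b<m. \<Lambda> $$ (a,b) * X a b) = (\<Sum>a<m. \<Sum>b<m. \<Sum>t<m. X a b * l t a * l t b)"
      by (intro sum.cong refl) (simp add: l sum_distrib_left sum_distrib_right mult_ac)
    also have "\<dots> = (\<Sum>t<m. \<Sum>a<m. \<Sum>b<m. X a b * l t a * l t b)"
      by (rule sum_swap3)
    finally show ?thesis by (simp add: bil_def)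
  qed
  have psdA: "psd_form m (entries A)" using psd_form_entries[OF feas] Ac by (simp add: A_def)
  have Asym: "entries A a b = entries A b a" if "a < m" "b < m" for a b
    using psdA that by (simp add: psd_form_def)
  \<comment> \<open>Complementarity makes a sum of nonnegative terms vanish. Each \<open>l t\<close>
    is thus isotropic for the semidefinite matrix \<open>A\<close>, and therefore in its
    kernel.\<close>
  have "(\<Sum>t<m. bil m (entries A) (l t) (l t)) = 0"
    using LA0 Lsum[of "entries A"] unfolding minner_eq[OF Lc Ac] by (simp add: entries_def)
  then have Al0: "bil m (entries A) (l t) (l t) = 0" if "t < m" for t
    using that psdA by (subst (asm) sum_nonneg_eq_0_iff) (auto simp: psd_form_def)
  have Al: "mv m (entries A) (l t) a = 0" if "t < m" "a < m" for t a
    using psd_form_isotropic[OF psdA Al0[OF that(1)], of "\<lambda>i. of_bool (i = a)"] bil_unit_left[OF that(2)]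
    by (simp add: mv_def)
  have AL: "A * \<Lambda> = 0\<^sub>m m m"
  proof (rule eq_matI)
    fix a b assume "a < dim_row (0\<^sub>m m m :: real mat)" "b < dim_col (0\<^sub>m m m :: real mat)"
    then have ab: "a < m" "b < m" by auto
    have "(A * \<Lambda>) $$ (a,b) = (\<Sum>c<m. A $$ (a,c) * \<Lambda> $$ (c,b))"
      using Ac Lc ab by (simp add: scalar_prod_def lessThan_atLeast0)
    also have "\<dots> = (\<Sum>c<m. \<Sum>t<m. A $$ (a,c) * l t c * l t b)"
      using ab by (intro sum.cong refl) (simp add: l sum_distrib_left mult.assoc)
    also have "\<dots> = (\<Sum>t<m. \<Sum>c<m. A $$ (a,c) * l t c * l t b)" by (rule sum.swap)
    also have "\<dots> = (\<Sum>t<m. mv m (entries A) (l t) a * l t b)"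
      by (simp add: mv_def entries_def sum_distrib_right)
    also have "\<dots> = 0" using Al ab by simp
    finally show "(A * \<Lambda>) $$ (a,b) = 0\<^sub>m m m $$ (a,b)" using ab by simp
  qed (use Ac Lc in auto)
  have rk: "vec_space.rank m A + vec_space.rank m \<Lambda> = m"
    using scc Ac Lc G by (simp add: SCC_def mrank_def A_def)
  define Ym where "Ym = mp_inverse A"
  note mp = mp_inverse_complementary[OF Ac AT Lc LT AL rk, folded Ym_def]
  define Y where "Y = entries Ym"
  have Ysym: "Y a b = Y b a" if "a < m" "b < m" for a b
    using mp(1,2) that unfolding Y_def entries_def by (metis carrier_matD index_transpose_mat(1))
  have YAY: "mv m Y (mv m (entries A) (mv m Y z)) a = mv m Y z a" if "a < m" for z a
  proof -
    have "mv m (entries (Ym * A * Ym)) z a = mv m (entries (Ym * A)) (mv m (entries Ym) z) a"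
      using mp(1) Ac that by (intro mv_entries_mult) auto
    also have "\<dots> = mv m (entries Ym) (mv m (entries A) (mv m (entries Ym) z)) a"
      using mp(1) Ac that by (intro mv_entries_mult) auto
    finally show ?thesis by (simp add: mp(3) Y_def)
  qed
  define r where "r = dim_col E"
  have Ec: "E \<in> carrier_mat m r" using E Ac by (auto simp: ker_basis_mat_def r_def A_def)
  define e where "e j a = E $$ (a,j)" for j a
  have eL: "\<exists>y. \<forall>a<m. e j a = (\<Sum>t<m. y t * l t a)" and Ae: "a < m \<Longrightarrow> mv m (entries A) (e j) a = 0" if j: "j < r" for j a
  proof -
    have ker: "col E j \<in> mat_kernel A"
      by (rule ker_basis_mat_col[OF Ac]) (use E j in \<open>simp_all add: A_def r_def\<close>)
    note ce = mat_kernelD[OF Ac ker]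
    have ecol: "col E j $ a = e j a" if "a < m" for a
      unfolding e_def by (rule index_col) (use Ec j that in auto)
    show "mv m (entries A) (e j) a = 0" if "a < m"
    proof -
      have "(\<Sum>b<m. A $$ (a, b) * col E j $ b) = 0"
        using mult_mat_vec_entries[OF Ac ce(1) that] that unfolding ce(2) by simp
      moreover have "mv m (entries A) (e j) a = (\<Sum>b<m. A $$ (a, b) * col E j $ b)"
        unfolding mv_def entries_def
      proof (rule sum.cong[OF refl])
        fix b assume "b \<in> {..<m}"
        then have "col E j $ b = e j b" using ecol by simp
        then show "A $$ (a, b) * e j b = A $$ (a, b) * col E j $ b" by (simp only:)
      qed
      ultimately show ?thesis by simp
    qed
    \<comment> \<open>Here strict complementarity enters: a kernel vector lies in the image of
      \<open>\<Lambda>\<close>, so it is a combination of the \<open>l t\<close> whose coefficients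
      are the inner products of \<open>l t\<close> with \<open>y\<close>.\<close>
    from mp(4)[OF ce] obtain y where y: "y \<in> carrier_vec m" "col E j = \<Lambda> *\<^sub>v y" by (rule bexE)
    have "e j a = (\<Sum>t<m. (\<Sum>b<m. l t b * y $ b) * l t a)" if a: "a < m" for a
    proof -
      have "e j a = col E j $ a" by (rule ecol[OF a, symmetric])
      also have "\<dots> = (\<Sum>b<m. \<Lambda> $$ (a,b) * y $ b)"
        unfolding y(2) by (rule mult_mat_vec_entries[OF Lc y(1) a])
      also have "\<dots> = (\<Sum>b<m. \<Sum>t<m. l t b * y $ b * l t a)"
      proof (rule sum.cong[OF refl])
        fix b assume "b \<in> {..<m}"
        then have "\<Lambda> $$ (a,b) = (\<Sum>t<m. l t a * l t b)" using l a by simp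
        then show "\<Lambda> $$ (a,b) * y $ b = (\<Sum>t<m. l t b * y $ b * l t a)"
          by (simp only: sum_distrib_left mult_ac)
      qed
      also have "\<dots> = (\<Sum>t<m. \<Sum>b<m. l t b * y $ b * l t a)" by (rule sum.swap)
      finally show ?thesis by (simp add: sum_distrib_right)
    qed
    then show "\<exists>y. \<forall>a<m. e j a = (\<Sum>t<m. y t * l t a)"
      by (intro exI[of _ "\<lambda>t. \<Sum>b<m. l t b * y $ b"]) simp
  qed

  \<comment> \<open>The second order form and the penalty off the critical cone\<close>
  define B where "B h a b = (\<Sum>i<n. h i * D i a b)" for h a b
  have Bsym: "B h a b = B h b a" if "a < m" "b < m" for h a b
    using Dsym[OF that] by (simp add: B_def)
  define S where "S i j = hessL F G u \<Lambda> i j + Hterm G u \<Lambda> i j" for i j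
  define P where "P h = (\<Sum>t<m. \<Sum>j<r. (bil m (B h) (e j) (l t))\<^sup>2)" for h
  have minner_L: "minner \<Lambda> X = (\<Sum>t<m. bil m (entries X) (l t) (l t))" if "X \<in> carrier_mat m m" for X
    using Lsum[of "entries X"] unfolding minner_eq[OF Lc that] by (simp add: entries_def)
  have S_eq: "S i j = peval (pdiff i (pdiff j F)) u - (\<Sum>t<m. bil m (DD i j) (l t) (l t))
      + 2 * (\<Sum>t<m. ip m (mv m (D i) (l t)) (mv m Y (mv m (D j) (l t))))" for i j
  proof -
    have c: "ddG G i j u \<in> carrier_mat m m" "dG G i u * Ym \<in> carrier_mat m m" "dG G i u * Ym * dG G j u \<in> carrier_mat m m"
      using G Dc[of i] Dc[of j] mp(1) by (auto simp: ddG_def evalm_def)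
    have De: "mv m (entries (dG G i u)) x a = mv m (D i) x a" if "a < m" for i x a
      using D_eq that by (simp add: mv_def entries_def)
    have "bil m (entries (ddG G i j u)) (l t) (l t) = bil m (DD i j) (l t) (l t)" for t
      unfolding bil_def using DD_eq by (intro sum.cong refl) (simp add: entries_def)
    moreover have "bil m (entries (dG G i u * Ym * dG G j u)) (l t) (l t) = ip m (mv m (D i) (l t)) (mv m Y (mv m (D j) (l t)))" for t
    proof -
      have "bil m (entries (dG G i u * Ym * dG G j u)) (l t) (l t) = ip m (l t) (mv m (D i) (mv m Y (mv m (D j) (l t))))"
        unfolding ip_mv[symmetric]
      proof (rule ip_cong)
        fix a assume a: "a < m"
        have "mv m (entries (dG G i u * Ym * dG G j u)) (l t) a = mv m (D i) (mv m (entries Ym) (mv m (entries (dG G j u)) (l t))) a"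
          using mv_entries_mult[OF c(2) Dc a] mv_entries_mult[OF Dc mp(1) a] De[OF a] by simp
        also have "\<dots> = mv m (D i) (mv m Y (mv m (D j) (l t))) a"
          unfolding Y_def by (intro mv_cong) (simp add: De)
        finally show "mv m (entries (dG G i u * Ym * dG G j u)) (l t) a = mv m (D i) (mv m Y (mv m (D j) (l t))) a" .
      qed simp
      also have "\<dots> = ip m (mv m (D i) (l t)) (mv m Y (mv m (D j) (l t)))"
        by (rule ip_mv_sym[symmetric]) (use Dsym in auto)
      finally show ?thesis .
    qed
    ultimately show ?thesis
      unfolding S_def hessL_def Hterm_def A_def[symmetric] Ym_def[symmetric] minner_L[OF c(1)] minner_L[OF c(3)] by simp
  qed
  have mvB: "mv m (B h) x a = (\<Sum>i<n. h i * mv m (D i) x a)" for h x a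
    unfolding B_def by (rule mv_sum_left)
  have S_form: "bil n S h h = (\<Sum>i<n. \<Sum>j<n. h i * h j * peval (pdiff i (pdiff j F)) u)
     - (\<Sum>t<m. \<Sum>i<n. \<Sum>j<n. h i * h j * bil m (DD i j) (l t) (l t))
     + 2 * (\<Sum>t<m. ip m (mv m (B h) (l t)) (mv m Y (mv m (B h) (l t))))" for h
  proof -
    have 1: "ip m (mv m (B h) (l t)) (mv m Y (mv m (B h) (l t)))
       = (\<Sum>i<n. \<Sum>j<n. h i * h j * ip m (mv m (D i) (l t)) (mv m Y (mv m (D j) (l t))))" for t
    proof -
      have "mv m (B h) (l t) = (\<lambda>a. \<Sum>i<n. h i * mv m (D i) (l t) a)" by (rule ext) (rule mvB)
      then show ?thesis
        by (simp add: ip_sum_left ip_scale_left mv_sum_right[abs_def] mv_scale_right ip_sum_right ip_scale_right sum_distrib_left mult_ac)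
    qed
    have "bil n S h h = (\<Sum>i<n. \<Sum>j<n. h i * h j * peval (pdiff i (pdiff j F)) u
      - (\<Sum>t<m. h i * h j * bil m (DD i j) (l t) (l t))
      + 2 * (\<Sum>t<m. h i * h j * ip m (mv m (D i) (l t)) (mv m Y (mv m (D j) (l t)))))"
      unfolding bil_def[of n] S_eq by (intro sum.cong refl) (simp add: algebra_simps sum_distrib_left)
    also have "\<dots> = (\<Sum>i<n. \<Sum>j<n. h i * h j * peval (pdiff i (pdiff j F)) u)
      - (\<Sum>i<n. \<Sum>j<n. \<Sum>t<m. h i * h j * bil m (DD i j) (l t) (l t))
      + 2 * (\<Sum>i<n. \<Sum>j<n. \<Sum>t<m. h i * h j * ip m (mv m (D i) (l t)) (mv m Y (mv m (D j) (l t))))"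
      by (simp add: sum.distrib sum_subtractf sum_distrib_left)
    finally show ?thesis
      unfolding 1 sum_swap3[where I = "{..<n}" and J = "{..<n}" and K = "{..<m}"] .
  qed
  define T where "T = {h \<in> pts n. (\<Sum>i<n. h i * h i) = (1::real)}"
  have contc: "continuous_on X (\<lambda>h :: nat \<Rightarrow> real. h i)" for X i
    by (rule continuous_on_subset[OF continuous_on_product_coordinates]) simp
  have T: "compact T"
  proof -
    have "\<bar>h i\<bar> \<le> 1" if h: "h \<in> T" and i: "i < n" for h i
    proof -
      have fin: "i \<in> {..<n}" "finite {..<n}" using i by auto
      have "h i * h i + (\<Sum>i\<in>{..<n}-{i}. h i * h i) = 1"
        using h sum.remove[OF fin(2,1), of "\<lambda>i. h i * h i"] unfolding T_def by (metis (mono_tags) mem_Collect_eq)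
      moreover have "(\<Sum>i\<in>{..<n}-{i}. h i * h i) \<ge> 0" by (rule sum_nonneg) simp
      ultimately have "h i * h i \<le> 1" by linarith
      then show ?thesis by (simp add: abs_square_le_1 flip: power2_eq_square)
    qed
    then have Teq: "T = {h \<in> pts n. \<forall>i<n. \<bar>h i\<bar> \<le> 1} \<inter> {h. (\<Sum>i<n. h i * h i) = 1}"
      unfolding T_def by blast
    have cl: "closed {h :: nat \<Rightarrow> real. (\<Sum>i<n. h i * h i) = 1}"
      by (intro closed_Collect_eq continuous_on_sum continuous_on_mult contc continuous_on_const)
    show ?thesis unfolding Teq by (rule compact_Int_closed[OF compact_box cl])
  qed
  have contS: "continuous_on T (\<lambda>h. bil n S h h)"
    unfolding bil_def by (intro continuous_on_sum continuous_on_mult continuous_on_const contc)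
  have contP: "continuous_on T P"
    unfolding P_def bil_def B_def by (intro continuous_on_sum continuous_on_mult continuous_on_power continuous_on_const contc)
  have SP: "bil n S h h > 0" if h: "h \<in> T" "P h = 0" for h
  proof -
    have Bel: "bil m (B h) (e j) (l t) = 0" if "t < m" "j < r" for t j
    proof -
      have "(\<Sum>j<r. (bil m (B h) (e j) (l t))\<^sup>2) = 0"
        using h(2) that unfolding P_def by (subst (asm) sum_nonneg_eq_0_iff) (auto intro: sum_nonneg)
      then show ?thesis using that by (subst (asm) sum_nonneg_eq_0_iff) auto
    qed
    have swapB: "ip m (mv m (B h) x) y = bil m (B h) x y" for x y
      unfolding ip_mv[symmetric] by (rule ip_mv_sym) (rule Bsym)
    \<comment> \<open>Expanding \<open>e k\<close> in the \<open>l t\<close> turns the vanishing of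
      the penalty into \<open>E^T B(h) E = 0\<close>, the equation of the critical cone.\<close>
    have Bee: "bil m (B h) (e j) (e k) = 0" if "j < r" "k < r" for j k
    proof -
      from eL[OF that(2)] obtain y where y: "\<And>a. a < m \<Longrightarrow> e k a = (\<Sum>t<m. y t * l t a)" by metis
      have "bil m (B h) (e j) (e k) = ip m (mv m (B h) (e j)) (e k)" by (simp only: swapB)
      also have "\<dots> = ip m (mv m (B h) (e j)) (\<lambda>a. \<Sum>t<m. y t * l t a)"
        by (rule ip_cong) (simp_all add: y)
      also have "\<dots> = (\<Sum>t<m. y t * ip m (mv m (B h) (e j)) (l t))"
        by (simp add: ip_sum_right ip_scale_right)
      also have "\<dots> = (\<Sum>t<m. y t * bil m (B h) (e j) (l t))"
        by (simp only: swapB)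
      also have "\<dots> = 0" using Bel that by simp
      finally show ?thesis .
    qed
    have entry: "(E\<^sup>T * dG G i u * E) $$ (j,k) = bil m (D i) (e j) (e k)" if "j < r" "k < r" for i j k
    proof -
      have c: "E\<^sup>T \<in> carrier_mat r m" "E\<^sup>T * dG G i u \<in> carrier_mat r m"
        using Ec Dc[of i] by auto
      have "(E\<^sup>T * dG G i u * E) $$ (j,k) = (\<Sum>b<m. (E\<^sup>T * dG G i u) $$ (j,b) * E $$ (b,k))"
        by (rule index_mult_mat_sum[OF c(2) Ec that])
      also have "\<dots> = (\<Sum>b<m. (\<Sum>a<m. E $$ (a,j) * dG G i u $$ (a,b)) * E $$ (b,k))"
      proof (rule sum.cong[OF refl])
        fix b assume "b \<in> {..<m}"
        then have "(E\<^sup>T * dG G i u) $$ (j,b) = (\<Sum>a<m. E\<^sup>T $$ (j,a) * dG G i u $$ (a,b))"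
          by (intro index_mult_mat_sum[OF c(1) Dc that(1)]) simp
        also have "\<dots> = (\<Sum>a<m. E $$ (a,j) * dG G i u $$ (a,b))"
          using Ec that(1) by (intro sum.cong refl) simp
        finally show "(E\<^sup>T * dG G i u) $$ (j,b) * E $$ (b,k) = (\<Sum>a<m. E $$ (a,j) * dG G i u $$ (a,b)) * E $$ (b,k)" by simp
      qed
      also have "\<dots> = (\<Sum>b<m. \<Sum>a<m. D i a b * e j a * e k b)"
        unfolding sum_distrib_right by (intro sum.cong refl) (simp add: e_def D_eq)
      also have "\<dots> = bil m (D i) (e j) (e k)" unfolding bil_def by (rule sum.swap)
      finally show ?thesis .
    qed
    have Bsum: "bil m (B h) x y = (\<Sum>i<n. h i * bil m (D i) x y)" for x y
    proof -
      have "mv m (B h) y = (\<lambda>a. \<Sum>i<n. h i * mv m (D i) y a)" by (rule ext) (rule mvB)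
      then show ?thesis unfolding ip_mv[symmetric] by (simp only: ip_sum_right ip_scale_right)
    qed
    have crit: "h \<in> crit_cone n G u E"
      unfolding crit_cone_def r_def[symmetric]
    proof (intro CollectI conjI eq_matI)
      show "h \<in> pts n" using h by (simp add: T_def)
      fix j k assume "j < dim_row (0\<^sub>m r r :: real mat)" "k < dim_col (0\<^sub>m r r :: real mat)"
      then have jk: "j < r" "k < r" by auto
      then show "mat r r (\<lambda>(a, b). \<Sum>i<n. h i * (E\<^sup>T * dG G i u * E) $$ (a, b)) $$ (j, k) = 0\<^sub>m r r $$ (j, k)"
        using Bee[OF jk] unfolding Bsum by (simp add: entry)
    qed auto
    have nz: "h \<noteq> (\<lambda>_. 0)"
    proof
      assume "h = (\<lambda>_. 0)"
      then show False using h(1) by (simp add: T_def)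
    qed
    have "(\<Sum>i<n. \<Sum>j<n. h i * h j * S i j) > 0"
      unfolding S_def by (rule sosc[unfolded SOSC_def, rule_format, OF crit nz])
    then show ?thesis by (simp add: bil_def mult_ac)
  qed
  have P0: "P h \<ge> 0" for h unfolding P_def by (intro sum_nonneg) auto
  from penalty_compact[OF T contS contP P0 SP]
  obtain C c1 where c1: "c1 > 0" and Cc: "\<And>h. h \<in> T \<Longrightarrow> c1 \<le> bil n S h h + C * P h"
    by blast

  \<comment> \<open>The vectors \<open>v t\<close> and the Hessian that they produce\<close>
  define x where "x t i = mv m (D i) (l t)" for t i
  \<comment> \<open>The formula of \<open>complete_square\<close> for each basis direction. It is
    linear in \<open>x\<close>, so contraction with \<open>h\<close> gives the right
    \<open>w\<close> for every direction at once. The factor \<open>C / 4\<close> compensates the 4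
    in front of the penalty there.\<close>
  define \<alpha> where "\<alpha> t i a = - (mv m Y (x t i) a + C / 4 * (\<Sum>j<r. ip m (e j) (x t i) * e j a))" for t i a
  define V where "V t a = pconst (l t a) + (\<Sum>i<n. pconst (\<alpha> t i a) * xi u i)" for t a
  have V0: "peval (V t a) u = l t a" for t a by (simp add: V_def)
  have V1: "pdiff i (V t a) = pconst (\<alpha> t i a)" if "i < n" for i t a
  proof -
    have "pdiff i (V t a) = (\<Sum>j<n. pconst (\<alpha> t j a) * (if i = j then 1 else 0))"
      unfolding V_def by (simp only: pdiff_add pdiff_sum pdiff_mult pdiff_pconst pdiff_xi mult_zero_left add_0)
    then show ?thesis using that by (simp add: if_distrib cong: if_cong)
  qed
  define v where "v t = vec m (V t)" for t
  have pv: "polyvec n (dim_row G) (v t)" for t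
    using G unfolding polyvec_def v_def by (auto simp: V_def intro!: is_poly_add is_poly_sum is_poly_mult)
  define q where "q = (\<Sum>t<m. qform G (v t))"
  have q_eq: "q = (\<Sum>t<m. \<Sum>a<m. \<Sum>b<m. V t a * (G $$ (a,b) * V t b))"
    unfolding q_def by (intro sum.cong refl) (simp add: qform_eq[OF G(1)] v_def)
  have q_poly: "is_poly n q"
    unfolding q_eq using G by (intro is_poly_sum is_poly_mult) (auto simp: V_def intro!: is_poly_add is_poly_sum is_poly_mult)
  have lAl: "(\<Sum>b<m. peval (G $$ (a,b)) u * l t b) = 0" "(\<Sum>b<m. l t b * peval (G $$ (b,a)) u) = 0" if "t < m" "a < m" for t a
  proof -
    show 1: "(\<Sum>b<m. peval (G $$ (a,b)) u * l t b) = 0"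
      using Al[OF that] A_eq that by (simp add: mv_def entries_def)
    have "(\<Sum>b<m. l t b * peval (G $$ (b,a)) u) = (\<Sum>b<m. peval (G $$ (a,b)) u * l t b)"
      using Gsym that by (intro sum.cong refl) (simp add: mult.commute)
    then show "(\<Sum>b<m. l t b * peval (G $$ (b,a)) u) = 0" using 1 by simp
  qed
  have q0: "peval q u = 0"
    unfolding q_eq by (simp add: V0 lAl(1) flip: sum_distrib_left)
  \<comment> \<open>Terms in which \<open>V\<close> is differentiated vanish because
    \<open>A\<close> annihilates \<open>l t\<close>. What remains is the inner product of
    \<open>\<Lambda>\<close> with the derivative of \<open>G\<close>, the gradient of
    \<open>F\<close> by the KKT equation.\<close>
  have q1: "peval (pdiff i q) u = peval (pdiff i F) u" if i: "i < n" for i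
  proof -
    have "peval (pdiff i q) u = (\<Sum>t<m. (\<Sum>a<m. \<Sum>b<m. \<alpha> t i a * (peval (G $$ (a,b)) u * l t b))
         + (\<Sum>a<m. \<Sum>b<m. l t a * (D i a b * l t b)) + (\<Sum>a<m. \<Sum>b<m. l t a * peval (G $$ (a,b)) u * \<alpha> t i b))"
      unfolding q_eq by (simp add: pdiff_mult V0 V1[OF i] D_def algebra_simps sum.distrib)
    also have "\<dots> = (\<Sum>t<m. bil m (D i) (l t) (l t))"
    proof (intro sum.cong refl)
      fix t assume "t \<in> {..<m}"
      then have t: "t < m" by simp
      have "(\<Sum>a<m. \<Sum>b<m. \<alpha> t i a * (peval (G $$ (a,b)) u * l t b)) = 0"
        by (simp add: lAl(1)[OF t] flip: sum_distrib_left)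
      moreover have "(\<Sum>a<m. \<Sum>b<m. l t a * peval (G $$ (a,b)) u * \<alpha> t i b) = 0"
        by (subst sum.swap) (simp add: lAl(2)[OF t] flip: sum_distrib_right)
      ultimately show "(\<Sum>a<m. \<Sum>b<m. \<alpha> t i a * (peval (G $$ (a,b)) u * l t b)) + (\<Sum>a<m. \<Sum>b<m. l t a * (D i a b * l t b))
         + (\<Sum>a<m. \<Sum>b<m. l t a * peval (G $$ (a,b)) u * \<alpha> t i b) = bil m (D i) (l t) (l t)"
        by (simp add: bil_def mult_ac)
    qed
    also have "\<dots> = (\<Sum>a<m. \<Sum>b<m. \<Lambda> $$ (a,b) * D i a b)" by (rule Lsum[symmetric])
    also have "\<dots> = minner (dG G i u) \<Lambda>"
      unfolding minner_eq[OF Dc Lc] by (intro sum.cong refl) (simp add: D_eq)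
    finally show ?thesis by (simp add: grad[OF i])
  qed
  define H where "H i j = peval (pdiff i (pdiff j (F - q))) u" for i j
  \<comment> \<open>For each \<open>t\<close> the Hessian of the form is
    \<open>2 w^T A w + 4 l^T B w\<close> plus the second derivatives of \<open>G\<close> at
    \<open>l t\<close>. Completing the square makes the first two terms negative; subtracted from
    the Hessian of \<open>F\<close> they supply the contribution of \<open>Hterm\<close> and the
    penalty.\<close>
  have H_form: "bil n H h h = bil n S h h + C * P h" for h
  proof -
    define w where "w t a = (\<Sum>i<n. h i * \<alpha> t i a)" for t a
    have wx: "w t = (\<lambda>a. - (mv m Y (mv m (B h) (l t)) a + C / 4 * (\<Sum>j<r. ip m (e j) (mv m (B h) (l t)) * e j a)))" for t
    proof
      fix a
      have mb: "mv m (B h) (l t) = (\<lambda>b. \<Sum>i<n. h i * x t i b)"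
        unfolding x_def by (rule ext) (rule mvB)
      have "w t a = - ((\<Sum>i<n. h i * mv m Y (x t i) a) + C / 4 * (\<Sum>i<n. \<Sum>j<r. h i * ip m (e j) (x t i) * e j a))"
        by (simp add: w_def \<alpha>_def algebra_simps sum.distrib sum_negf sum_subtractf sum_distrib_left)
      also have "(\<Sum>i<n. \<Sum>j<r. h i * ip m (e j) (x t i) * e j a) = (\<Sum>j<r. ip m (e j) (mv m (B h) (l t)) * e j a)"
        unfolding mb ip_sum_right ip_scale_right by (subst sum.swap) (simp add: sum_distrib_right)
      also have "(\<Sum>i<n. h i * mv m Y (x t i) a) = mv m Y (mv m (B h) (l t)) a"
        unfolding mb mv_sum_right mv_scale_right ..
      finally show "w t a = - (mv m Y (mv m (B h) (l t)) a + C / 4 * (\<Sum>j<r. ip m (e j) (mv m (B h) (l t)) * e j a))" .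
    qed
    have hess_q: "peval (pdiff i (pdiff j q)) u = (\<Sum>t<m. \<Sum>a<m. \<Sum>b<m.
        (\<alpha> t i a * \<alpha> t j b + \<alpha> t j a * \<alpha> t i b) * peval (G $$ (a,b)) u + \<alpha> t j a * l t b * D i a b + \<alpha> t i a * l t b * D j a b
         + l t a * \<alpha> t j b * D i a b + l t a * \<alpha> t i b * D j a b + l t a * l t b * DD i j a b)" if "i < n" "j < n" for i j
      unfolding q_eq pdiff_sum peval_sum using that
      by (intro sum.cong refl) (simp add: hessian_triple[OF V1 V1 V1 V1] V0 D_def DD_def)
    have "(\<Sum>i<n. \<Sum>j<n. h i * h j * peval (pdiff i (pdiff j q)) u) =
       (\<Sum>i<n. \<Sum>j<n. \<Sum>t<m. \<Sum>a<m. \<Sum>b<m. h i * h j * (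
        (\<alpha> t i a * \<alpha> t j b + \<alpha> t j a * \<alpha> t i b) * peval (G $$ (a,b)) u + \<alpha> t j a * l t b * D i a b + \<alpha> t i a * l t b * D j a b
         + l t a * \<alpha> t j b * D i a b + l t a * \<alpha> t i b * D j a b + l t a * l t b * DD i j a b))"
    proof (rule sum.cong[OF refl], rule sum.cong[OF refl])
      fix i j assume "i \<in> {..<n}" "j \<in> {..<n}"
      then have ij: "i < n" "j < n" by auto
      show "h i * h j * peval (pdiff i (pdiff j q)) u = (\<Sum>t<m. \<Sum>a<m. \<Sum>b<m. h i * h j * (
        (\<alpha> t i a * \<alpha> t j b + \<alpha> t j a * \<alpha> t i b) * peval (G $$ (a,b)) u + \<alpha> t j a * l t b * D i a b + \<alpha> t i a * l t b * D j a b
         + l t a * \<alpha> t j b * D i a b + l t a * \<alpha> t i b * D j a b + l t a * l t b * DD i j a b))"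
        unfolding hess_q[OF ij] by (simp only: sum_distrib_left)
    qed
    also have "\<dots> = (\<Sum>t<m. \<Sum>a<m. \<Sum>b<m. \<Sum>i<n. \<Sum>j<n. h i * h j * (
        (\<alpha> t i a * \<alpha> t j b + \<alpha> t j a * \<alpha> t i b) * peval (G $$ (a,b)) u + \<alpha> t j a * l t b * D i a b + \<alpha> t i a * l t b * D j a b
         + l t a * \<alpha> t j b * D i a b + l t a * \<alpha> t i b * D j a b + l t a * l t b * DD i j a b))"
      by (rule sum_swap5)
    also have "\<dots> = (\<Sum>t<m. \<Sum>a<m. \<Sum>b<m. 2 * (w t a * peval (G $$ (a,b)) u * w t b) + 2 * (w t a * B h a b * l t b)
        + 2 * (l t a * B h a b * w t b) + l t a * l t b * (\<Sum>i<n. \<Sum>j<n. h i * h j * DD i j a b))"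
      unfolding hessian_triple_form w_def B_def ..
    also have "\<dots> = (\<Sum>t<m. 2 * bil m (entries A) (w t) (w t) + 4 * bil m (B h) (l t) (w t)
         + (\<Sum>i<n. \<Sum>j<n. h i * h j * bil m (DD i j) (l t) (l t)))"
    proof (intro sum.cong refl)
      fix t
      have "(\<Sum>a<m. \<Sum>b<m. w t a * peval (G $$ (a,b)) u * w t b) = bil m (entries A) (w t) (w t)"
        unfolding bil_def by (intro sum.cong refl) (simp add: entries_def A_eq mult_ac)
      moreover have "(\<Sum>a<m. \<Sum>b<m. w t a * B h a b * l t b) = bil m (B h) (l t) (w t)"
        using bil_commute[of m "B h" "l t" "w t"] Bsym by (simp add: bil_def mult_ac)
      moreover have "(\<Sum>a<m. \<Sum>b<m. l t a * B h a b * w t b) = bil m (B h) (l t) (w t)"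
        by (simp add: bil_def mult_ac)
      moreover have "(\<Sum>a<m. \<Sum>b<m. l t a * l t b * (\<Sum>i<n. \<Sum>j<n. h i * h j * DD i j a b))
          = (\<Sum>i<n. \<Sum>j<n. h i * h j * bil m (DD i j) (l t) (l t))"
      proof -
        have "(\<Sum>a<m. \<Sum>b<m. l t a * l t b * (\<Sum>i<n. \<Sum>j<n. h i * h j * DD i j a b))
            = (\<Sum>a<m. \<Sum>b<m. \<Sum>i<n. \<Sum>j<n. h i * h j * (DD i j a b * l t a * l t b))"
          by (simp add: sum_distrib_left mult_ac)
        also have "\<dots> = (\<Sum>i<n. \<Sum>a<m. \<Sum>b<m. \<Sum>j<n. h i * h j * (DD i j a b * l t a * l t b))"
          by (rule sum_swap3)
        also have "\<dots> = (\<Sum>i<n. \<Sum>j<n. \<Sum>a<m. \<Sum>b<m. h i * h j * (DD i j a b * l t a * l t b))"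
          by (rule sum.cong[OF refl]) (rule sum_swap3)
        finally show ?thesis by (simp add: bil_def sum_distrib_left)
      qed
      ultimately show "(\<Sum>a<m. \<Sum>b<m. 2 * (w t a * peval (G $$ (a,b)) u * w t b) + 2 * (w t a * B h a b * l t b)
        + 2 * (l t a * B h a b * w t b) + l t a * l t b * (\<Sum>i<n. \<Sum>j<n. h i * h j * DD i j a b))
        = 2 * bil m (entries A) (w t) (w t) + 4 * bil m (B h) (l t) (w t)
         + (\<Sum>i<n. \<Sum>j<n. h i * h j * bil m (DD i j) (l t) (l t))"
        by (simp add: sum.distrib flip: sum_distrib_left)
    qed
    also have "\<dots> = (\<Sum>t<m. - 2 * ip m (mv m (B h) (l t)) (mv m Y (mv m (B h) (l t))) - C * (\<Sum>j<r. (bil m (B h) (e j) (l t))\<^sup>2)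
         + (\<Sum>i<n. \<Sum>j<n. h i * h j * bil m (DD i j) (l t) (l t)))"
    proof (intro sum.cong refl arg_cong2[where f = "(+)"])
      fix t
      show "2 * bil m (entries A) (w t) (w t) + 4 * bil m (B h) (l t) (w t)
        = - 2 * ip m (mv m (B h) (l t)) (mv m Y (mv m (B h) (l t))) - C * (\<Sum>j<r. (bil m (B h) (e j) (l t))\<^sup>2)"
        using complete_square[where m = m and A = "entries A" and B = "B h" and Y = Y and r = r and e = e and C = "C / 4" and l = "l t", OF Asym Bsym Ysym YAY Ae]
        unfolding wx by (simp add: ip_mv)
    qed
    also have "\<dots> = - 2 * (\<Sum>t<m. ip m (mv m (B h) (l t)) (mv m Y (mv m (B h) (l t)))) - C * P h
         + (\<Sum>t<m. \<Sum>i<n. \<Sum>j<n. h i * h j * bil m (DD i j) (l t) (l t))"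
      by (simp add: P_def sum.distrib sum_subtractf sum_distrib_left sum_negf)
    finally have fq: "(\<Sum>i<n. \<Sum>j<n. h i * h j * peval (pdiff i (pdiff j q)) u) =
      - 2 * (\<Sum>t<m. ip m (mv m (B h) (l t)) (mv m Y (mv m (B h) (l t)))) - C * P h
         + (\<Sum>t<m. \<Sum>i<n. \<Sum>j<n. h i * h j * bil m (DD i j) (l t) (l t))" .
    have "bil n H h h = (\<Sum>i<n. \<Sum>j<n. h i * h j * peval (pdiff i (pdiff j F)) u) - (\<Sum>i<n. \<Sum>j<n. h i * h j * peval (pdiff i (pdiff j q)) u)"
      by (simp add: bil_def H_def algebra_simps sum_subtractf)
    then show ?thesis unfolding fq S_form by simp
  qed
  have H_low: "c1 * (\<Sum>i<n. h i * h i) \<le> bil n H h h" for h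
    by (rule bounded_below_on_sphere) (use Cc in \<open>auto simp: H_form T_def\<close>)

  \<comment> \<open>The rest of the Hessian as a sum of squares\<close>
  show ?thesis
  proof (intro exI[of _ "c1 / 2"] conjI allI impI)
    show "c1 / 2 > 0" using c1 by simp
    \<comment> \<open>All small \<open>c\<close> are covered, not just one, because the global
      construction needs a value that varies with the minimizer: a common constant times the leading
      coefficient of \<open>p\<close> there.\<close>
    fix c assume c: "0 < c \<and> c \<le> c1 / 2"
    \<comment> \<open>One factor 1/2 averages \<open>H\<close> with its transpose, as Cholesky
      decomposition requires symmetry; the other is the 1/2 of the second order Taylor term. The
      latter also explains the bound \<open>c1 / 2\<close> on \<open>c\<close>.\<close>
    define Q where "Q i j = (H i j + H j i) / 4 - (if i = j then c else 0)" for i j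
    have "psd_form n Q"
      unfolding psd_form_def
    proof (intro conjI allI impI)
      fix h
      have "bil n Q h h = (\<Sum>i<n. \<Sum>j<n. H i j * h i * h j / 4) + (\<Sum>i<n. \<Sum>j<n. H j i * h i * h j / 4) - (\<Sum>i<n. \<Sum>j<n. if i = j then c * h i * h j else 0)"
        unfolding bil_def sum.distrib[symmetric] sum_subtractf[symmetric]
        by (intro sum.cong refl) (simp add: Q_def algebra_simps)
      also have "(\<Sum>i<n. \<Sum>j<n. H j i * h i * h j / 4) = (\<Sum>i<n. \<Sum>j<n. H i j * h i * h j / 4)"
        by (subst sum.swap) (simp add: mult_ac)
      also have "(\<Sum>i<n. \<Sum>j<n. H i j * h i * h j / 4) = bil n H h h / 4"
        by (simp add: bil_def sum_divide_distrib)
      also have "(\<Sum>i<n. \<Sum>j<n. if i = j then c * h i * h j else 0) = c * (\<Sum>i<n. h i * h i)"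
        by (simp add: sum_distrib_left mult_ac)
      finally have "bil n Q h h = bil n H h h / 2 - c * (\<Sum>i<n. h i * h i)" by simp
      moreover have "c * (\<Sum>i<n. h i * h i) \<le> c1 / 2 * (\<Sum>i<n. h i * h i)"
        using c by (intro mult_right_mono sum_nonneg) auto
      ultimately show "0 \<le> bil n Q h h" using H_low[of h] by simp
    qed (auto simp: Q_def)
    from psd_form_decomp[OF this] obtain k where k: "\<And>i j. i < n \<Longrightarrow> j < n \<Longrightarrow> Q i j = (\<Sum>s<n. k s i * k s j)"
      by blast
    define lf where "lf s = (\<Sum>i<n. pconst (k s i) * xi u i)" for s
    have lf_poly: "is_poly n (lf s)" for s by (auto simp: lf_def intro!: is_poly_sum)
    have lf0: "peval (lf s) u = 0" for s by (simp add: lf_def)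
    have lf1: "pdiff i (lf s) = pconst (k s i)" if "i < n" for i s
    proof -
      have "pdiff i (lf s) = (\<Sum>j<n. pconst (k s j) * (if i = j then 1 else 0))"
        unfolding lf_def by (simp only: pdiff_sum pdiff_mult pdiff_pconst pdiff_xi mult_zero_left add_0)
      then show ?thesis using that by (simp add: if_distrib cong: if_cong)
    qed
    define \<sigma> where "\<sigma> = (\<Sum>s<n. lf s * lf s)"
    have sos: "sos n \<sigma>" unfolding \<sigma>_def by (intro sos_sum sos_square lf_poly)
    have \<sigma>2: "peval (pdiff i (pdiff j \<sigma>)) u = 2 * Q i j" if "i < n" "j < n" for i j
    proof -
      have "peval 2 u = 2" using peval_pconst[of 2 u] by (simp add: pconst_numeral)
      then show ?thesis
        unfolding \<sigma>_def using that by (simp add: pdiff_mult lf1 lf0 k sum_distrib_left mult_ac sum.distrib)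
    qed
    define N where "N = (\<Sum>i<n. xi u i * xi u i)"
    have N2: "peval (pdiff i (pdiff j N)) u = (if i = j then 2 else 0)" if "i < n" "j < n" for i j
    proof -
      have "pdiff j N = (\<Sum>k<n. (if j = k then 1 else 0) * xi u k + xi u k * (if j = k then 1 else 0))"
        unfolding N_def by (simp only: pdiff_sum pdiff_mult pdiff_xi)
      also have "\<dots> = (\<Sum>k<n. if j = k then xi u k + xi u k else 0)"
        by (intro sum.cong refl) auto
      also have "\<dots> = xi u j + xi u j" using that by simp
      finally have "pdiff j N = xi u j + xi u j" .
      then have "peval (pdiff i (pdiff j N)) u = peval (pdiff i (xi u j)) u + peval (pdiff i (xi u j)) u"
        by (simp only: pdiff_add peval_add)
      also have "\<dots> = (if i = j then 2 else 0)" by (cases "i = j") (simp_all only: pdiff_xi peval_1 peval_0, simp_all)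
      finally show ?thesis .
    qed
    have N1: "peval (pdiff i N) u = 0" for i unfolding N_def by (simp add: pdiff_mult)
    let ?g = "\<sigma> + q"
    have "?g \<in> qmod n G"
      unfolding qmod_def q_def using sos pv by blast
    moreover have "peval ?g u = 0" using q0 by (simp add: \<sigma>_def lf0)
    moreover have "cubic n u (F - ?g - pconst c * N)"
    proof (rule cubicI)
      show "is_poly n (F - ?g - pconst c * N)"
        using F q_poly sos_is_poly[OF sos] by (auto simp: N_def intro!: is_poly_diff is_poly_add is_poly_mult is_poly_sum)
      show "peval (F - ?g - pconst c * N) u = 0" using F q0 by (simp add: \<sigma>_def lf0 N_def)
      show "peval (pdiff i (F - ?g - pconst c * N)) u = 0" if "i < n" for i
      proof -
        have "peval (pdiff i \<sigma>) u = 0" unfolding \<sigma>_def by (simp add: pdiff_mult lf0)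
        then show ?thesis using q1[OF that] N1 by (simp add: pdiff_mult)
      qed
      show "peval (pdiff i (pdiff j (F - ?g - pconst c * N))) u + peval (pdiff j (pdiff i (F - ?g - pconst c * N))) u = 0"
        if "i < n" "j < n" for i j
      proof -
        have *: "peval (pdiff i (pdiff j (F - ?g - pconst c * N))) u = H i j - 2 * Q i j - c * (if i = j then 2 else 0)" if "i < n" "j < n" for i j
          using \<sigma>2[OF that] N2[OF that] by (simp add: H_def pdiff_mult)
        show ?thesis unfolding *[OF that] *[OF that(2,1)] by (simp add: Q_def field_simps)
      qed
    qed
    ultimately show "\<exists>g\<in>qmod n G. peval g u = 0 \<and> cubic n u (F - g - pconst c * (\<Sum>i<n. xi u i * xi u i))"
      unfolding N_def by blast
  qed
qed

subsection \<open>Interpolation and forms with small coefficients\<close>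

definition comaximal :: "nat \<Rightarrow> rpoly \<Rightarrow> rpoly \<Rightarrow> bool" where
  "comaximal n a b \<longleftrightarrow> (\<exists>s t. is_poly n s \<and> is_poly n t \<and> s * a + t * b = 1)"

lemma comaximal_commute: "comaximal n a b \<Longrightarrow> comaximal n b a"
  unfolding comaximal_def by (elim exE conjE, rule exI, rule exI, intro conjI) (assumption | simp add: add.commute)+

lemma comaximal_1: "comaximal n 1 b"
  unfolding comaximal_def by (intro exI[of _ 1] exI[of _ 0] conjI) simp_all

lemma comaximal_mult:
  assumes "is_poly n a" "is_poly n a'" "is_poly n b" "comaximal n a b" "comaximal n a' b"
  shows "comaximal n (a * a') b"
proof -
  obtain s t s' t' where *: "is_poly n s" "is_poly n t" "s * a + t * b = 1"
    "is_poly n s'" "is_poly n t'" "s' * a' + t' * b = 1"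
    using assms(4,5) unfolding comaximal_def by (elim exE conjE)
  have "(s * s') * (a * a') + (s * a * t' + t * s' * a' + t * t' * b) * b = (s * a + t * b) * (s' * a' + t' * b)"
    by (simp add: algebra_simps)
  then have "(s * s') * (a * a') + (s * a * t' + t * s' * a' + t * t' * b) * b = 1"
    unfolding *(3,6) by simp
  then show ?thesis
    unfolding comaximal_def
    by (intro exI[of _ "s * s'"] exI[of _ "s * a * t' + t * s' * a' + t * t' * b"] conjI) (simp_all add: * assms)
qed

lemma comaximal_power: "is_poly n a \<Longrightarrow> is_poly n b \<Longrightarrow> comaximal n a b \<Longrightarrow> comaximal n (a ^ k) b"
  by (induction k) (auto intro: comaximal_1 comaximal_mult)

lemma comaximal_prod:
  assumes "\<And>c. c \<in> J \<Longrightarrow> is_poly n (a c)" "is_poly n b" "\<And>c. c \<in> J \<Longrightarrow> comaximal n (a c) b"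
  shows "comaximal n (\<Prod>c\<in>J. a c) b"
  using assms by (induction J rule: infinite_finite_induct) (auto intro!: comaximal_1 comaximal_mult is_poly_prod)

text \<open>Adding \<open>e\<close> multiplies the old cofactors by \<open>t e\<close>, while the
  cofactor of \<open>e\<close> is the product of all the old factors. The \<open>k\<close>-th powers
  of \<open>t e\<close> and of this product are comaximal, so their Bezout identity combines with
  the old one.\<close>

lemma unit_ideal_of_cofactors:
  assumes "finite J" "J \<noteq> {}" and poly: "\<And>c. c \<in> J \<Longrightarrow> is_poly n (t c)"
    and comax: "\<And>c d. c \<in> J \<Longrightarrow> d \<in> J \<Longrightarrow> c \<noteq> d \<Longrightarrow> comaximal n (t c) (t d)"
  shows "\<exists>\<alpha>. (\<forall>c\<in>J. is_poly n (\<alpha> c)) \<and> (\<Sum>c\<in>J. \<alpha> c * (\<Prod>d\<in>J-{c}. t d) ^ k) = 1"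
  using assms
proof (induction J rule: finite_ne_induct)
  case (singleton c)
  show ?case by (intro exI[of _ "\<lambda>_. 1"] conjI) simp_all
next
  case (insert e J)
  have "\<exists>\<alpha>. (\<forall>c\<in>J. is_poly n (\<alpha> c)) \<and> (\<Sum>c\<in>J. \<alpha> c * (\<Prod>d\<in>J-{c}. t d) ^ k) = 1"
  proof (rule insert.IH)
    show "is_poly n (t c)" if "c \<in> J" for c using insert.prems(1)[of c] that by simp
    show "comaximal n (t c) (t d)" if "c \<in> J" "d \<in> J" "c \<noteq> d" for c d using insert.prems(2)[of c d] that by simp
  qed
  then obtain \<alpha> where "(\<forall>c\<in>J. is_poly n (\<alpha> c)) \<and> (\<Sum>c\<in>J. \<alpha> c * (\<Prod>d\<in>J-{c}. t d) ^ k) = 1"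
    by (rule exE)
  then have \<alpha>: "\<And>c. c \<in> J \<Longrightarrow> is_poly n (\<alpha> c)" "(\<Sum>c\<in>J. \<alpha> c * (\<Prod>d\<in>J-{c}. t d) ^ k) = 1"
    by simp_all
  let ?T = "\<Prod>d\<in>J. t d"
  have tJ: "is_poly n (t c)" "comaximal n (t c) (t e)" if "c \<in> J" for c
    using insert.prems(1)[of e] insert.prems(1)[of c] insert.prems(2)[of c e] insert.hyps(3) that by auto
  have te: "is_poly n (t e)" using insert.prems(1)[of e] by simp
  have T: "is_poly n ?T" using tJ by (intro is_poly_prod)
  have "comaximal n ?T (t e)" using tJ te by (intro comaximal_prod)
  then have "comaximal n (?T ^ k) (t e)" using T te by (intro comaximal_power)
  then have "comaximal n (t e ^ k) (?T ^ k)"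
    by (rule comaximal_power[OF te is_poly_power[OF T] comaximal_commute])
  then obtain s r where sr: "is_poly n s" "is_poly n r" "s * t e ^ k + r * ?T ^ k = 1"
    unfolding comaximal_def by (elim exE conjE)
  define \<beta> where "\<beta> c = (if c = e then r else s * \<alpha> c)" for c
  have "(\<Sum>c\<in>insert e J. \<beta> c * (\<Prod>d\<in>insert e J-{c}. t d) ^ k)
      = r * ?T ^ k + (\<Sum>c\<in>J. \<beta> c * (\<Prod>d\<in>insert e J-{c}. t d) ^ k)"
    using insert.hyps by (simp add: \<beta>_def)
  also have "(\<Sum>c\<in>J. \<beta> c * (\<Prod>d\<in>insert e J-{c}. t d) ^ k) = (\<Sum>c\<in>J. s * t e ^ k * (\<alpha> c * (\<Prod>d\<in>J-{c}. t d) ^ k))"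
  proof (rule sum.cong[OF refl])
    fix c assume c: "c \<in> J"
    then have ce: "c \<noteq> e" using insert.hyps by auto
    then have eq: "insert e J - {c} = insert e (J - {c})" by auto
    have "(\<Prod>d\<in>insert e J-{c}. t d) = t e * (\<Prod>d\<in>J-{c}. t d)"
      unfolding eq using insert.hyps by simp
    then show "\<beta> c * (\<Prod>d\<in>insert e J-{c}. t d) ^ k = s * t e ^ k * (\<alpha> c * (\<Prod>d\<in>J-{c}. t d) ^ k)"
      using ce by (simp add: \<beta>_def power_mult_distrib mult_ac)
  qed
  also have "\<dots> = s * t e ^ k" unfolding sum_distrib_left[symmetric] \<alpha>(2) by simp
  also have "r * ?T ^ k + s * t e ^ k = 1" using sr(3) by (simp add: add.commute)
  finally have "(\<Sum>c\<in>insert e J. \<beta> c * (\<Prod>d\<in>insert e J-{c}. t d) ^ k) = 1" .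
  moreover have "\<forall>c\<in>insert e J. is_poly n (\<beta> c)"
    using \<alpha>(1) sr by (auto simp: \<beta>_def)
  ultimately show ?case by (intro exI[of _ \<beta>] conjI)
qed

text \<open>Lagrange interpolation of distinct numbers. For one such \<open>f\<close> the
  polynomials \<open>f - f(u)\<close> differ by nonzero constants and are therefore pairwise
  comaximal in the polynomial ring.\<close>

lemma separating_poly:
  fixes U :: "(nat \<Rightarrow> real) set"
  assumes U: "finite U" "U \<subseteq> pts n"
  obtains f where "is_poly n f" "inj_on (peval f) U"
proof -
  have "\<exists>i<n. u i \<noteq> v i" if "u \<in> U" "v \<in> U" "u \<noteq> v" for u v
  proof (rule ccontr)
    assume *: "\<not> (\<exists>i<n. u i \<noteq> v i)"
    have "u = v"
    proof
      fix i show "u i = v i"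
        using * subsetD[OF U(2) that(1)] subsetD[OF U(2) that(2)] by (cases "i < n") (auto simp: pts_def)
    qed
    then show False using that(3) by contradiction
  qed
  note ex = this
  define i where "i u v = (SOME i. i < n \<and> u i \<noteq> v i)" for u v :: "nat \<Rightarrow> real"
  have i: "i u v < n \<and> u (i u v) \<noteq> v (i u v)" if "u \<in> U" "v \<in> U" "u \<noteq> v" for u v
    unfolding i_def by (rule someI_ex[OF ex[OF that]])
  define e where "e u = (\<Prod>v\<in>U-{u}. xi v (i u v))" for u
  have e_poly: "is_poly n (e u)" if "u \<in> U" for u
    unfolding e_def using i that by (intro is_poly_prod is_poly_xi) auto
  have e0: "peval (e u) v = 0" if "u \<in> U" "v \<in> U" "u \<noteq> v" for u v :: "nat \<Rightarrow> real"
    unfolding e_def peval_prod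
  proof (rule prod_zero)
    show "\<exists>w\<in>U-{u}. peval (xi w (i u w)) v = 0" by (rule bexI[of _ v]) (use that in auto)
  qed (use U(1) in simp)
  have e1: "peval (e u) u \<noteq> 0" if "u \<in> U" for u
  proof -
    have "peval (xi v (i u v)) u \<noteq> 0" if "v \<in> U - {u}" for v
      using i[of u v] that \<open>u \<in> U\<close> by auto
    then show ?thesis unfolding e_def peval_prod using U(1) by (simp add: prod_zero_iff)
  qed
  obtain idx :: "(nat \<Rightarrow> real) \<Rightarrow> nat" where idx: "inj_on idx U"
    using finite_imp_inj_to_nat_seg[OF U(1)] by blast
  define f where "f = (\<Sum>u\<in>U. pconst (real (idx u) / peval (e u) u) * e u)"
  have val: "peval f v = real (idx v)" if v: "v \<in> U" for v
  proof -
    have "peval f v = (\<Sum>u\<in>U. if u = v then real (idx v) else 0)"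
      unfolding f_def peval_sum
    proof (rule sum.cong[OF refl])
      fix u assume u: "u \<in> U"
      show "peval (pconst (real (idx u) / peval (e u) u) * e u) v = (if u = v then real (idx v) else 0)"
        using e0[OF u v] e1[OF u] by (cases "u = v") simp_all
    qed
    then show ?thesis using v U(1) by simp
  qed
  show thesis
  proof (rule that)
    show "is_poly n f" unfolding f_def using e_poly by (intro is_poly_sum is_poly_mult) auto
    show "inj_on (peval f) U"
    proof (rule inj_onI)
      fix u v assume "u \<in> U" "v \<in> U" "peval f u = (peval f v :: real)"
      then show "u = v" using val[of u] val[of v] inj_onD[OF idx, of u v] by simp
    qed
  qed
qed

text \<open>\<open>P u\<close> is the product of the \<open>f - f(v)\<close> over the other points
  \<open>v\<close>, with \<open>f\<close> separating the points; the Bezout identity for powers of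
  cofactors gives the \<open>\<alpha> u\<close>.\<close>

lemma interpolation_partition:
  fixes U :: "(nat \<Rightarrow> real) set"
  assumes U: "finite U" "U \<subseteq> pts n" "U \<noteq> {}"
  obtains P \<alpha> where "\<And>u. u \<in> U \<Longrightarrow> is_poly n (P u)" "\<And>u. u \<in> U \<Longrightarrow> is_poly n (\<alpha> u)"
    "\<And>u. u \<in> U \<Longrightarrow> peval (P u) u \<noteq> 0" "\<And>u v. u \<in> U \<Longrightarrow> v \<in> U \<Longrightarrow> u \<noteq> v \<Longrightarrow> peval (P u) v = 0"
    "(\<Sum>u\<in>U. \<alpha> u * P u ^ k) = 1"
proof -
  obtain f where f: "is_poly n f" "inj_on (peval f) U" using separating_poly[OF U(1,2)] .
  define t where "t u = f - pconst (peval f u)" for u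
  have t: "is_poly n (t u)" for u using f(1) by (simp add: t_def)
  have "comaximal n (t u) (t v)" if "u \<in> U" "v \<in> U" "u \<noteq> v" for u v
  proof -
    let ?d = "peval f v - peval f u"
    have d: "?d \<noteq> 0" using f(2) that by (auto simp: inj_on_def)
    have "pconst (1 / ?d) * t u + pconst (- 1 / ?d) * t v = pconst (1 / ?d) * pconst ?d"
      by (simp add: t_def algebra_simps pconst_diff pconst_uminus)
    also have "\<dots> = 1" using d by (simp flip: pconst_mult)
    finally show ?thesis unfolding comaximal_def by (intro exI conjI) simp_all
  qed
  then have "\<exists>\<alpha>. (\<forall>u\<in>U. is_poly n (\<alpha> u)) \<and> (\<Sum>u\<in>U. \<alpha> u * (\<Prod>v\<in>U-{u}. t v) ^ k) = 1"
    by (rule unit_ideal_of_cofactors[OF U(1,3) t])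
  then obtain \<alpha> where "(\<forall>u\<in>U. is_poly n (\<alpha> u)) \<and> (\<Sum>u\<in>U. \<alpha> u * (\<Prod>v\<in>U-{u}. t v) ^ k) = 1"
    by (rule exE)
  then have \<alpha>: "\<And>u. u \<in> U \<Longrightarrow> is_poly n (\<alpha> u)" "(\<Sum>u\<in>U. \<alpha> u * (\<Prod>v\<in>U-{u}. t v) ^ k) = 1"
    by simp_all
  show thesis
  proof (rule that[of "\<lambda>u. \<Prod>v\<in>U-{u}. t v" \<alpha>])
    show "is_poly n (\<Prod>v\<in>U-{u}. t v)" for u using t by (intro is_poly_prod)
    show "peval (\<Prod>v\<in>U-{u}. t v) u \<noteq> 0" if "u \<in> U" for u
      using f(2) that U(1) by (auto simp: prod_zero_iff t_def inj_on_def)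
    show "peval (\<Prod>v\<in>U-{u}. t v) v = 0" if "u \<in> U" "v \<in> U" "u \<noteq> v" for u v
      unfolding peval_prod using U(1) that by (intro prod_zero bexI[of _ v]) (auto simp: t_def)
  qed (use \<alpha> in auto)
qed

lemma abs_form_le:
  fixes b :: "nat \<Rightarrow> nat \<Rightarrow> real"
  assumes "\<And>i j. i < n \<Longrightarrow> j < n \<Longrightarrow> \<bar>b i j\<bar> \<le> \<eta>"
  shows "\<bar>\<Sum>i<n. \<Sum>j<n. b i j * (y i * y j)\<bar> \<le> \<eta> * n * (\<Sum>i<n. y i * y i)"
proof -
  have "\<bar>\<Sum>i<n. \<Sum>j<n. b i j * (y i * y j)\<bar> \<le> (\<Sum>i<n. \<Sum>j<n. \<bar>b i j * (y i * y j)\<bar>)"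
    by (rule order_trans[OF sum_abs]) (intro sum_mono sum_abs)
  also have "\<dots> \<le> (\<Sum>i<n. \<Sum>j<n. \<eta> / 2 * (y i * y i) + \<eta> / 2 * (y j * y j))"
  proof (intro sum_mono)
    fix i j assume "i \<in> {..<n}" "j \<in> {..<n}"
    then have b: "\<bar>b i j\<bar> \<le> \<eta>" using assms by simp
    have "\<bar>y i * y j\<bar> \<le> (y i * y i + y j * y j) / 2"
      using sum_squares_bound[of "\<bar>y i\<bar>" "\<bar>y j\<bar>"] by (simp add: abs_mult power2_eq_square)
    then have "\<bar>b i j\<bar> * \<bar>y i * y j\<bar> \<le> \<eta> * ((y i * y i + y j * y j) / 2)"
      using b by (intro mult_mono) auto
    then show "\<bar>b i j * (y i * y j)\<bar> \<le> \<eta> / 2 * (y i * y i) + \<eta> / 2 * (y j * y j)"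
      by (simp add: abs_mult[of "b i j"] distrib_left add_divide_distrib)
  qed
  also have "\<dots> = \<eta> * n * (\<Sum>i<n. y i * y i)"
  proof -
    define A where "A i = \<eta> / 2 * (y i * y i)" for i
    have "(\<Sum>i<n. \<Sum>j<n. A i + A j) = real n * (\<Sum>i<n. A i) + real n * (\<Sum>i<n. A i)"
      by (simp only: sum.distrib sum_constant card_lessThan sum_distrib_left)
    also have "(\<Sum>i<n. A i) = \<eta> / 2 * (\<Sum>i<n. y i * y i)"
      unfolding A_def by (rule sum_distrib_left[symmetric])
    finally show ?thesis unfolding A_def by simp
  qed
  finally show ?thesis .
qed

context archimedean_module
begin

abbreviation "S \<equiv> nonneg_set n M"

lemma compact_nonneg_set: "compact S"
proof -
  obtain R where R: "R > 0" "pconst R - (\<Sum>i<n. pvar i * pvar i) \<in> M" using arch by blast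
  have bnd: "\<bar>x i\<bar> \<le> R + 1" if x: "x \<in> S" and i: "i < n" for x i
  proof -
    have "0 \<le> peval (pconst R - (\<Sum>i<n. pvar i * pvar i)) x"
      using x R(2) unfolding nonneg_set_def by blast
    then have "(\<Sum>i<n. x i * x i) \<le> R" by simp
    moreover have "(\<Sum>i<n. x i * x i) = x i * x i + (\<Sum>i\<in>{..<n}-{i}. x i * x i)"
      using i by (subst sum.remove[of "{..<n}" i]) auto
    moreover have "(\<Sum>i\<in>{..<n}-{i}. x i * x i) \<ge> 0" by (rule sum_nonneg) simp
    ultimately have "x i * x i \<le> R" by linarith
    also have "R \<le> (R + 1) * (R + 1)" using R by (simp add: algebra_simps)
    finally have "(x i)\<^sup>2 \<le> (R + 1)\<^sup>2" by (simp add: power2_eq_square)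
    then have "\<bar>x i\<bar> \<le> \<bar>R + 1\<bar>" by (simp only: abs_le_square_iff)
    then show ?thesis using R by simp
  qed
  have eq: "S = {x \<in> pts n. \<forall>i<n. \<bar>x i\<bar> \<le> R + 1} \<inter> (\<Inter>m\<in>M. {x. 0 \<le> peval m x})"
    using bnd unfolding nonneg_set_def by blast
  have "closed {x :: nat \<Rightarrow> real. 0 \<le> peval m x}" for m
    by (intro closed_Collect_le continuous_on_const continuous_on_peval)
  then show ?thesis
    unfolding eq by (intro compact_Int_closed[OF compact_box] closed_INT) auto
qed

text \<open>Uses \<open>(\<delta> + b) (q i + q j)^2 + (\<delta> - b) (q i - q j)^2 = 4 b q i q j +
  2 \<delta> (q i^2 + q j^2)\<close>, where both weights are in \<open>M\<close> by the
  Positivstellensatz. Summation over all pairs meets every square \<open>2 n\<close> times, each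
  time with the factor \<open>\<delta> / 2\<close>.\<close>

lemma form_mem:
  assumes b: "\<And>i j. i < n \<Longrightarrow> j < n \<Longrightarrow> is_poly n (b i j)" and q: "\<And>i. i < n \<Longrightarrow> is_poly n (q i)"
    and small: "\<And>i j x. i < n \<Longrightarrow> j < n \<Longrightarrow> x \<in> S \<Longrightarrow> \<bar>peval (b i j) x\<bar> < \<delta>"
  shows "(\<Sum>i<n. \<Sum>j<n. b i j * (q i * q j)) + pconst (real n * \<delta>) * (\<Sum>i<n. q i * q i) \<in> M"
proof -
  let ?d = "pconst \<delta>" and ?h = "pconst (1/4)"
  have half: "?h + ?h + ?h + ?h = 1" by (simp flip: pconst_add)
  have pair: "b i j * (q i * q j) + pconst (\<delta>/2) * (q i * q i) + pconst (\<delta>/2) * (q j * q j) \<in> M"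
    if ij: "i < n" "j < n" for i j
  proof -
    have dd: "pconst (\<delta>/2) = ?h * ?d + ?h * ?d" by (simp flip: pconst_mult pconst_add)
    have 1: "?d + b i j \<in> M" "?d - b i j \<in> M"
    proof -
      show "?d + b i j \<in> M"
      proof (rule positivstellensatz)
        show "peval (?d + b i j) x > 0" if "x \<in> S" for x using small[OF ij that] by simp
      qed (use b ij in simp)
      show "?d - b i j \<in> M"
      proof (rule positivstellensatz)
        show "peval (?d - b i j) x > 0" if "x \<in> S" for x using small[OF ij that] by simp
      qed (use b ij in simp)
    qed
    have "?h * ((q i + q j) * (q i + q j) * (?d + b i j)) + ?h * ((q i - q j) * (q i - q j) * (?d - b i j)) \<in> M"
      by (rule add_mem; rule scale_mem; (rule square_mult_mem)?) (use q ij 1 in auto)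
    also have "?h * ((q i + q j) * (q i + q j) * (?d + b i j)) + ?h * ((q i - q j) * (q i - q j) * (?d - b i j))
       = (?h + ?h + ?h + ?h) * (b i j * (q i * q j)) + pconst (\<delta>/2) * (q i * q i) + pconst (\<delta>/2) * (q j * q j)"
      unfolding dd by (simp add: algebra_simps)
    finally show ?thesis unfolding half by simp
  qed
  have nd: "pconst (real n * \<delta>) = of_nat n * pconst (\<delta>/2) + of_nat n * pconst (\<delta>/2)"
  proof -
    have "of_nat k * pconst c = pconst (real k * c)" for k c
      by (induction k) (auto simp: algebra_simps pconst_add)
    then show ?thesis by (simp add: mult.commute flip: pconst_add distrib_left)
  qed
  have "(\<Sum>i<n. \<Sum>j<n. b i j * (q i * q j) + pconst (\<delta>/2) * (q i * q i) + pconst (\<delta>/2) * (q j * q j)) \<in> M"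
    using pair by (intro sum_mem) auto
  also have "(\<Sum>i<n. \<Sum>j<n. b i j * (q i * q j) + pconst (\<delta>/2) * (q i * q i) + pconst (\<delta>/2) * (q j * q j))
    = (\<Sum>i<n. \<Sum>j<n. b i j * (q i * q j)) + pconst (real n * \<delta>) * (\<Sum>i<n. q i * q i)"
    unfolding nd by (simp add: sum.distrib distrib_right sum_distrib_left mult.assoc)
  finally show ?thesis .
qed

end

subsection \<open>The global certificate\<close>

text \<open>The coefficients in front of the products \<open>xi u i * xi u j\<close> vanish at
  \<open>u\<close> and are continuous, so they are as small as desired near
  \<open>u\<close>.\<close>

lemma cubic_growth:
  assumes "cubic n u Q" "e > 0"
  shows "\<exists>V. open V \<and> u \<in> V \<and> (\<forall>x\<in>V. \<bar>peval Q x\<bar> \<le> e * (\<Sum>i<n. (x i - u i) * (x i - u i)))"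
proof -
  obtain C where C: "\<And>i j. i < n \<Longrightarrow> j < n \<Longrightarrow> peval (C i j) u = (0::real)"
    and Q: "Q = (\<Sum>i<n. \<Sum>j<n. C i j * (xi u i * xi u j))"
    using assms(1) unfolding cubic_def by (elim exE conjE) (rule that; simp)
  define \<eta> where "\<eta> = e / (real n + 1)"
  have \<eta>: "\<eta> > 0" "\<eta> * n \<le> e" using assms(2) by (auto simp: \<eta>_def field_simps)
  let ?V = "\<Inter>i<n. \<Inter>j<n. {x. \<bar>peval (C i j) x\<bar> < \<eta>}"
  have "open {x :: nat \<Rightarrow> real. \<bar>peval (C i j) x\<bar> < \<eta>}" for i j
    by (intro open_Collect_less continuous_on_rabs continuous_on_peval continuous_on_const)
  then have "open ?V" by (intro open_INT) auto
  moreover have "u \<in> ?V" using C \<eta> by simp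
  moreover have "\<bar>peval Q x\<bar> \<le> e * (\<Sum>i<n. (x i - u i) * (x i - u i))" if x: "x \<in> ?V" for x
  proof -
    have "\<bar>peval Q x\<bar> \<le> \<eta> * n * (\<Sum>i<n. (x i - u i) * (x i - u i))"
      using abs_form_le[of n "\<lambda>i j. peval (C i j) x" \<eta> "\<lambda>i. x i - u i"] x by (simp add: Q less_imp_le)
    also have "\<dots> \<le> e * (\<Sum>i<n. (x i - u i) * (x i - u i))"
      using \<eta> by (intro mult_right_mono sum_nonneg) auto
    finally show ?thesis .
  qed
  ultimately show ?thesis by blast
qed

lemma finite_of_isolated:
  fixes U :: "'a::topological_space set"
  assumes "compact U" and iso: "\<And>u. u \<in> U \<Longrightarrow> \<exists>V. open V \<and> u \<in> V \<and> V \<inter> U \<subseteq> {u}"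
  shows "finite U"
proof -
  have "\<forall>u. \<exists>V. u \<in> U \<longrightarrow> open V \<and> u \<in> V \<and> V \<inter> U \<subseteq> {u}" using iso by auto
  then obtain W where W: "\<And>u. u \<in> U \<Longrightarrow> open (W u) \<and> u \<in> W u \<and> W u \<inter> U \<subseteq> {u}"
    by (rule choice[THEN exE]) auto
  have op: "open (W u)" if "u \<in> U" for u using W[OF that] by simp
  have cover: "U \<subseteq> (\<Union>u\<in>U. W u)" using W by blast
  obtain C where "C \<subseteq> U" "finite C" "U \<subseteq> (\<Union>u\<in>C. W u)"
    by (rule compactE_image[OF assms(1) op cover])
  then have "U \<subseteq> C" using W by blast
  then show ?thesis using \<open>finite C\<close> finite_subset by blast
qed

lemma finite_uniform_bound:
  fixes c :: "'a \<Rightarrow> real"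
  assumes "finite U" "\<And>u. u \<in> U \<Longrightarrow> c u > 0"
  shows "\<exists>e>0. \<forall>u\<in>U. e \<le> c u"
  using assms
proof (induction U)
  case empty
  then show ?case by (intro exI[of _ 1]) auto
next
  case (insert u U)
  then obtain e where "e > 0" "\<forall>u\<in>U. e \<le> c u" by auto
  then show ?case using insert.prems[of u] by (intro exI[of _ "min e (c u)"]) auto
qed

context archimedean_module
begin

text \<open>With \<open>p = \<Sum> (P\<^sub>u\<^sup>2 \<xi>\<^sub>i)\<^sup>2\<close>, near the zeros \<open>F\<close> is handled by the local certificates and away from
them by positivity; the two are joined by the identity \<open>1 = T\<^sup>2\<^sup>K + p \<kappa>\<close> with \<open>T = 1 - \<gamma> p\<close>.\<close>

lemma global_certificate:
  fixes F :: rpoly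
  defines "U \<equiv> {x \<in> S. peval F x = 0}"
  assumes F: "is_poly n F" and F_nonneg: "\<And>x. x \<in> S \<Longrightarrow> peval F x \<ge> 0" and U_ne: "U \<noteq> {}"
    and loc: "\<And>u. u \<in> U \<Longrightarrow> \<exists>c0>0. \<forall>c. 0 < c \<and> c \<le> c0 \<longrightarrow>
      (\<exists>g\<in>M. peval g u = 0 \<and> cubic n u (F - g - pconst c * (\<Sum>i<n. xi u i * xi u i)))"
  obtains \<epsilon> P \<alpha> where "finite U" "\<epsilon> > 0"
    "\<And>u. u \<in> U \<Longrightarrow> is_poly n (P u)" "\<And>u. u \<in> U \<Longrightarrow> is_poly n (\<alpha> u)"
    "\<And>u v. u \<in> U \<Longrightarrow> v \<in> U \<Longrightarrow> u \<noteq> v \<Longrightarrow> peval (P u) v = 0"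
    "(\<Sum>u\<in>U. \<alpha> u * P u ^ 6) = 1"
    "F - pconst \<epsilon> * (\<Sum>u\<in>U. \<Sum>i<n. (P u * P u * xi u i) * (P u * P u * xi u i)) \<in> M"
proof -
  have S_pts: "S \<subseteq> pts n" and M_nonneg: "\<And>m x. m \<in> M \<Longrightarrow> x \<in> S \<Longrightarrow> peval m x \<ge> 0"
    by (auto simp: nonneg_set_def)
  have US: "U \<subseteq> S" by (auto simp: U_def)
  have finU: "finite U"
  proof (rule finite_of_isolated)
    have "U = S \<inter> {x. peval F x = 0}" by (auto simp: U_def)
    moreover have "closed {x :: nat \<Rightarrow> real. peval F x = 0}"
      by (intro closed_Collect_eq continuous_on_peval continuous_on_const)
    ultimately show "compact U" using compact_Int_closed[OF compact_nonneg_set] by simp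
    fix u assume u: "u \<in> U"
    from loc[OF u] obtain c0 where c0: "c0 > 0" "\<forall>c. 0 < c \<and> c \<le> c0 \<longrightarrow>
      (\<exists>g\<in>M. peval g u = 0 \<and> cubic n u (F - g - pconst c * (\<Sum>i<n. xi u i * xi u i)))"
      by (elim exE conjE)
    from c0(2)[rule_format, of c0] c0(1)
    obtain g where g: "g \<in> M" "cubic n u (F - g - pconst c0 * (\<Sum>i<n. xi u i * xi u i))" by (auto simp del: peval_diff)
    obtain W where W: "open W" "u \<in> W" and
      bd: "\<And>x. x \<in> W \<Longrightarrow> \<bar>peval (F - g - pconst c0 * (\<Sum>i<n. xi u i * xi u i)) x\<bar> \<le> c0 / 2 * (\<Sum>i<n. (x i - u i) * (x i - u i))"
      using cubic_growth[OF g(2), of "c0 / 2"] c0(1) by auto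
    \<comment> \<open>Near \<open>u\<close> the polynomial \<open>F\<close> is at least
      \<open>g\<close> plus half of \<open>c0\<close> times the squared distance, and
      \<open>g\<close> is nonnegative on \<open>S\<close>; so \<open>u\<close> is an isolated
      zero.\<close>
    have "x = u" if x: "x \<in> W" "x \<in> U" for x
    proof -
      let ?D = "\<Sum>i<n. (x i - u i) * (x i - u i)"
      have "peval g x \<ge> 0" "peval F x = 0" using M_nonneg[OF g(1)] x US by (auto simp: U_def)
      moreover have "\<bar>peval F x - peval g x - c0 * ?D\<bar> \<le> c0 * ?D / 2" using bd[OF x(1)] by simp
      ultimately have "c0 * ?D \<le> 0" by linarith
      then have "?D \<le> 0" using c0(1) by (simp add: mult_le_0_iff)
      moreover have "?D \<ge> 0" by (intro sum_nonneg) simp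
      ultimately have "?D = 0" by simp
      then have eq: "x i = u i" if "i < n" for i
        using that by (subst (asm) sum_nonneg_eq_0_iff) auto
      show "x = u"
      proof
        fix i show "x i = u i"
          using eq[of i] subsetD[OF S_pts subsetD[OF US x(2)]] subsetD[OF S_pts subsetD[OF US u]]
          by (cases "i < n") (auto simp: pts_def)
      qed
    qed
    then show "\<exists>V. open V \<and> u \<in> V \<and> V \<inter> U \<subseteq> {u}" using W by auto
  qed
  obtain P \<alpha> where P: "\<And>u. u \<in> U \<Longrightarrow> is_poly n (P u)" and \<alpha>: "\<And>u. u \<in> U \<Longrightarrow> is_poly n (\<alpha> u)"
    and P1: "\<And>u. u \<in> U \<Longrightarrow> peval (P u) u \<noteq> 0" and P0: "\<And>u v. u \<in> U \<Longrightarrow> v \<in> U \<Longrightarrow> u \<noteq> v \<Longrightarrow> peval (P u) v = 0"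
    and part: "(\<Sum>u\<in>U. \<alpha> u * P u ^ 6) = 1"
    by (rule interpolation_partition[OF finU subset_trans[OF US S_pts] U_ne, of 6], rule that)
  \<comment> \<open>The leading coefficient of \<open>p\<close> at \<open>u\<close>, where the
    summands of the other minimizers vanish to order four. Local certificates with constant
    \<open>c * b u\<close> thus fit a single multiple \<open>c\<close> of \<open>p\<close>.\<close>
  define b where "b u = peval (P u) u ^ 4" for u
  have b: "b u > 0" if "u \<in> U" for u using P1[OF that] by (simp add: b_def zero_less_power_eq)
  have "\<forall>u. \<exists>c0. u \<in> U \<longrightarrow> c0 > 0 \<and> (\<forall>c. 0 < c \<and> c \<le> c0 \<longrightarrow>
      (\<exists>g\<in>M. peval g u = 0 \<and> cubic n u (F - g - pconst c * (\<Sum>i<n. xi u i * xi u i))))"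
  proof
    fix u
    show "\<exists>c0. u \<in> U \<longrightarrow> c0 > 0 \<and> (\<forall>c. 0 < c \<and> c \<le> c0 \<longrightarrow>
      (\<exists>g\<in>M. peval g u = 0 \<and> cubic n u (F - g - pconst c * (\<Sum>i<n. xi u i * xi u i))))"
    proof (cases "u \<in> U")
      case True
      from loc[OF True] show ?thesis by (rule ex_forward) (rule impI)
    qed simp
  qed
  then obtain c0 where c0': "\<forall>u. u \<in> U \<longrightarrow> c0 u > 0 \<and> (\<forall>c. 0 < c \<and> c \<le> c0 u \<longrightarrow>
      (\<exists>g\<in>M. peval g u = 0 \<and> cubic n u (F - g - pconst c * (\<Sum>i<n. xi u i * xi u i))))"
    by (rule choice[THEN exE])
  have c0: "c0 u > 0" "0 < c \<Longrightarrow> c \<le> c0 u \<Longrightarrow>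
      \<exists>g\<in>M. peval g u = 0 \<and> cubic n u (F - g - pconst c * (\<Sum>i<n. xi u i * xi u i))" if "u \<in> U" for u c
    using c0'[rule_format, OF that] by simp_all
  obtain c where c: "c > 0" "\<forall>u\<in>U. c \<le> c0 u / b u"
    using finite_uniform_bound[OF finU, of "\<lambda>u. c0 u / b u"] c0(1) b by auto
  have "\<forall>u. \<exists>g. u \<in> U \<longrightarrow> g \<in> M \<and> peval g u = 0 \<and> cubic n u (F - g - pconst (c * b u) * (\<Sum>i<n. xi u i * xi u i))"
  proof
    fix u
    show "\<exists>g. u \<in> U \<longrightarrow> g \<in> M \<and> peval g u = 0 \<and> cubic n u (F - g - pconst (c * b u) * (\<Sum>i<n. xi u i * xi u i))"
    proof (cases "u \<in> U")
      case True
      have "c \<le> c0 u / b u" using c(2) True by blast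
      then have "c * b u \<le> c0 u" using pos_le_divide_eq[OF b[OF True]] by simp
      from c0(2)[OF True mult_pos_pos[OF c(1) b[OF True]] this]
      show ?thesis unfolding Bex_def by (rule ex_forward) (rule impI)
    qed simp
  qed
  then obtain g where gg: "\<forall>u. u \<in> U \<longrightarrow> g u \<in> M \<and> peval (g u) u = 0 \<and> cubic n u (F - g u - pconst (c * b u) * (\<Sum>i<n. xi u i * xi u i))"
    by (rule choice[THEN exE])
  then have gM: "\<And>u. u \<in> U \<Longrightarrow> g u \<in> M" and g0: "\<And>u. u \<in> U \<Longrightarrow> peval (g u) u = 0"
    and gc: "\<And>u. u \<in> U \<Longrightarrow> cubic n u (F - g u - pconst (c * b u) * (\<Sum>i<n. xi u i * xi u i))"
    by simp_all
  have gp: "is_poly n (g u)" if "u \<in> U" for u using gM[OF that] by (rule is_polyD)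
  define s where "s u = pconst (1 / peval (P u) u) * P u" for u
  have s: "is_poly n (s u)" "peval (s u) u = 1" if "u \<in> U" for u
    using P[OF that] P1[OF that] by (simp_all add: s_def)
  have s0: "peval (s u) v = 0" if "u \<in> U" "v \<in> U" "u \<noteq> v" for u v
    using P0[OF that] by (simp add: s_def)
  \<comment> \<open>Here \<open>1 - \<omega> u = (1 - s u)^2 (1 + 2 s u)\<close>, so
    \<open>\<omega> u\<close> is 1 with vanishing gradient at \<open>u\<close>, and it vanishes to
    second order at the other minimizers. Since \<open>g u\<close> vanishes at \<open>u\<close>, its
    weight \<open>\<omega> u * \<omega> u\<close> changes it there only by a cubic term.\<close>
  define \<omega> where "\<omega> u = s u * s u * (3 - 2 * s u)" for u
  have p3: "is_poly n 3" "is_poly n 2" using is_poly_pconst[of n 3] is_poly_pconst[of n 2] by (simp_all only: pconst_numeral)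
  have \<omega>: "is_poly n (\<omega> u)" if "u \<in> U" for u using s(1)[OF that] p3 by (simp add: \<omega>_def)
  define D where "D u = (\<Sum>i<n. xi u i * xi u i)" for u
  define q where "q u i = P u * P u * xi u i" for u i
  have q: "is_poly n (q u i)" if "u \<in> U" "i < n" for u i using P[OF that(1)] that(2) by (simp add: q_def)
  define p where "p = (\<Sum>u\<in>U. \<Sum>i<n. q u i * q u i)"
  have pD: "p = (\<Sum>u\<in>U. P u ^ 4 * D u)"
    unfolding p_def D_def q_def sum_distrib_left
    by (intro sum.cong refl) (simp add: power4_eq_xxxx mult_ac)
  have p_poly: "is_poly n p" unfolding p_def using q by (intro is_poly_sum is_poly_mult) auto
  define R where "R = F - (\<Sum>u\<in>U. \<omega> u * \<omega> u * g u) - pconst c * p"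
  have Dp: "is_poly n (D u)" for u unfolding D_def by (intro is_poly_sum is_poly_mult is_poly_xi) auto
  have R_cubic: "cubic n u R" if u: "u \<in> U" for u
  proof -
    have split_sum: "(\<Sum>v\<in>U. h v) = h u + (\<Sum>v\<in>U-{u}. h v)" for h :: "(nat \<Rightarrow> real) \<Rightarrow> rpoly"
      using finU u by (rule sum.remove)
    \<comment> \<open>The first summand is cubic by the choice of \<open>g u\<close>. Each of the
      others displays three factors vanishing at \<open>u\<close>; in the term with
      \<open>D u\<close>, two of them are the \<open>xi u i\<close>.\<close>
    have R_eq: "R = (F - g u - pconst (c * b u) * D u) + (1 - s u) * (1 - s u) * g u * ((1 + 2 * s u) * (1 + \<omega> u))
       - (\<Sum>v\<in>U-{u}. s v * s v * s v * (s v * (3 - 2 * s v) * (3 - 2 * s v) * g v))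
       + pconst c * ((pconst (b u) - P u ^ 4) * D u)
       - pconst c * (\<Sum>v\<in>U-{u}. P v * P v * P v * (P v * D v))"
    proof -
      have 1: "(1 - s u) * (1 - s u) * g u * ((1 + 2 * s u) * (1 + \<omega> u)) = g u - \<omega> u * \<omega> u * g u"
      proof -
        have "(1 - s u) * (1 - s u) * (1 + 2 * s u) = 1 - \<omega> u"
          unfolding \<omega>_def by (simp add: algebra_simps)
        moreover have "(1 - s u) * (1 - s u) * g u * ((1 + 2 * s u) * (1 + \<omega> u)) = (1 - s u) * (1 - s u) * (1 + 2 * s u) * ((1 + \<omega> u) * g u)"
          by (simp only: mult_ac)
        ultimately have "(1 - s u) * (1 - s u) * g u * ((1 + 2 * s u) * (1 + \<omega> u)) = (1 - \<omega> u) * ((1 + \<omega> u) * g u)"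
          by simp
        then show ?thesis by (simp add: left_diff_distrib distrib_right distrib_left)
      qed
      have 2: "(\<Sum>v\<in>U-{u}. s v * s v * s v * (s v * (3 - 2 * s v) * (3 - 2 * s v) * g v)) = (\<Sum>v\<in>U-{u}. \<omega> v * \<omega> v * g v)"
        by (intro sum.cong refl) (simp add: \<omega>_def mult_ac)
      have 3: "(\<Sum>v\<in>U-{u}. P v * P v * P v * (P v * D v)) = (\<Sum>v\<in>U-{u}. P v ^ 4 * D v)"
        by (intro sum.cong refl) (simp add: power4_eq_xxxx mult_ac)
      show ?thesis
        unfolding 1 2 3 R_def pD split_sum[of "\<lambda>u. \<omega> u * \<omega> u * g u"] split_sum[of "\<lambda>u. P u ^ 4 * D u"]
        by (simp add: algebra_simps pconst_mult)
    qed
    have c1: "cubic n u ((1 - s u) * (1 - s u) * g u * ((1 + 2 * s u) * (1 + \<omega> u)))"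
      by (subst mult.commute, rule cubic_mult, use s[OF u] \<omega>[OF u] p3 in simp, rule cubic_mult3)
         (use s[OF u] gp[OF u] g0[OF u] in simp_all)
    have c2: "cubic n u (s v * s v * s v * (s v * (3 - 2 * s v) * (3 - 2 * s v) * g v))" if v: "v \<in> U - {u}" for v
      by (subst mult.commute, rule cubic_mult, use s(1)[of v] gp[of v] p3 v in simp, rule cubic_mult3)
         (use s(1)[of v] s0[of v u] u v in auto)
    have c3: "cubic n u ((pconst (b u) - P u ^ 4) * D u)"
    proof -
      have "(pconst (b u) - P u ^ 4) * D u = (\<Sum>i<n. xi u i * xi u i * (pconst (b u) - P u ^ 4))"
        by (simp add: D_def sum_distrib_left mult_ac)
      moreover have "cubic n u (xi u i * xi u i * (pconst (b u) - P u ^ 4))" if "i < n" for i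
        by (rule cubic_mult3) (use that P[OF u] in \<open>simp_all add: b_def\<close>)
      ultimately show ?thesis by (simp only:) (rule cubic_sum, simp)
    qed
    have c4: "cubic n u (P v * P v * P v * (P v * D v))" if v: "v \<in> U - {u}" for v
      by (subst mult.commute, rule cubic_mult, use P[of v] Dp v in simp, rule cubic_mult3)
         (use P[of v] P0[of v u] u v in auto)
    show ?thesis
      unfolding R_eq
      by (intro cubic_add cubic_diff cubic_sum cubic_mult[OF is_poly_pconst] c1 c2 c3 c4 gc[OF u, folded D_def])
  qed
  have "\<forall>u. \<exists>C. u \<in> U \<longrightarrow> (\<forall>i<n. \<forall>j<n. is_poly n (C i j) \<and> peval (C i j) u = 0) \<and>
     R = (\<Sum>i<n. \<Sum>j<n. C i j * (xi u i * xi u j))"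
    using R_cubic unfolding cubic_def by auto
  then obtain C where C': "\<forall>u. u \<in> U \<longrightarrow> (\<forall>i<n. \<forall>j<n. is_poly n (C u i j) \<and> peval (C u i j) u = 0) \<and>
     R = (\<Sum>i<n. \<Sum>j<n. C u i j * (xi u i * xi u j))"
    by (rule choice[THEN exE])
  then have C: "\<And>u i j. u \<in> U \<Longrightarrow> i < n \<Longrightarrow> j < n \<Longrightarrow> is_poly n (C u i j)"
     "\<And>u i j. u \<in> U \<Longrightarrow> i < n \<Longrightarrow> j < n \<Longrightarrow> peval (C u i j) u = 0"
    and RC: "\<And>u. u \<in> U \<Longrightarrow> R = (\<Sum>i<n. \<Sum>j<n. C u i j * (xi u i * xi u j))"
    by blast+
  \<comment> \<open>Vanishes at \<open>u\<close> through \<open>C\<close> and at the other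
    minimizers through \<open>P u\<close>.\<close>
  define a where "a u i j = \<alpha> u * (P u * P u) * C u i j" for u i j
  have a: "is_poly n (a u i j)" if "u \<in> U" "i < n" "j < n" for u i j
    using \<alpha>[OF that(1)] P[OF that(1)] C(1)[OF that] by (simp add: a_def)
  have a0: "peval (a u i j) v = 0" if "u \<in> U" "v \<in> U" "i < n" "j < n" for u v i j
    using P0[of u v] C(2)[of u i j] that by (cases "u = v") (simp_all add: a_def)
  have R_sum: "R = (\<Sum>u\<in>U. \<Sum>i<n. \<Sum>j<n. a u i j * (q u i * q u j))"
  proof -
    have "R = (\<Sum>u\<in>U. \<alpha> u * P u ^ 6) * R" by (simp add: part)
    also have "\<dots> = (\<Sum>u\<in>U. \<alpha> u * P u ^ 6 * (\<Sum>i<n. \<Sum>j<n. C u i j * (xi u i * xi u j)))"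
      unfolding sum_distrib_right by (intro sum.cong refl arg_cong2[where f = "(*)"] RC)
    also have "\<dots> = (\<Sum>u\<in>U. \<Sum>i<n. \<Sum>j<n. a u i j * (q u i * q u j))"
      unfolding sum_distrib_left
      by (intro sum.cong refl) (simp add: a_def q_def numeral_eq_Suc mult_ac)
    finally show ?thesis .
  qed
  define A where "A = (\<Sum>u\<in>U. \<omega> u * \<omega> u * g u)"
  have F_eq: "F = A + pconst c * p + (\<Sum>u\<in>U. \<Sum>i<n. \<Sum>j<n. a u i j * (q u i * q u j))"
    unfolding R_sum[symmetric] R_def A_def by (simp add: algebra_simps)
  have A_nonneg: "peval A x \<ge> 0" if x: "x \<in> S" for x
    unfolding A_def peval_sum using M_nonneg[OF gM x] by (intro sum_nonneg) (simp add: mult_nonneg_nonneg)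
  have p_eval: "peval p x = (\<Sum>u\<in>U. \<Sum>i<n. peval (q u i) x * peval (q u i) x)" for x :: "nat \<Rightarrow> real"
    by (simp add: p_def)
  have p_nonneg: "peval p x \<ge> 0" for x :: "nat \<Rightarrow> real"
    unfolding p_eval by (intro sum_nonneg) simp
  \<comment> \<open>At a zero of \<open>p\<close> the partition identity provides some
    \<open>u\<close> with \<open>P u\<close> nonzero there; then all coordinates agree with those of
    \<open>u\<close>.\<close>
  have p_pos: "peval p x > 0" if x: "x \<in> S" "x \<notin> U" for x
  proof (rule ccontr)
    assume "\<not> peval p x > 0"
    then have "peval p x = 0" using p_nonneg[of x] by simp
    then have "\<forall>u\<in>U. (\<Sum>i<n. peval (q u i) x * peval (q u i) x) = 0"
      unfolding p_eval by (subst (asm) sum_nonneg_eq_0_iff) (auto intro: sum_nonneg simp: finU)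
    then have q0: "peval (q u i) x = 0" if "u \<in> U" "i < n" for u i
      using that by (subst (asm) sum_nonneg_eq_0_iff) auto
    have "(\<Sum>u\<in>U. peval (\<alpha> u) x * peval (P u) x ^ 6) = 1"
      using arg_cong[OF part, of "\<lambda>h. peval h x"] by simp
    moreover have "(\<Sum>u\<in>U. peval (\<alpha> u) x * peval (P u) x ^ 6) = 0" if "\<forall>u\<in>U. peval (P u) x = 0"
      using that by (intro sum.neutral) simp
    ultimately have "\<not> (\<forall>u\<in>U. peval (P u) x = 0)" by linarith
    then obtain u where u: "u \<in> U" "peval (P u) x \<noteq> 0" by auto
    have "x i = u i" for i
    proof (cases "i < n")
      case True
      then show ?thesis using q0[OF u(1) True] u(2) by (simp add: q_def)
    next
      case False
      then show ?thesis using subsetD[OF S_pts x(1)] subsetD[OF S_pts subsetD[OF US u(1)]] by (simp add: pts_def)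
    qed
    then have "x = u" by (rule ext)
    then show False using u x by simp
  qed

  \<comment> \<open>Domination of \<open>p\<close> by \<open>F\<close> on the nonnegativity
    set\<close>
  define W where "W \<delta> = (\<Inter>u\<in>U. \<Inter>i<n. \<Inter>j<n. {x. \<bar>peval (a u i j) x\<bar> < \<delta>})" for \<delta> :: real
  have W: "open (W \<delta>)" for \<delta>
    unfolding W_def using finU
    by (intro open_INT ballI finite_lessThan open_Collect_less continuous_on_rabs continuous_on_peval continuous_on_const)
  have UW: "U \<subseteq> W \<delta>" if "\<delta> > 0" for \<delta>
    using a0 that by (auto simp: W_def)
  have compactSW: "compact (S - W \<delta>)" for \<delta> by (rule compact_diff[OF compact_nonneg_set W])
  obtain B where B: "B > 0" "\<And>x. x \<in> S \<Longrightarrow> peval p x \<le> B"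
  proof -
    have "compact (peval p ` S :: real set)" by (intro compact_continuous_image continuous_on_peval compact_nonneg_set)
    then obtain B where "\<forall>y\<in>peval p ` S. \<bar>y :: real\<bar> \<le> B" using compact_imp_bounded bounded_real by blast
    then show thesis by (intro that[of "\<bar>B\<bar> + 1"]) force+
  qed
  have sum_bound: "\<bar>\<Sum>u\<in>U. \<Sum>i<n. \<Sum>j<n. peval (a u i j) x * (peval (q u i) x * peval (q u j) x)\<bar> \<le> \<delta> * n * peval p x"
    if x: "x \<in> W \<delta>" for \<delta> x
  proof -
    have "\<bar>\<Sum>u\<in>U. \<Sum>i<n. \<Sum>j<n. peval (a u i j) x * (peval (q u i) x * peval (q u j) x)\<bar>
       \<le> (\<Sum>u\<in>U. \<bar>\<Sum>i<n. \<Sum>j<n. peval (a u i j) x * (peval (q u i) x * peval (q u j) x)\<bar>)" by (rule sum_abs)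
    also have "\<dots> \<le> (\<Sum>u\<in>U. \<delta> * n * (\<Sum>i<n. peval (q u i) x * peval (q u i) x))"
      using x by (intro sum_mono abs_form_le) (auto simp: W_def less_imp_le)
    also have "\<dots> = \<delta> * n * peval p x" by (simp add: p_eval sum_distrib_left)
    finally show ?thesis .
  qed
  obtain c' where c': "c' > 0" "c' \<le> c" "\<And>x. x \<in> S \<Longrightarrow> peval F x \<ge> c' * peval p x"
  proof -
    \<comment> \<open>On \<open>W \<delta>\<close> the form is at most
      \<open>\<delta> * n * p\<close>, hence at most half of \<open>c * p\<close>. Outside,
      \<open>F\<close> has a positive minimum while \<open>p\<close> is bounded by
      \<open>B\<close>.\<close>
    define \<delta> where "\<delta> = c / (2 * (real n + 1))"
    have \<delta>: "\<delta> > 0" "\<delta> * n \<le> c / 2" using c(1) by (auto simp: \<delta>_def field_simps)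
    have near: "peval F x \<ge> c / 2 * peval p x" if x: "x \<in> S" "x \<in> W \<delta>" for x
    proof -
      have "peval F x = peval A x + c * peval p x + (\<Sum>u\<in>U. \<Sum>i<n. \<Sum>j<n. peval (a u i j) x * (peval (q u i) x * peval (q u j) x))"
        by (subst F_eq) simp
      moreover have "\<delta> * n * peval p x \<le> c / 2 * peval p x"
        using \<delta>(2) p_nonneg by (rule mult_right_mono)
      ultimately show ?thesis using A_nonneg[OF x(1)] sum_bound[OF x(2)] by (simp add: abs_le_iff)
    qed
    show thesis
    proof (cases "S - W \<delta> = {}")
      case True
      show thesis by (rule that[of "c / 2"]) (use c(1) near True in auto)
    next
      case False
      obtain x0 where x0: "x0 \<in> S - W \<delta>" "\<And>x. x \<in> S - W \<delta> \<Longrightarrow> peval F x0 \<le> (peval F x :: real)"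
        using continuous_attains_inf[OF compactSW False continuous_on_peval] by metis
      have "peval F x0 \<noteq> 0" using x0(1) UW[OF \<delta>(1)] by (auto simp: U_def)
      then have f0: "peval F x0 > 0" using F_nonneg[of x0] x0(1) by force
      show thesis
      proof (rule that[of "min (c / 2) (peval F x0 / B)"])
        fix x assume x: "x \<in> S"
        show "peval F x \<ge> min (c / 2) (peval F x0 / B) * peval p x"
        proof (cases "x \<in> W \<delta>")
          case True
          have "min (c / 2) (peval F x0 / B) * peval p x \<le> c / 2 * peval p x"
            by (rule mult_right_mono[OF min.cobounded1 p_nonneg])
          then show ?thesis using near[OF x True] by simp
        next
          case False
          have "min (c / 2) (peval F x0 / B) * peval p x \<le> peval F x0 / B * B"
            using B f0 p_nonneg x by (intro mult_mono) auto
          also have "\<dots> = peval F x0" using B(1) by simp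
          also have "\<dots> \<le> peval F x" using x0(2) x False by simp
          finally show ?thesis by simp
        qed
      qed (use c(1) f0 B(1) in auto)
    qed
  qed

  \<comment> \<open>Splitting \<open>F\<close> by a power of \<open>T\<close>\<close>
  define \<delta> where "\<delta> = c' / (4 * (real n + 1))"
  have \<delta>: "\<delta> > 0" "\<delta> * n \<le> c' / 4" using c'(1) by (auto simp: \<delta>_def field_simps)
  \<comment> \<open>This normalisation keeps \<open>T\<close> between 0 and 1 on \<open>S\<close>,
    with the value 1 exactly on \<open>U\<close>.\<close>
  define \<gamma> where "\<gamma> = 1 / B"
  define T where "T = 1 - pconst \<gamma> * p"
  have T_poly: "is_poly n T" using p_poly by (simp add: T_def)
  have T01: "0 \<le> peval T x" "peval T x \<le> 1" if "x \<in> S" for x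
    using B(1) B(2)[OF that] p_nonneg[of x] by (simp_all add: T_def \<gamma>_def)
  \<comment> \<open>Inside \<open>W \<delta>\<close> the coefficients are small already. On the
    compact remainder \<open>T\<close> stays below a constant less than 1, so a high power outweighs
    the common bound \<open>L\<close>.\<close>
  obtain K where K: "\<And>x u i j. x \<in> S \<Longrightarrow> u \<in> U \<Longrightarrow> i < n \<Longrightarrow> j < n \<Longrightarrow> peval T x ^ (2 * K) * \<bar>peval (a u i j) x\<bar> < \<delta>"
  proof (cases "S - W \<delta> = {}")
    case True
    show thesis
    proof (rule that[of 0])
      fix x u i j assume "x \<in> S" "u \<in> U" "i < n" "j < n"
      then show "peval T x ^ (2 * 0) * \<bar>peval (a u i j) x\<bar> < \<delta>" using True by (auto simp: W_def)
    qed
  next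
    case False
    obtain x0 where x0: "x0 \<in> S - W \<delta>" "\<And>x. x \<in> S - W \<delta> \<Longrightarrow> peval T x \<le> (peval T x0 :: real)"
      using continuous_attains_sup[OF compactSW False continuous_on_peval] by metis
    have t0: "0 \<le> peval T x0" "peval T x0 < 1"
    proof -
      have "x0 \<notin> U" "x0 \<in> S" using x0(1) UW[OF \<delta>(1)] by blast+
      then have "peval p x0 / B > 0" using p_pos[of x0] B(1) by simp
      then show "peval T x0 < 1" by (simp add: T_def \<gamma>_def)
      show "0 \<le> peval T x0" using T01[of x0] \<open>x0 \<in> S\<close> by simp
    qed
    have "\<exists>L>0. \<forall>x\<in>S. \<forall>u\<in>U. \<forall>i<n. \<forall>j<n. \<bar>peval (a u i j) x\<bar> \<le> L"
    proof -
      define Z where "Z x = (\<Sum>u\<in>U. \<Sum>i<n. \<Sum>j<n. \<bar>peval (a u i j) x\<bar>)" for x :: "nat \<Rightarrow> real"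
      have "continuous_on S Z" unfolding Z_def
        by (intro continuous_on_sum continuous_on_rabs continuous_on_peval)
      then have "compact (Z ` S)" by (intro compact_continuous_image compact_nonneg_set)
      then obtain L where L: "\<forall>y\<in>Z ` S. \<bar>y\<bar> \<le> L" using compact_imp_bounded bounded_real by blast
      have "\<bar>peval (a u i j) x\<bar> \<le> \<bar>L\<bar> + 1" if x: "x \<in> S" and uij: "u \<in> U" "i < n" "j < n" for x u i j
      proof -
        have "\<bar>peval (a u i j) x\<bar> \<le> (\<Sum>j<n. \<bar>peval (a u i j) x\<bar>)"
          using uij by (intro member_le_sum[of j "{..<n}" "\<lambda>j. \<bar>peval (a u i j) x\<bar>"]) auto
        also have "\<dots> \<le> (\<Sum>i<n. \<Sum>j<n. \<bar>peval (a u i j) x\<bar>)"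
          using uij by (intro member_le_sum[of i "{..<n}" "\<lambda>i. \<Sum>j<n. \<bar>peval (a u i j) x\<bar>"]) (auto intro: sum_nonneg)
        also have "\<dots> \<le> Z x"
          unfolding Z_def using uij finU
          by (intro member_le_sum[of u U "\<lambda>u. \<Sum>i<n. \<Sum>j<n. \<bar>peval (a u i j) x\<bar>"]) (auto intro: sum_nonneg)
        also have "\<dots> \<le> \<bar>L\<bar> + 1" using L x by force
        finally show ?thesis .
      qed
      then show ?thesis by (intro exI[of _ "\<bar>L\<bar> + 1"]) auto
    qed
    then obtain L where L: "L > 0" "\<forall>x\<in>S. \<forall>u\<in>U. \<forall>i<n. \<forall>j<n. \<bar>peval (a u i j) x\<bar> \<le> L" by auto
    obtain K where K: "peval T x0 ^ K < \<delta> / L"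
      using real_arch_pow_inv[of "\<delta> / L" "peval T x0"] \<delta>(1) L(1) t0 by auto
    show thesis
    proof (rule that[of K])
      fix x u i j assume x: "x \<in> S" and uij: "u \<in> U" "i < n" "j < n"
      show "peval T x ^ (2 * K) * \<bar>peval (a u i j) x\<bar> < \<delta>"
      proof (cases "x \<in> W \<delta>")
        case True
        have "peval T x ^ (2 * K) * \<bar>peval (a u i j) x\<bar> \<le> 1 * \<bar>peval (a u i j) x\<bar>"
          using T01[OF x] by (intro mult_right_mono power_le_one) auto
        moreover have "\<bar>peval (a u i j) x\<bar> < \<delta>" using True uij unfolding W_def by blast
        ultimately show ?thesis by linarith
      next
        case False
        have "peval T x ^ (2 * K) \<le> peval T x ^ K" using T01[OF x] by (intro power_decreasing) auto
        also have "\<dots> \<le> peval T x0 ^ K" using T01[OF x] x0(2)[of x] x False by (intro power_mono) auto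
        finally have "peval T x ^ (2 * K) < \<delta> / L" using K by simp
        have "\<bar>peval (a u i j) x\<bar> \<le> L" using L(2) x uij by blast
        then have "peval T x ^ (2 * K) * \<bar>peval (a u i j) x\<bar> \<le> peval T x ^ (2 * K) * L"
          by (rule mult_left_mono) (use T01[OF x] in simp)
        moreover have "peval T x ^ (2 * K) * L < \<delta>"
          using \<open>peval T x ^ (2 * K) < \<delta> / L\<close> L(1) by (simp add: pos_less_divide_eq)
        ultimately show ?thesis by linarith
      qed
    qed
  qed
  \<comment> \<open>The geometric sum gives \<open>p * \<kappa> = 1 - T ^ (2 * K)\<close>. The
    exponent is even so that the power is a square and may multiply module elements.\<close>
  define \<kappa> where "\<kappa> = pconst \<gamma> * (\<Sum>j<2*K. T ^ j)"
  have \<kappa>_poly: "is_poly n \<kappa>" unfolding \<kappa>_def using T_poly by (intro is_poly_mult is_poly_sum is_poly_power) auto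
  have p\<kappa>: "p * \<kappa> = 1 - T ^ (2 * K)"
  proof -
    have "1 - T ^ (2 * K) = (1 - T) * (\<Sum>j<2*K. T ^ j)" by (rule one_diff_power_eq)
    also have "1 - T = pconst \<gamma> * p" by (simp add: T_def)
    finally show ?thesis by (simp add: \<kappa>_def mult_ac)
  qed
  let ?T2 = "T ^ (2 * K)"
  have T2: "?T2 = T ^ K * T ^ K" by (simp add: mult_2 power_add)
  define \<epsilon> where "\<epsilon> = c' / 4"
  \<comment> \<open>The cofactor left for the squares in \<open>p\<close>. From
    \<open>F \<ge> c' * p\<close> and \<open>c \<ge> c'\<close> follows
    \<open>c T^(2K) + \<kappa> F \<ge> c'\<close> on \<open>S\<close>. The constants
    \<open>\<epsilon>\<close> and \<open>n \<delta>\<close> use at most half of \<open>c'\<close>,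
    so \<open>d\<close> is strictly positive there.\<close>
  define d where "d = pconst c * ?T2 + \<kappa> * F - pconst \<epsilon> - pconst (real n * \<delta>)"
  have d_poly: "is_poly n d" unfolding d_def using F T_poly \<kappa>_poly by simp
  have dM: "d \<in> M"
  proof (rule positivstellensatz[OF d_poly])
    fix x assume x: "x \<in> S"
    have t: "0 \<le> peval T x ^ (2 * K)" "peval T x ^ (2 * K) \<le> 1"
      using T01[OF x] by (auto intro: power_le_one)
    have pk: "peval p x * peval \<kappa> x = 1 - peval T x ^ (2 * K)"
      using arg_cong[OF p\<kappa>, of "\<lambda>h. peval h x"] by simp
    have k0: "peval \<kappa> x \<ge> 0"
      unfolding \<kappa>_def using B(1) T01[OF x] by (simp add: \<gamma>_def sum_nonneg)
    have "peval \<kappa> x * peval F x \<ge> peval \<kappa> x * (c' * peval p x)"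
      using c'(3)[OF x] k0 by (rule mult_left_mono)
    also have "peval \<kappa> x * (c' * peval p x) = c' * (1 - peval T x ^ (2 * K))" using pk by (simp add: mult_ac)
    finally have 1: "c' * (1 - peval T x ^ (2 * K)) \<le> peval \<kappa> x * peval F x" .
    have "c' * peval T x ^ (2 * K) \<le> c * peval T x ^ (2 * K)" using c'(2) t(1) by (rule mult_right_mono)
    then have "c' \<le> c * peval T x ^ (2 * K) + peval \<kappa> x * peval F x" using 1 by (simp add: algebra_simps)
    then show "peval d x > 0" using \<delta>(2) c'(1) by (simp add: d_def \<epsilon>_def mult.commute)
  qed
  have "F - pconst \<epsilon> * p = (\<Sum>u\<in>U. (T ^ K * \<omega> u) * (T ^ K * \<omega> u) * g u)
     + (\<Sum>u\<in>U. ((\<Sum>i<n. \<Sum>j<n. (?T2 * a u i j) * (q u i * q u j)) + pconst (real n * \<delta>) * (\<Sum>i<n. q u i * q u i))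
         + (\<Sum>i<n. q u i * q u i * d))"
  proof -
    have e1: "(\<Sum>u\<in>U. (T ^ K * \<omega> u) * (T ^ K * \<omega> u) * g u) = ?T2 * A"
      unfolding A_def T2 sum_distrib_left by (intro sum.cong refl) (simp add: mult_ac)
    have e2: "(\<Sum>u\<in>U. ((\<Sum>i<n. \<Sum>j<n. (?T2 * a u i j) * (q u i * q u j)) + pconst (real n * \<delta>) * (\<Sum>i<n. q u i * q u i))
         + (\<Sum>i<n. q u i * q u i * d)) = ?T2 * (\<Sum>u\<in>U. \<Sum>i<n. \<Sum>j<n. a u i j * (q u i * q u j)) + pconst (real n * \<delta>) * p + p * d"
      unfolding p_def sum.distrib sum_distrib_left sum_distrib_right by (simp only: mult.assoc)
    have "?T2 * A + (?T2 * (\<Sum>u\<in>U. \<Sum>i<n. \<Sum>j<n. a u i j * (q u i * q u j)) + pconst (real n * \<delta>) * p + p * d)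
       = ?T2 * (A + pconst c * p + (\<Sum>u\<in>U. \<Sum>i<n. \<Sum>j<n. a u i j * (q u i * q u j))) + p * \<kappa> * F - pconst \<epsilon> * p"
      unfolding d_def by (simp add: algebra_simps)
    also have "\<dots> = ?T2 * F + p * \<kappa> * F - pconst \<epsilon> * p" by (simp only: F_eq[symmetric])
    also have "\<dots> = F - pconst \<epsilon> * p" unfolding p\<kappa> by (simp add: algebra_simps)
    finally show ?thesis unfolding e1 e2 by (rule sym)
  qed
  also have "\<dots> \<in> M"
  proof (rule add_mem[OF sum_mem sum_mem])
    fix u assume u: "u \<in> U"
    show "(T ^ K * \<omega> u) * (T ^ K * \<omega> u) * g u \<in> M"
      by (rule square_mult_mem[OF _ gM[OF u]]) (use T_poly \<omega>[OF u] in simp)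
    have "(\<Sum>i<n. \<Sum>j<n. (?T2 * a u i j) * (q u i * q u j)) + pconst (real n * \<delta>) * (\<Sum>i<n. q u i * q u i) \<in> M"
    proof (rule form_mem)
      show "is_poly n (?T2 * a u i j)" if "i < n" "j < n" for i j using a[OF u that] T_poly by simp
      show "is_poly n (q u i)" if "i < n" for i by (rule q[OF u that])
      show "\<bar>peval (?T2 * a u i j) x\<bar> < \<delta>" if "i < n" "j < n" "x \<in> S" for i j x
        using K[OF that(3) u that(1,2)] T01[OF that(3)] by (simp add: abs_mult)
    qed
    moreover have "(\<Sum>i<n. q u i * q u i * d) \<in> M"
      using q[OF u] dM by (intro sum_mem square_mult_mem) auto
    ultimately show "(\<Sum>i<n. \<Sum>j<n. (?T2 * a u i j) * (q u i * q u j)) + pconst (real n * \<delta>) * (\<Sum>i<n. q u i * q u i)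
         + (\<Sum>i<n. q u i * q u i * d) \<in> M" by (rule add_mem)
  qed
  finally have mem: "F - pconst \<epsilon> * p \<in> M" .
  show thesis
    by (rule that[of \<epsilon> P \<alpha>]) (use finU c'(1) P \<alpha> P0 part mem in \<open>simp_all add: \<epsilon>_def p_def q_def\<close>)
qed

end

subsection \<open>The quadratic module of a polynomial matrix\<close>

lemma qform_is_poly:
  assumes "G \<in> carrier_mat m m" "\<forall>i<m. \<forall>j<m. is_poly n (G $$ (i,j))" "polyvec n m v"
  shows "is_poly n (qform G v)"
  using assms by (subst qform_eq[OF assms(1)]) (auto simp: polyvec_def intro!: is_poly_sum is_poly_mult)

lemma qform_scale:
  assumes "G \<in> carrier_mat m m" "v \<in> carrier_vec m"
  shows "qform G (vec m (\<lambda>a. p * v $ a)) = p * p * qform G v"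
  using assms by (simp add: qform_eq sum_distrib_left mult_ac)

lemma qmod_memI: "sos n \<sigma> \<Longrightarrow> (\<And>t. t < r \<Longrightarrow> polyvec n (dim_row G) (v t)) \<Longrightarrow> \<sigma> + (\<Sum>t<(r::nat). qform G (v t)) \<in> qmod n G"
  unfolding qmod_def by (intro CollectI exI conjI allI impI) (rule refl, assumption, blast)

lemma qmod_memE:
  assumes "p \<in> qmod n G"
  obtains \<sigma> r v where "sos n \<sigma>" "\<And>t. t < r \<Longrightarrow> polyvec n (dim_row G) (v t)" "p = \<sigma> + (\<Sum>t<(r::nat). qform G (v t))"
  using assms unfolding qmod_def by (elim CollectE exE conjE) (rule that; simp)

lemma quadratic_module_qmod:
  assumes G: "G \<in> carrier_mat m m" "\<forall>i<m. \<forall>j<m. is_poly n (G $$ (i,j))"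
  shows "quadratic_module n (qmod n G)"
proof
  have dm: "dim_row G = m" using G by simp
  show "is_poly n p" if "p \<in> qmod n G" for p
    by (rule qmod_memE[OF that]) (auto simp: dm intro!: is_poly_add is_poly_sum qform_is_poly[OF G] dest: sos_is_poly)
  show "1 \<in> qmod n G"
    using qmod_memI[of n "1 * 1" 0 G] sos_square[OF is_poly_1] by simp
  show "p + q \<in> qmod n G" if p: "p \<in> qmod n G" and q: "q \<in> qmod n G" for p q
  proof -
    obtain \<sigma> r v where 1: "sos n \<sigma>" "\<And>t. t < r \<Longrightarrow> polyvec n (dim_row G) (v t)" "p = \<sigma> + (\<Sum>t<(r::nat). qform G (v t))"
      by (rule qmod_memE[OF p], rule that)
    obtain \<sigma>' r' v' where 2: "sos n \<sigma>'" "\<And>t. t < r' \<Longrightarrow> polyvec n (dim_row G) (v' t)" "q = \<sigma>' + (\<Sum>t<(r'::nat). qform G (v' t))"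
      by (rule qmod_memE[OF q], rule that)
    define w where "w t = (if t < r then v t else v' (t - r))" for t
    have "(\<Sum>t<r + r'. qform G (w t)) = (\<Sum>t<r. qform G (w t)) + (\<Sum>t<r'. qform G (w (t + r)))"
      by (induction r') (simp_all add: ac_simps)
    also have "\<dots> = (\<Sum>t<r. qform G (v t)) + (\<Sum>t<r'. qform G (v' t))"
      by (simp add: w_def)
    finally have "p + q = (\<sigma> + \<sigma>') + (\<Sum>t<r + r'. qform G (w t))"
      unfolding 1(3) 2(3) by (simp add: algebra_simps)
    also have "\<dots> \<in> qmod n G"
    proof (rule qmod_memI)
      show "polyvec n (dim_row G) (w t)" if "t < r + r'" for t
        using 1(2)[of t] 2(2)[of "t - r"] that by (auto simp: w_def)
    qed (rule sos_add[OF 1(1) 2(1)])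
    finally show ?thesis .
  qed
  show "a * a * p \<in> qmod n G" if a: "is_poly n a" and p: "p \<in> qmod n G" for a p
  proof -
    obtain \<sigma> r v where 1: "sos n \<sigma>" "\<And>t. t < r \<Longrightarrow> polyvec n (dim_row G) (v t)" "p = \<sigma> + (\<Sum>t<(r::nat). qform G (v t))"
      by (rule qmod_memE[OF p], rule that)
    have sc: "qform G (vec m (\<lambda>i. a * v t $ i)) = a * a * qform G (v t)" if "t < r" for t
      using 1(2)[OF that] dm by (intro qform_scale[OF G(1)]) (simp add: polyvec_def)
    have "a * a * p = a * a * \<sigma> + (\<Sum>t<r. qform G (vec m (\<lambda>i. a * v t $ i)))"
      unfolding 1(3) by (simp add: distrib_left sum_distrib_left sc)
    also have "\<dots> \<in> qmod n G"
    proof (rule qmod_memI)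
      show "polyvec n (dim_row G) (vec m (\<lambda>i. a * v t $ i))" if "t < r" for t
        using 1(2)[OF that] a dm by (simp add: polyvec_def)
    qed (rule sos_square_mult[OF a 1(1)])
    finally show ?thesis .
  qed
qed

lemma peval_qform:
  assumes "G \<in> carrier_mat m m" "v \<in> carrier_vec m"
  shows "peval (qform G v) u = bil m (entries (evalm G u)) (\<lambda>a. peval (v $ a) u) (\<lambda>a. peval (v $ a) u)"
  unfolding qform_eq[OF assms] bil_def using assms
  by (simp add: entries_def evalm_def mult_ac)

text \<open>Constant vectors \<open>v\<close> recover positive semidefiniteness of
  \<open>G(u)\<close> from the module; conversely a semidefinite \<open>G(u)\<close> makes every
  summand of a module element nonnegative at \<open>u\<close>.\<close>

lemma nonneg_set_qmod:
  assumes G: "G \<in> carrier_mat m m" "G\<^sup>T = G" "\<forall>i<m. \<forall>j<m. is_poly n (G $$ (i,j))"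
  shows "nonneg_set n (qmod n G) = feasible n G"
proof (intro subset_antisym subsetI)
  have dm: "dim_row G = m" using G by simp
  have Ec: "evalm G u \<in> carrier_mat m m" for u using G by (simp add: evalm_def)
  have ET: "(evalm G u)\<^sup>T = evalm G u" for u
    unfolding evalm_def using G(2) by (simp add: map_mat_transpose)
  fix u
  {
    assume u: "u \<in> nonneg_set n (qmod n G)"
    have "0 \<le> w \<bullet> (evalm G u *\<^sub>v w)" if w: "w \<in> carrier_vec m" for w
    proof -
      let ?v = "vec m (\<lambda>a. pconst (w $ a))"
      have "0 + (\<Sum>t<Suc 0. qform G ?v) \<in> qmod n G"
        by (rule qmod_memI) (auto simp: polyvec_def dm)
      then have "0 \<le> peval (qform G ?v) u" using u by (simp add: nonneg_set_def)
      also have "\<dots> = w \<bullet> (evalm G u *\<^sub>v w)"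
        using peval_qform[OF G(1), of ?v u] w Ec[of u]
        by (simp add: bil_def scalar_prod_def entries_def lessThan_atLeast0 sum_distrib_left mult_ac)
      finally show ?thesis .
    qed
    then show "u \<in> feasible n G"
      using u Ec[of u] ET[of u] by (auto simp: feasible_def psd_def nonneg_set_def)
  next
    assume u: "u \<in> feasible n G"
    then have psd: "psd_form m (entries (evalm G u))"
      using psd_form_entries[OF _ Ec] by (simp add: feasible_def)
    have "0 \<le> peval p u" if p: "p \<in> qmod n G" for p
    proof -
      obtain \<sigma> r v where 1: "sos n \<sigma>" "\<And>t. t < r \<Longrightarrow> polyvec n (dim_row G) (v t)" "p = \<sigma> + (\<Sum>t<(r::nat). qform G (v t))"
        by (rule qmod_memE[OF p], rule that)
      have "0 \<le> peval \<sigma> u"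
        using 1(1) unfolding sos_def by (auto simp: peval_sum_list o_def intro!: sum_list_nonneg)
      moreover have "0 \<le> peval (qform G (v t)) u" if "t < r" for t
        using psd 1(2)[OF that] dm by (subst peval_qform[OF G(1)]) (auto simp: polyvec_def psd_form_def)
      ultimately show ?thesis unfolding 1(3) by (auto intro!: add_nonneg_nonneg sum_nonneg)
    qed
    then show "u \<in> nonneg_set n (qmod n G)" using u by (simp add: nonneg_set_def feasible_def)
  }
qed

text \<open>A representation involves finitely many degrees and stays admissible at every larger
  order. One fixed certificate therefore serves all large relaxations.\<close>

lemma qmod_trunc_exhaust:
  assumes "p \<in> qmod n G"
  shows "\<exists>k0. \<forall>k\<ge>k0. p \<in> qmod_trunc n G k"
proof -
  obtain \<sigma> r v where 1: "sos n \<sigma>" "\<And>t. t < r \<Longrightarrow> polyvec n (dim_row G) (v t)" "p = \<sigma> + (\<Sum>t<(r::nat). qform G (v t))"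
    by (rule qmod_memE[OF assms], rule that)
  define k0 where "k0 = pdeg \<sigma> + (\<Sum>t<r. pdeg (qform G (v t)))"
  have "pdeg (qform G (v t)) \<le> k0" if "t < r" for t
    using member_le_sum[of t "{..<r}" "\<lambda>t. pdeg (qform G (v t))"] that by (simp add: k0_def)
  then have "pdeg \<sigma> \<le> 2 * k \<and> (\<forall>t<r. pdeg (qform G (v t)) \<le> 2 * k)" if "k \<ge> k0" for k
    using that by (force simp: k0_def)
  then have "p \<in> qmod_trunc n G k" if "k \<ge> k0" for k
    unfolding qmod_trunc_def using 1 that
    by (intro CollectI exI[of _ \<sigma>] exI[of _ r] exI[of _ v] conjI) simp_all
  then show ?thesis by (intro exI[of _ k0]) simp
qed

lemma qmod_trunc_subset: "qmod_trunc n G k \<subseteq> qmod n G"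
proof
  fix p assume "p \<in> qmod_trunc n G k"
  then show "p \<in> qmod n G"
    unfolding qmod_trunc_def by (elim CollectE exE conjE) (simp add: qmod_memI)
qed

lemma qmod_trunc_pdeg: "p \<in> qmod_trunc n G k \<Longrightarrow> pdeg p \<le> 2 * k"
  unfolding qmod_trunc_def by (auto intro!: pdeg_add_le pdeg_sum_le)

lemma square_mem_qmod_trunc:
  assumes "is_poly n q" "pdeg q \<le> k"
  shows "q * q \<in> qmod_trunc n G k"
proof -
  have "pdeg (q * q) \<le> 2 * k" using pdeg_mult_le[of q q] assms(2) by simp
  then have "q * q + (\<Sum>t<(0::nat). qform G ((\<lambda>_. vec 0 (\<lambda>_. 0)) t)) \<in> qmod_trunc n G k"
    unfolding qmod_trunc_def using sos_square[OF assms(1)]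
    by (intro CollectI exI conjI) (rule refl, simp_all)
  then show ?thesis by simp
qed

section \<open>Monomial bases and ranks of moment matrices\<close>

lemma finite_mons: "finite (mons n t)"
proof (rule finite_subset)
  show "mons n t \<subseteq> (\<lambda>a. \<Sum>i<n. Poly_Mapping.single i (a i)) ` PiE {..<n} (\<lambda>_. {..t})"
  proof
    fix \<alpha> assume \<alpha>: "\<alpha> \<in> mons n t"
    then have sub: "mkeys \<alpha> \<subseteq> {..<n}" "mdeg \<alpha> \<le> t" by (auto simp: mons_def)
    have deg: "mdeg \<alpha> = (\<Sum>i<n. coef \<alpha> i)" by (rule mdeg_superset) (use sub in auto)
    have "coef \<alpha> i \<le> t" if "i < n" for i
      using member_le_sum[of i "{..<n}" "coef \<alpha>"] that sub(2) deg by simp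
    moreover have "\<alpha> = (\<Sum>i<n. Poly_Mapping.single i (restrict (coef \<alpha>) {..<n} i))"
    proof -
      have "\<alpha> = (\<Sum>i\<in>mkeys \<alpha>. Poly_Mapping.single i (coef \<alpha> i))" by (simp add: poly_mapping_sum_single)
      also have "\<dots> = (\<Sum>i<n. Poly_Mapping.single i (coef \<alpha> i))"
        by (rule sum.mono_neutral_left) (use sub in \<open>auto simp: in_keys_iff\<close>)
      finally show ?thesis by simp
    qed
    ultimately show "\<alpha> \<in> (\<lambda>a. \<Sum>i<n. Poly_Mapping.single i (a i)) ` PiE {..<n} (\<lambda>_. {..t})"
      by (intro image_eqI[of _ _ "restrict (coef \<alpha>) {..<n}"]) auto
  qed
qed (intro finite_imageI finite_PiE, auto)

lemma sum_nth_distinct: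
  assumes "distinct xs"
  shows "(\<Sum>i<length xs. h (xs ! i)) = (\<Sum>x\<in>set xs. h x)"
  using sum.reindex_bij_betw[OF bij_betw_nth[OF assms refl refl], of h] by simp

lemma mrank_congruence_le:
  assumes M: "M \<in> carrier_mat k k" and C: "C \<in> carrier_mat l k"
  shows "mrank (C * M * C\<^sup>T) \<le> mrank M"
proof -
  let ?r = "vec_space.rank k M"
  obtain B D where BD: "B \<in> carrier_mat k ?r" "D \<in> carrier_mat ?r k" "M = B * D"
    by (rule rank_factorization[OF M]) (rule that)
  have CB: "C * B \<in> carrier_mat l ?r" and DC: "D * C\<^sup>T \<in> carrier_mat ?r l" and CT: "C\<^sup>T \<in> carrier_mat k l"
    using C BD by auto
  have "C * M * C\<^sup>T = (C * B) * (D * C\<^sup>T)"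
  proof -
    have "C * M = C * (B * D)" using arg_cong[OF BD(3), of "\<lambda>X. C * X"] .
    also have "\<dots> = C * B * D" by (rule assoc_mult_mat[OF C BD(1,2), symmetric])
    finally have "C * M * C\<^sup>T = C * B * D * C\<^sup>T" by (rule arg_cong)
    also have "\<dots> = (C * B) * (D * C\<^sup>T)" by (rule assoc_mult_mat[OF CB BD(2) CT])
    finally show ?thesis .
  qed
  moreover have "vec_space.rank l ((C * B) * (D * C\<^sup>T)) \<le> ?r"
    by (rule rank_mult_le[OF CB DC])
  moreover have "dim_row (C * M * C\<^sup>T) = l" "dim_row M = k" using M C by auto
  ultimately show ?thesis unfolding mrank_def by (simp only:)
qed

text \<open>If the monomials of \<open>xs\<close> reduce to combinations of those of
  \<open>zs\<close> in both arguments, the first matrix is \<open>C * Z * C^T\<close> with the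
  coefficient matrix \<open>C\<close>, and such a product does not raise the rank.\<close>

lemma mrank_moment_le:
  fixes y :: "mon \<Rightarrow> real" and xs zs :: "mon list"
  assumes dist: "distinct zs"
    and eq: "\<And>\<alpha> \<beta>. \<alpha> \<in> set xs \<Longrightarrow> \<beta> \<in> set xs \<Longrightarrow> y (\<alpha> + \<beta>) = (\<Sum>\<gamma>\<in>set zs. \<Sum>\<delta>\<in>set zs. c \<alpha> \<gamma> * y (\<gamma> + \<delta>) * c \<beta> \<delta>)"
  shows "mrank (mat (length xs) (length xs) (\<lambda>(i,j). y (xs ! i + xs ! j)))
     \<le> mrank (mat (length zs) (length zs) (\<lambda>(i,j). y (zs ! i + zs ! j)))" (is "mrank ?X \<le> mrank ?Z")
proof -
  define C where "C = mat (length xs) (length zs) (\<lambda>(i,j). c (xs ! i) (zs ! j))"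
  have C: "C \<in> carrier_mat (length xs) (length zs)" by (simp add: C_def)
  have Z: "?Z \<in> carrier_mat (length zs) (length zs)" by simp
  have CZ: "C * ?Z \<in> carrier_mat (length xs) (length zs)" using C by auto
  have "?X = C * ?Z * C\<^sup>T"
  proof (rule eq_matI)
    fix i j assume "i < dim_row (C * ?Z * C\<^sup>T)" "j < dim_col (C * ?Z * C\<^sup>T)"
    then have ij: "i < length xs" "j < length xs" using C by auto
    have "(C * ?Z * C\<^sup>T) $$ (i,j) = (\<Sum>b<length zs. (C * ?Z) $$ (i,b) * C\<^sup>T $$ (b,j))"
      using index_mult_mat_sum[OF CZ transpose_carrier_mat[THEN iffD2, OF C] ij] .
    also have "\<dots> = (\<Sum>b<length zs. (\<Sum>a<length zs. c (xs ! i) (zs ! a) * y (zs ! a + zs ! b)) * c (xs ! j) (zs ! b))"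
    proof (rule sum.cong[OF refl])
      fix b assume b: "b \<in> {..<length zs}"
      have "(C * ?Z) $$ (i,b) = (\<Sum>a<length zs. C $$ (i,a) * ?Z $$ (a,b))"
        by (rule index_mult_mat_sum[OF C Z ij(1)]) (use b in simp)
      also have "\<dots> = (\<Sum>a<length zs. c (xs ! i) (zs ! a) * y (zs ! a + zs ! b))"
        using ij b by (intro sum.cong refl) (simp add: C_def)
      moreover have "C\<^sup>T $$ (b,j) = c (xs ! j) (zs ! b)" using ij b by (simp add: C_def)
      ultimately show "(C * ?Z) $$ (i,b) * C\<^sup>T $$ (b,j) = (\<Sum>a<length zs. c (xs ! i) (zs ! a) * y (zs ! a + zs ! b)) * c (xs ! j) (zs ! b)"
        by simp
    qed
    also have "\<dots> = (\<Sum>\<delta>\<in>set zs. (\<Sum>\<gamma>\<in>set zs. c (xs ! i) \<gamma> * y (\<gamma> + \<delta>)) * c (xs ! j) \<delta>)"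
      using sum_nth_distinct[OF dist, of "\<lambda>\<delta>. (\<Sum>\<gamma>\<in>set zs. c (xs ! i) \<gamma> * y (\<gamma> + \<delta>)) * c (xs ! j) \<delta>"]
      by (simp only: sum_nth_distinct[OF dist, of "\<lambda>\<gamma>. c (xs ! i) \<gamma> * y (\<gamma> + _)"])
    also have "\<dots> = (\<Sum>\<gamma>\<in>set zs. \<Sum>\<delta>\<in>set zs. c (xs ! i) \<gamma> * y (\<gamma> + \<delta>) * c (xs ! j) \<delta>)"
      unfolding sum_distrib_right by (rule sum.swap)
    also have "\<dots> = y (xs ! i + xs ! j)" using eq ij by simp
    finally show "?X $$ (i,j) = (C * ?Z * C\<^sup>T) $$ (i,j)" using ij by simp
  qed (use C in auto)
  then show ?thesis using mrank_congruence_le[OF Z C] by simp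
qed

text \<open>The case \<open>l = 0\<close> is listed separately for empty \<open>U\<close>: the
  degree of the zero polynomial is 0 here, which is not below \<open>card U = 0\<close>.\<close>

lemma prod_linear_monic:
  assumes "finite U" "i < n"
  shows "\<exists>l. is_poly n l \<and> (\<Prod>v\<in>U. xi v i) = pvar i ^ card U + l \<and> (l = 0 \<or> pdeg l < card U)"
  using assms(1)
proof (induction U)
  case empty
  then show ?case by (intro exI[of _ 0]) simp
next
  case (insert v U)
  then obtain l where l: "is_poly n l" "(\<Prod>v\<in>U. xi v i) = pvar i ^ card U + l" "l = 0 \<or> pdeg l < card U" by auto
  let ?N = "card U"
  let ?l = "pvar i * l - pconst (v i) * pvar i ^ ?N - pconst (v i) * l"
  have dp: "pdeg (pvar i ^ k) \<le> k" for k by (simp add: pvar_power pdeg_le_iff)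
  have d1: "pdeg (pvar i) \<le> 1" using dp[of 1] by simp
  have "pdeg (pvar i * l) \<le> ?N"
    using l(3) pdeg_mult_le[of "pvar i" l] d1 by (cases "l = 0") auto
  moreover have "pdeg (pconst (v i) * pvar i ^ ?N) \<le> ?N"
    using pdeg_mult_le[of "pconst (v i)" "pvar i ^ ?N"] dp[of ?N] by simp
  moreover have "pdeg (pconst (v i) * l) \<le> ?N"
    using pdeg_mult_le[of "pconst (v i)" l] l(3) by (cases "l = 0") auto
  ultimately have "pdeg ?l \<le> ?N" by (intro pdeg_diff_le)
  moreover have "(\<Prod>v\<in>insert v U. xi v i) = pvar i ^ card (insert v U) + ?l"
    using insert.hyps l(2) by (simp add: xi_def algebra_simps)
  moreover have "is_poly n ?l" using l(1) assms(2) by simp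
  ultimately show ?case using insert.hyps by (intro exI[of _ ?l]) auto
qed

subsection \<open>Flat truncation\<close>

lemma peval_eq_mval_sum:
  assumes "is_poly n p" "pdeg p \<le> d"
  shows "peval p x = (\<Sum>\<alpha>\<in>mons n d. of_real (coef p \<alpha>) * mval \<alpha> x)"
  using assms by (intro peval_superset finite_mons) (auto simp: mons_def is_poly_def pdeg_le_iff)

lemma Ly_eq_mons_sum:
  assumes "is_poly n p" "pdeg p \<le> d"
  shows "Ly y p = (\<Sum>\<alpha>\<in>mons n d. coef p \<alpha> * y \<alpha>)"
  using assms by (intro Ly_superset finite_mons) (auto simp: mons_def is_poly_def pdeg_le_iff)

text \<open>Gives the competitor against which a minimizing sequence is compared. The cut-off at
  degree \<open>2 * k\<close> follows the encoding of truncated sequences as functions vanishing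
  beyond that degree.\<close>

lemma point_moments_feasible:
  fixes u :: "nat \<Rightarrow> real" and k :: nat
  assumes G: "G \<in> carrier_mat m m" "G\<^sup>T = G" "\<forall>i<m. \<forall>j<m. is_poly n (G $$ (i,j))" and u: "u \<in> feasible n G"
  defines "z \<equiv> \<lambda>\<alpha>. if \<alpha> \<in> mons n (2 * k) then mval \<alpha> u else 0"
  shows "z \<in> mom_feasible n G k" "\<And>p. is_poly n p \<Longrightarrow> pdeg p \<le> 2 * k \<Longrightarrow> Ly z p = peval p u"
proof -
  interpret quadratic_module n "qmod n G" by (rule quadratic_module_qmod[OF G(1,3)])
  show Lz: "Ly z p = peval p u" if "is_poly n p" "pdeg p \<le> 2 * k" for p
    unfolding Ly_eq_mons_sum[OF that] peval_eq_mval_sum[OF that] by (intro sum.cong refl) (simp add: z_def)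
  have "0 \<le> Ly z p" if p: "p \<in> qmod_trunc n G k" for p
  proof -
    have pm: "p \<in> qmod n G" using p qmod_trunc_subset by blast
    have "0 \<le> peval p u"
      using u pm nonneg_set_qmod[OF G] unfolding nonneg_set_def by blast
    then show ?thesis using Lz[OF is_polyD[OF pm] qmod_trunc_pdeg[OF p]] by simp
  qed
  moreover have "Ly z 1 = 1" using Lz[OF is_poly_1] by simp
  moreover have "z \<in> tms n k" by (simp add: tms_def z_def)
  ultimately show "z \<in> mom_feasible n G k" by (simp add: mom_feasible_def)
qed

text \<open>On degree at most \<open>k\<close>, \<open>Ly y\<close> of a product is a positive
  semidefinite bilinear form, and \<open>q\<close> is isotropic for it.\<close>

lemma moment_null:
  assumes y: "y \<in> mom_feasible n G k" and q: "is_poly n q" "pdeg q \<le> k" "Ly y (q * q) = 0"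
    and h: "is_poly n h" "pdeg h \<le> k"
  shows "Ly y (q * h) = 0"
proof (rule linear_term_eq_0)
  fix s :: real
  have "is_poly n (q + pconst s * h)" "pdeg (q + pconst s * h) \<le> k"
    using q h pdeg_mult_le[of "pconst s" h] by (auto intro!: pdeg_add_le)
  then have "0 \<le> Ly y ((q + pconst s * h) * (q + pconst s * h))"
    using y square_mem_qmod_trunc unfolding mom_feasible_def by blast
  also have "(q + pconst s * h) * (q + pconst s * h) = q * q + pconst (2 * s) * (q * h) + pconst (s * s) * (h * h)"
    by (simp add: algebra_simps pconst_mult pconst_numeral)
  also have "Ly y \<dots> = 2 * s * Ly y (q * h) + s * s * Ly y (h * h)" using q(3) by simp
  finally show "0 \<le> 2 * s * Ly y (q * h) + s * s * Ly y (h * h)" .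
qed

text \<open>A monomial of degree above \<open>n * card U\<close> contains some variable to the power
  \<open>card U\<close>. Since the monic product in this variable is annihilated, the power can be
  replaced by lower terms, and induction on the degree applies. Annihilation is required up to
  \<open>2 * t\<close> because the multiplier is a cofactor monomial times the test polynomial
  \<open>h\<close>.\<close>

lemma monomial_reduction:
  fixes U :: "(nat \<Rightarrow> real) set"
  assumes U: "finite U" "U \<noteq> {}" and s: "s = n * card U"
    and null: "\<And>i h. i < n \<Longrightarrow> is_poly n h \<Longrightarrow> pdeg h \<le> 2 * t \<Longrightarrow> Ly y ((\<Prod>v\<in>U. xi v i) * h) = 0"
  shows "\<alpha> \<in> mons n t \<Longrightarrow> \<exists>r. is_poly n r \<and> pdeg r \<le> s \<and>
     (\<forall>h. is_poly n h \<longrightarrow> pdeg h \<le> t \<longrightarrow> Ly y (Poly_Mapping.single \<alpha> 1 * h) = Ly y (r * h))"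
proof (induction "mdeg \<alpha>" arbitrary: \<alpha> rule: less_induct)
  case less
  have ka: "mkeys \<alpha> \<subseteq> {..<n}" and ta: "mdeg \<alpha> \<le> t" using less.prems by (auto simp: mons_def)
  show ?case
  proof (cases "mdeg \<alpha> \<le> s")
    case True
    then show ?thesis
      using ka by (intro exI[of _ "Poly_Mapping.single \<alpha> 1"]) (simp add: is_poly_def pdeg_le_iff)
  next
    case False
    let ?N = "card U"
    have N: "?N > 0" using U by (simp add: card_gt_0_iff)
    have "\<exists>i<n. ?N \<le> coef \<alpha> i"
    proof (rule ccontr)
      assume "\<not> (\<exists>i<n. ?N \<le> coef \<alpha> i)"
      then have "mdeg \<alpha> \<le> (\<Sum>i<n. ?N)"
        unfolding mdeg_superset[OF finite_lessThan ka] by (intro sum_mono) (auto simp: not_le)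
      then show False using False s by simp
    qed
    then obtain i where i: "i < n" "?N \<le> coef \<alpha> i" by blast
    define \<beta> where "\<beta> = \<alpha> - Poly_Mapping.single i ?N"
    have \<alpha>\<beta>: "\<alpha> = \<beta> + Poly_Mapping.single i ?N"
      by (rule poly_mapping_eqI) (use i in \<open>auto simp: \<beta>_def lookup_add lookup_minus lookup_single when_def\<close>)
    have d\<alpha>: "mdeg \<alpha> = mdeg \<beta> + ?N" by (subst \<alpha>\<beta>) (simp add: mdeg_add)
    have k\<beta>: "mkeys \<beta> \<subseteq> {..<n}"
    proof
      fix x assume "x \<in> mkeys \<beta>"
      then have "coef \<alpha> x \<noteq> 0" by (auto simp: \<beta>_def in_keys_iff lookup_minus)
      then have "x \<in> mkeys \<alpha>" by (simp add: in_keys_iff)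
      then show "x \<in> {..<n}" using ka by (rule subsetD[rotated])
    qed
    let ?b = "Poly_Mapping.single \<beta> (1::real)"
    have b: "is_poly n ?b" "pdeg ?b \<le> mdeg \<beta>" using k\<beta> by (auto simp: is_poly_def pdeg_le_iff)
    obtain l where l: "is_poly n l" "(\<Prod>v\<in>U. xi v i) = pvar i ^ ?N + l" "l = 0 \<or> pdeg l < ?N"
      using prod_linear_monic[OF U(1) i(1)] by auto
    define p where "p = - (?b * l)"
    have p_poly: "is_poly n p" using b l by (simp add: p_def)
    have key: "Ly y (Poly_Mapping.single \<alpha> 1 * h) = Ly y (p * h)" if h: "is_poly n h" "pdeg h \<le> t" for h
    proof -
      have "Poly_Mapping.single \<alpha> 1 = ?b * pvar i ^ ?N"
        by (subst \<alpha>\<beta>) (simp add: pvar_power mult_single)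
      also have "\<dots> = ?b * (\<Prod>v\<in>U. xi v i) + p" unfolding l(2) p_def by (simp add: algebra_simps)
      finally have "Poly_Mapping.single \<alpha> 1 * h = (\<Prod>v\<in>U. xi v i) * (?b * h) + p * h"
        by (simp add: algebra_simps)
      moreover have "Ly y ((\<Prod>v\<in>U. xi v i) * (?b * h)) = 0"
      proof (rule null[OF i(1)])
        show "is_poly n (?b * h)" using b h by simp
        show "pdeg (?b * h) \<le> 2 * t" using pdeg_mult_le[of ?b h] b h d\<alpha> ta by simp
      qed
      ultimately show ?thesis by simp
    qed
    have low: "mdeg \<gamma> < mdeg \<alpha>" "mkeys \<gamma> \<subseteq> {..<n}" if \<gamma>: "\<gamma> \<in> mkeys p" for \<gamma>
    proof -
      have "l \<noteq> 0" using \<gamma> by (auto simp: p_def)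
      then have "pdeg p \<le> mdeg \<beta> + (?N - 1)" using pdeg_mult_le[of ?b l] b l(3) by (simp add: p_def)
      then have "mdeg \<gamma> \<le> mdeg \<beta> + (?N - 1)" using \<gamma> by (simp add: pdeg_le_iff)
      then show "mdeg \<gamma> < mdeg \<alpha>" using N d\<alpha> by simp
      show "mkeys \<gamma> \<subseteq> {..<n}" using p_poly \<gamma> by (simp add: is_poly_def)
    qed
    have "\<forall>\<gamma>. \<exists>r. \<gamma> \<in> mkeys p \<longrightarrow> is_poly n r \<and> pdeg r \<le> s \<and>
      (\<forall>h. is_poly n h \<longrightarrow> pdeg h \<le> t \<longrightarrow> Ly y (Poly_Mapping.single \<gamma> 1 * h) = Ly y (r * h))"
    proof
      fix \<gamma>
      show "\<exists>r. \<gamma> \<in> mkeys p \<longrightarrow> is_poly n r \<and> pdeg r \<le> s \<and>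
        (\<forall>h. is_poly n h \<longrightarrow> pdeg h \<le> t \<longrightarrow> Ly y (Poly_Mapping.single \<gamma> 1 * h) = Ly y (r * h))"
      proof (cases "\<gamma> \<in> mkeys p")
        case True
        have "\<gamma> \<in> mons n t" using low[OF True] ta by (simp add: mons_def)
        from less.hyps[OF low(1)[OF True] this] show ?thesis by (rule ex_forward) simp
      qed simp
    qed
    then obtain r where r: "\<forall>\<gamma>. \<gamma> \<in> mkeys p \<longrightarrow> is_poly n (r \<gamma>) \<and> pdeg (r \<gamma>) \<le> s \<and>
      (\<forall>h. is_poly n h \<longrightarrow> pdeg h \<le> t \<longrightarrow> Ly y (Poly_Mapping.single \<gamma> 1 * h) = Ly y (r \<gamma> * h))"
      by (rule choice[THEN exE])
    define R where "R = (\<Sum>\<gamma>\<in>mkeys p. pconst (coef p \<gamma>) * r \<gamma>)"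
    show ?thesis
    proof (intro exI[of _ R] conjI allI impI)
      show "is_poly n R" unfolding R_def using r by (intro is_poly_sum is_poly_mult) auto
      have "pdeg (pconst (coef p \<gamma>) * r \<gamma>) \<le> s" if "\<gamma> \<in> mkeys p" for \<gamma>
        using pdeg_mult_le[of "pconst (coef p \<gamma>)" "r \<gamma>"] r that by fastforce
      then show "pdeg R \<le> s" unfolding R_def by (intro pdeg_sum_le)
      fix h assume h: "is_poly n h" "pdeg h \<le> t"
      have "p * h = (\<Sum>\<gamma>\<in>mkeys p. Poly_Mapping.single \<gamma> (coef p \<gamma>)) * h" by (simp only: poly_mapping_sum_single)
      also have "\<dots> = (\<Sum>\<gamma>\<in>mkeys p. pconst (coef p \<gamma>) * (Poly_Mapping.single \<gamma> 1 * h))"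
        unfolding sum_distrib_right
        by (intro sum.cong refl) (simp add: pconst_def mult_single flip: mult.assoc)
      finally have "Ly y (p * h) = (\<Sum>\<gamma>\<in>mkeys p. coef p \<gamma> * Ly y (Poly_Mapping.single \<gamma> 1 * h))" by simp
      also have "\<dots> = (\<Sum>\<gamma>\<in>mkeys p. coef p \<gamma> * Ly y (r \<gamma> * h))"
        using r h by (intro sum.cong refl) simp
      also have "\<dots> = Ly y (R * h)"
        unfolding R_def sum_distrib_right by (simp add: mult.assoc)
      finally show "Ly y (Poly_Mapping.single \<alpha> 1 * h) = Ly y (R * h)" using key[OF h] by simp
    qed
  qed
qed

text \<open>The first index is reduced with the other monomial as test polynomial, the second one
  with the remainder \<open>r \<alpha>\<close>, which is admissible because
  \<open>s \<le> t\<close>. The opposite inequality is the one for a submatrix, with selection of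
  indices as coefficients.\<close>

lemma mrank_moment_eq:
  fixes y :: "mon \<Rightarrow> real"
  assumes st: "s \<le> t" and red: "\<And>\<alpha>. \<alpha> \<in> mons n t \<Longrightarrow> \<exists>r. is_poly n r \<and> pdeg r \<le> s \<and>
     (\<forall>h. is_poly n h \<longrightarrow> pdeg h \<le> t \<longrightarrow> Ly y (Poly_Mapping.single \<alpha> 1 * h) = Ly y (r * h))"
  shows "mrank (moment_mat n t y) = mrank (moment_mat n s y)"
proof -
  have "\<forall>\<alpha>. \<exists>r. \<alpha> \<in> mons n t \<longrightarrow> is_poly n r \<and> pdeg r \<le> s \<and>
     (\<forall>h. is_poly n h \<longrightarrow> pdeg h \<le> t \<longrightarrow> Ly y (Poly_Mapping.single \<alpha> 1 * h) = Ly y (r * h))"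
  proof
    fix \<alpha>
    show "\<exists>r. \<alpha> \<in> mons n t \<longrightarrow> is_poly n r \<and> pdeg r \<le> s \<and>
     (\<forall>h. is_poly n h \<longrightarrow> pdeg h \<le> t \<longrightarrow> Ly y (Poly_Mapping.single \<alpha> 1 * h) = Ly y (r * h))"
    proof (cases "\<alpha> \<in> mons n t")
      case True
      from red[OF True] show ?thesis by (rule ex_forward) simp
    qed simp
  qed
  then obtain r where r': "\<forall>\<alpha>. \<alpha> \<in> mons n t \<longrightarrow> is_poly n (r \<alpha>) \<and> pdeg (r \<alpha>) \<le> s \<and>
     (\<forall>h. is_poly n h \<longrightarrow> pdeg h \<le> t \<longrightarrow> Ly y (Poly_Mapping.single \<alpha> 1 * h) = Ly y (r \<alpha> * h))"
    by (rule choice[THEN exE])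
  then have r: "is_poly n (r \<alpha>)" "pdeg (r \<alpha>) \<le> s"
     "\<And>h. is_poly n h \<Longrightarrow> pdeg h \<le> t \<Longrightarrow> Ly y (Poly_Mapping.single \<alpha> 1 * h) = Ly y (r \<alpha> * h)" if "\<alpha> \<in> mons n t" for \<alpha>
    using that by simp_all
  let ?xs = "sorted_list_of_set (mons n t)" and ?zs = "sorted_list_of_set (mons n s)"
  have xs: "set ?xs = mons n t" "distinct ?xs" and zs: "set ?zs = mons n s" "distinct ?zs"
    by (simp_all add: finite_mons)
  have sub: "mons n s \<subseteq> mons n t" using st by (auto simp: mons_def)
  have "mrank (moment_mat n t y) \<le> mrank (moment_mat n s y)"
    unfolding moment_mat_def Let_def
  proof (rule mrank_moment_le[where c = "\<lambda>\<alpha>. coef (r \<alpha>)", OF zs(2)], unfold xs zs)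
    fix \<alpha> \<beta> assume a: "\<alpha> \<in> mons n t" and b: "\<beta> \<in> mons n t"
    have expand: "r \<alpha> = (\<Sum>\<gamma>\<in>mons n s. Poly_Mapping.single \<gamma> (coef (r \<alpha>) \<gamma>))" if "\<alpha> \<in> mons n t" for \<alpha>
    proof -
      have "r \<alpha> = (\<Sum>\<gamma>\<in>mkeys (r \<alpha>). Poly_Mapping.single \<gamma> (coef (r \<alpha>) \<gamma>))" by (simp add: poly_mapping_sum_single)
      also have "\<dots> = (\<Sum>\<gamma>\<in>mons n s. Poly_Mapping.single \<gamma> (coef (r \<alpha>) \<gamma>))"
        by (rule sum.mono_neutral_left[OF finite_mons])
           (use r(1,2)[OF that] in \<open>auto simp: mons_def is_poly_def pdeg_le_iff in_keys_iff\<close>)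
      finally show ?thesis .
    qed
    have sb: "is_poly n (Poly_Mapping.single \<beta> 1)" "pdeg (Poly_Mapping.single \<beta> 1) \<le> t"
      using b by (auto simp: mons_def is_poly_def pdeg_le_iff)
    have "y (\<alpha> + \<beta>) = Ly y (Poly_Mapping.single \<alpha> 1 * Poly_Mapping.single \<beta> 1)" by (simp add: mult_single)
    also have "\<dots> = Ly y (Poly_Mapping.single \<beta> 1 * r \<alpha>)" using r(3)[OF a sb] by (simp add: mult.commute)
    also have "\<dots> = Ly y (r \<beta> * r \<alpha>)" using r(1,2)[OF a] st by (intro r(3)[OF b]) auto
    also have "\<dots> = Ly y (r \<alpha> * r \<beta>)" by (simp add: mult.commute)
    also have "r \<alpha> * r \<beta> = (\<Sum>\<gamma>\<in>mons n s. \<Sum>\<delta>\<in>mons n s. Poly_Mapping.single (\<gamma> + \<delta>) (coef (r \<alpha>) \<gamma> * coef (r \<beta>) \<delta>))"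
      by (subst expand[OF a], subst expand[OF b]) (simp add: sum_product mult_single)
    also have "Ly y \<dots> = (\<Sum>\<gamma>\<in>mons n s. \<Sum>\<delta>\<in>mons n s. coef (r \<alpha>) \<gamma> * y (\<gamma> + \<delta>) * coef (r \<beta>) \<delta>)"
      by (simp add: mult_ac)
    finally show "y (\<alpha> + \<beta>) = (\<Sum>\<gamma>\<in>mons n s. \<Sum>\<delta>\<in>mons n s. coef (r \<alpha>) \<gamma> * y (\<gamma> + \<delta>) * coef (r \<beta>) \<delta>)" .
  qed
  moreover have "mrank (moment_mat n s y) \<le> mrank (moment_mat n t y)"
    unfolding moment_mat_def Let_def
  proof (rule mrank_moment_le[where c = "\<lambda>\<alpha> \<gamma>. of_bool (\<gamma> = \<alpha>)", OF xs(2)], unfold xs zs)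
    fix \<alpha> \<beta> assume "\<alpha> \<in> mons n s" "\<beta> \<in> mons n s"
    then have ab: "\<alpha> \<in> mons n t" "\<beta> \<in> mons n t" using sub by auto
    have "(\<Sum>\<gamma>\<in>mons n t. \<Sum>\<delta>\<in>mons n t. of_bool (\<gamma> = \<alpha>) * y (\<gamma> + \<delta>) * of_bool (\<delta> = \<beta>))
       = (\<Sum>\<gamma>\<in>mons n t. if \<gamma> = \<alpha> then y (\<gamma> + \<beta>) else 0)"
    proof (rule sum.cong[OF refl])
      fix \<gamma>
      have "(\<Sum>\<delta>\<in>mons n t. of_bool (\<gamma> = \<alpha>) * y (\<gamma> + \<delta>) * of_bool (\<delta> = \<beta>))
        = (\<Sum>\<delta>\<in>mons n t. if \<delta> = \<beta> then of_bool (\<gamma> = \<alpha>) * y (\<gamma> + \<delta>) else 0)"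
        by (intro sum.cong refl) simp
      then show "(\<Sum>\<delta>\<in>mons n t. of_bool (\<gamma> = \<alpha>) * y (\<gamma> + \<delta>) * of_bool (\<delta> = \<beta>)) = (if \<gamma> = \<alpha> then y (\<gamma> + \<beta>) else 0)"
        using ab finite_mons by simp
    qed
    then show "y (\<alpha> + \<beta>) = (\<Sum>\<gamma>\<in>mons n t. \<Sum>\<delta>\<in>mons n t. of_bool (\<gamma> = \<alpha>) * y (\<gamma> + \<delta>) * of_bool (\<delta> = \<beta>))"
      using ab finite_mons by simp
  qed
  ultimately show ?thesis by simp
qed

section \<open>The support ideal and the final theorem\<close>

lemma mem_supp_iff: "p \<in> supp M \<longleftrightarrow> p \<in> M \<and> - p \<in> M"
  unfolding supp_def by (metis Int_iff imageE image_eqI minus_minus)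

lemma (in quadratic_module) is_ideal_supp: "is_ideal n (supp M)"
  unfolding is_ideal_def
proof (intro conjI ballI allI impI subsetI CollectI)
  show "is_poly n p" if "p \<in> supp M" for p using that is_polyD by (simp add: mem_supp_iff)
  show "0 \<in> supp M" by (simp add: mem_supp_iff zero_mem)
  show "a + b \<in> supp M" if "a \<in> supp M" "b \<in> supp M" for a b
    using that add_mem[of a b] add_mem[of "- a" "- b"] by (simp add: mem_supp_iff)
  show "q * a \<in> supp M" if "a \<in> supp M" "is_poly n q" for a q
    using that supp_mult[of q a] supp_mult[of q "- a"] by (simp add: mem_supp_iff)
qed

lemma quadratic_module_Mset:
  assumes M: "quadratic_module n (qmod n G)" and f: "is_poly n f"
  shows "quadratic_module n (Mset n f G)"
proof -
  interpret quadratic_module n "qmod n G" by (rule M)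
  let ?F = "f - pconst (fmin n f G)"
  have memI: "a + q * ?F \<in> Mset n f G" if "a \<in> qmod n G" "is_poly n q" for a q
    unfolding Mset_def principal_ideal_def using that by blast
  have memE: "\<exists>a q. a \<in> qmod n G \<and> is_poly n q \<and> p = a + q * ?F" if "p \<in> Mset n f G" for p
    using that unfolding Mset_def principal_ideal_def by blast
  show ?thesis
  proof
    show "is_poly n p" if "p \<in> Mset n f G" for p
      using memE[OF that] is_polyD f by auto
    show "1 \<in> Mset n f G" using memI[OF one_mem is_poly_0] by simp
    show "p + p' \<in> Mset n f G" if p: "p \<in> Mset n f G" "p' \<in> Mset n f G" for p p'
    proof -
      obtain a q a' q' where *: "a \<in> qmod n G" "is_poly n q" "p = a + q * ?F" "a' \<in> qmod n G" "is_poly n q'" "p' = a' + q' * ?F"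
        using memE[OF p(1)] memE[OF p(2)] by auto
      have "p + p' = (a + a') + (q + q') * ?F" unfolding *(3,6) by (simp add: algebra_simps)
      then show ?thesis using memI[OF add_mem[OF *(1,4)] is_poly_add[OF *(2,5)]] by simp
    qed
    show "c * c * p \<in> Mset n f G" if c: "is_poly n c" "p \<in> Mset n f G" for c p
    proof -
      obtain a q where *: "a \<in> qmod n G" "is_poly n q" "p = a + q * ?F" using memE[OF c(2)] by auto
      have "c * c * p = c * c * a + (c * c * q) * ?F" unfolding *(3) by (simp add: algebra_simps)
      then show ?thesis using memI[OF square_mult_mem[OF c(1) *(1)], of "c * c * q"] c(1) *(2) by simp
    qed
  qed
qed

theorem theorem1p2:
  fixes n m :: nat and f :: rpoly and G :: "rpoly mat"
  assumes f_poly: "is_poly n f"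
    and G_dim: "G \<in> carrier_mat m m"
    and G_sym: "G\<^sup>T = G"
    and G_poly: "\<forall>i<m. \<forall>j<m. is_poly n (G $$ (i,j))"
    and arch: "archimedean n G"
    and conds: "\<forall>u\<in>minimizers n f G. opt_conds n f G u"
  shows "(is_ideal n (supp (Mset n f G)) \<and> zero_dimensional n (supp (Mset n f G)))
         \<and> (\<exists>K. \<forall>k\<ge>K. \<forall>y. mom_minimizer n f G k y \<longrightarrow>
              (\<exists>t. dGdeg G \<le> t \<and> t \<le> k \<and>
                   mrank (moment_mat n t y) = mrank (moment_mat n (t - dGdeg G) y)))"
proof -
  interpret quadratic_module n "qmod n G" by (rule quadratic_module_qmod[OF G_dim G_poly])
  interpret archimedean_module n "qmod n G"
    by standard (use arch in \<open>simp add: archimedean_def\<close>)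
  have S_eq: "nonneg_set n (qmod n G) = feasible n G" by (rule nonneg_set_qmod[OF G_dim G_sym G_poly])
  interpret Ms: quadratic_module n "Mset n f G" by (rule quadratic_module_Mset[OF quadratic_module_axioms f_poly])
  have Ms_F: "a + q * (f - pconst (fmin n f G)) \<in> Mset n f G" if "a \<in> qmod n G" "is_poly n q" for a q
    unfolding Mset_def principal_ideal_def using that by blast
  have ideal: "is_ideal n (supp (Mset n f G))" by (rule Ms.is_ideal_supp)
  show ?thesis
  proof (cases "feasible n G = {}")
    case True
    \<comment> \<open>Strict positivity on the empty set is vacuous. With \<open>- 1\<close> in
      QM[G] the support contains 1, so its variety is empty, and relaxations of large order have no
      feasible point.\<close>
    have neg1: "- 1 \<in> qmod n G" by (rule positivstellensatz) (use True S_eq in auto)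
    have "1 \<in> supp (Mset n f G)"
      using Ms_F[OF neg1 is_poly_0] Ms.one_mem by (simp add: mem_supp_iff)
    then have "cvariety n (supp (Mset n f G)) = {}"
      unfolding cvariety_def by (auto intro!: bexI[of _ 1])
    then have "zero_dimensional n (supp (Mset n f G))" by (simp add: zero_dimensional_def)
    moreover obtain k0 where k0: "\<forall>k\<ge>k0. - 1 \<in> qmod_trunc n G k" using qmod_trunc_exhaust[OF neg1] by blast
    have "\<not> mom_minimizer n f G k y" if "k \<ge> k0" for k y
    proof
      assume "mom_minimizer n f G k y"
      then have y: "Ly y 1 = 1" "\<forall>p\<in>qmod_trunc n G k. Ly y p \<ge> 0" by (auto simp: mom_minimizer_def mom_feasible_def)
      then have "Ly y (- 1) \<ge> 0" using k0 that by blast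
      then show False using y(1) by simp
    qed
    ultimately show ?thesis using ideal by blast
  next
    case feas_ne: False
    define F where "F = f - pconst (fmin n f G)"
    \<comment> \<open>Compactness makes the infimum in \<open>fmin\<close> an attained value, so
      that the minimizers are exactly the feasible zeros of \<open>F\<close>.\<close>
    obtain u0 where u0: "u0 \<in> feasible n G" "\<And>x. x \<in> feasible n G \<Longrightarrow> peval f u0 \<le> (peval f x :: real)"
      using continuous_attains_inf[OF compact_nonneg_set[unfolded S_eq] feas_ne continuous_on_peval[of _ f]] by auto
    have fm: "fmin n f G = peval f u0"
      unfolding fmin_def by (rule cInf_eq_minimum) (use u0 in auto)
    have F_poly: "is_poly n F" using f_poly by (simp add: F_def)
    define U where "U = {x \<in> feasible n G. peval F x = (0::real)}"
    have U_min: "U = minimizers n f G"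
      using u0 by (force simp: U_def minimizers_def F_def fm)
    have u0U: "u0 \<in> U" using u0(1) by (simp add: U_def F_def fm)
    have loc: "\<exists>c0>0. \<forall>c. 0 < c \<and> c \<le> c0 \<longrightarrow>
      (\<exists>g\<in>qmod n G. peval g u = 0 \<and> cubic n u (F - g - pconst c * (\<Sum>i<n. xi u i * xi u i)))" if u: "u \<in> U" for u
    proof -
      obtain E \<Lambda> where E: "ker_basis_mat (evalm G u) E" and kkt: "KKT n f G u \<Lambda>" and scc: "SCC G u \<Lambda>" and sosc: "SOSC n f G u \<Lambda> E"
        using conds u unfolding U_min opt_conds_def by blast
      have dF: "pdiff i F = pdiff i f" for i by (simp add: F_def)
      have kktF: "KKT n F G u \<Lambda>" using kkt by (simp add: KKT_def dF)
      have soscF: "SOSC n F G u \<Lambda> E" using sosc by (simp add: SOSC_def hessL_def dF)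
      have psdu: "psd (evalm G u)" and F0: "peval F u = 0" using u by (simp_all add: U_def feasible_def)
      show ?thesis
        by (rule local_certificate[OF F_poly F0 G_dim G_sym G_poly psdu E kktF scc soscF])
    qed
    obtain \<epsilon> P \<alpha> where fin: "finite U" and \<epsilon>: "\<epsilon> > 0"
      and P: "\<And>u. u \<in> U \<Longrightarrow> is_poly n (P u)" and \<alpha>: "\<And>u. u \<in> U \<Longrightarrow> is_poly n (\<alpha> u)"
      and P0: "\<And>u v. u \<in> U \<Longrightarrow> v \<in> U \<Longrightarrow> u \<noteq> v \<Longrightarrow> peval (P u) v = (0::real)"
      and part: "(\<Sum>u\<in>U. \<alpha> u * P u ^ 6) = 1"
      and cert: "F - pconst \<epsilon> * (\<Sum>u\<in>U. \<Sum>i<n. (P u * P u * xi u i) * (P u * P u * xi u i)) \<in> qmod n G"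
    proof (rule global_certificate[unfolded S_eq, OF F_poly, folded U_def])
      show "0 \<le> peval F x" if "x \<in> feasible n G" for x using u0(2)[OF that] by (simp add: F_def fm)
      show "U \<noteq> {}" using u0U by blast
    qed (use loc that in auto)
    define q where "q u i = P u * P u * xi u i" for u i
    have q: "is_poly n (q u i)" if "u \<in> U" "i < n" for u i using P[OF that(1)] that(2) by (simp add: q_def)
    define p where "p = (\<Sum>u\<in>U. \<Sum>i<n. q u i * q u i)"
    have cert: "F - pconst \<epsilon> * p \<in> qmod n G" using cert by (simp add: p_def q_def)
    have "zero_dimensional n (supp (Mset n f G))"
    proof -
      \<comment> \<open>Subtracting \<open>F\<close> itself, a multiple of the generator of the
        ideal, leaves \<open>- \<epsilon> p\<close>.\<close>
      have negp: "- (pconst \<epsilon> * p) \<in> Mset n f G"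
        using Ms_F[OF cert, of "- 1"] by (simp add: F_def algebra_simps)
      \<comment> \<open>The remaining squares of \<open>p\<close> are added back to
        \<open>- p\<close>, so that the negative of a single square is isolated.\<close>
      have qsupp: "q u i * q u i \<in> supp (Mset n f G)" if u: "u \<in> U" and i: "i < n" for u i
      proof -
        have "p = q u i * q u i + ((\<Sum>j\<in>{..<n}-{i}. q u j * q u j) + (\<Sum>v\<in>U-{u}. \<Sum>j<n. q v j * q v j))"
          unfolding p_def using fin u i by (simp add: sum.remove[of U u] sum.remove[of "{..<n}" i] add.assoc)
        then have eq: "- (q u i * q u i) = pconst (1/\<epsilon>) * (- (pconst \<epsilon> * p)) + ((\<Sum>j\<in>{..<n}-{i}. q u j * q u j) + (\<Sum>v\<in>U-{u}. \<Sum>j<n. q v j * q v j))"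
          using \<epsilon> by (simp add: mult.assoc[symmetric] pconst_mult[symmetric])
        have "- (q u i * q u i) \<in> Mset n f G"
          unfolding eq
          by (intro Ms.add_mem Ms.scale_mem negp Ms.sum_mem Ms.square_mem q) (use \<epsilon> u i in auto)
        then show ?thesis using Ms.square_mem[OF q[OF u i]] by (simp add: mem_supp_iff)
      qed
      have "cvariety n (supp (Mset n f G)) \<subseteq> (\<lambda>u i. of_real (u i)) ` U"
      proof
        fix z assume z: "z \<in> cvariety n (supp (Mset n f G))"
        have one: "(\<Sum>u\<in>U. peval (\<alpha> u) z * peval (P u) z ^ 6) = 1"
          using arg_cong[OF part, of "\<lambda>h. peval h z"] by simp
        have "\<not> (\<forall>u\<in>U. peval (P u) z = 0)"
        proof
          assume "\<forall>u\<in>U. peval (P u) z = 0"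
          then have "(\<Sum>u\<in>U. peval (\<alpha> u) z * peval (P u) z ^ 6) = 0" by (intro sum.neutral) simp
          then show False unfolding one by simp
        qed
        then obtain u where u: "u \<in> U" "peval (P u) z \<noteq> 0" by blast
        have "z i = of_real (u i)" for i
        proof (cases "i < n")
          case True
          have "peval (q u i * q u i) z = 0" using z qsupp[OF u(1) True] unfolding cvariety_def by blast
          then show ?thesis using u(2) by (simp add: q_def)
        next
          case False
          then show ?thesis using z u(1) by (simp add: cvariety_def U_def feasible_def pts_def)
        qed
        then have "z = (\<lambda>i. of_real (u i))" by (rule ext)
        then show "z \<in> (\<lambda>u i. of_real (u i)) ` U" using u(1) by (rule image_eqI)
      qed
      then show ?thesis unfolding zero_dimensional_def using fin finite_subset by blast
    qed
    moreover have "\<exists>K. \<forall>k\<ge>K. \<forall>y. mom_minimizer n f G k y \<longrightarrow>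
              (\<exists>t. dGdeg G \<le> t \<and> t \<le> k \<and> mrank (moment_mat n t y) = mrank (moment_mat n (t - dGdeg G) y))"
    proof -
      obtain k0 where k0: "\<forall>k\<ge>k0. F - pconst \<epsilon> * p \<in> qmod_trunc n G k" using qmod_trunc_exhaust[OF cert] by blast
      define s where "s = n * card U"
      \<comment> \<open>Makes \<open>t - dGdeg G\<close> equal to \<open>s\<close>, the degree to
        which all monomials reduce.\<close>
      define t where "t = s + dGdeg G"
      \<comment> \<open>Cofactors for the product of the \<open>xi v i\<close> in terms of the
        \<open>q u i\<close>: of \<open>P u ^ 6\<close> and the factor \<open>xi u i\<close>, the
        polynomial \<open>q u i\<close> takes two \<open>P u\<close> and this
        \<open>xi u i\<close>.\<close>
      define w where "w u i = \<alpha> u * P u ^ 4 * (\<Prod>v\<in>U-{u}. xi v i)" for u i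
      have w: "is_poly n (w u i)" if "u \<in> U" "i < n" for u i
        unfolding w_def using \<alpha>[OF that(1)] P[OF that(1)] that(2) by (auto intro!: is_poly_mult is_poly_prod)
      have pi_eq: "(\<Prod>v\<in>U. xi v i) = (\<Sum>u\<in>U. q u i * w u i)" for i
      proof -
        have "(\<Prod>v\<in>U. xi v i) = (\<Sum>u\<in>U. \<alpha> u * P u ^ 6) * (\<Prod>v\<in>U. xi v i)" by (simp add: part)
        also have "\<dots> = (\<Sum>u\<in>U. \<alpha> u * P u ^ 6 * (\<Prod>v\<in>U. xi v i))" by (rule sum_distrib_right)
        also have "\<dots> = (\<Sum>u\<in>U. q u i * w u i)"
        proof (rule sum.cong[OF refl])
          fix u assume u: "u \<in> U"
          show "\<alpha> u * P u ^ 6 * (\<Prod>v\<in>U. xi v i) = q u i * w u i"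
            unfolding prod.remove[OF fin u] by (simp add: q_def w_def numeral_eq_Suc mult_ac)
        qed
        finally show ?thesis .
      qed
      define d where "d = (\<Sum>u\<in>U. \<Sum>i<n. pdeg (q u i) + pdeg (w u i))"
      have d: "pdeg (q u i) \<le> d" "pdeg (w u i) \<le> d" if "u \<in> U" "i < n" for u i
      proof -
        have "pdeg (q u i) + pdeg (w u i) \<le> (\<Sum>i<n. pdeg (q u i) + pdeg (w u i))"
          using that by (intro member_le_sum[of i "{..<n}" "\<lambda>i. pdeg (q u i) + pdeg (w u i)"]) auto
        also have "\<dots> \<le> d"
          unfolding d_def using that fin by (intro member_le_sum[of u U "\<lambda>u. \<Sum>i<n. pdeg (q u i) + pdeg (w u i)"]) auto
        finally show "pdeg (q u i) \<le> d" "pdeg (w u i) \<le> d" by auto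
      qed
      \<comment> \<open>The order must admit the certificate (\<open>k0\<close>) and evaluation of
        \<open>f\<close> at a point sequence (\<open>pdeg f\<close>); \<open>d + 2 * t\<close>
        bounds the degree of \<open>w u i * h\<close> for \<open>h\<close> of degree at most
        \<open>2 * t\<close>.\<close>
      define K where "K = k0 + pdeg f + d + 2 * t"
      have "dGdeg G \<le> t \<and> t \<le> k \<and> mrank (moment_mat n t y) = mrank (moment_mat n (t - dGdeg G) y)"
        if k: "k \<ge> K" and y: "mom_minimizer n f G k y" for k y
      proof (intro conjI)
        show "dGdeg G \<le> t" by (simp add: t_def)
        show "t \<le> k" using k by (simp add: K_def)
        have yf: "y \<in> mom_feasible n G k" and ymin: "\<And>z. z \<in> mom_feasible n G k \<Longrightarrow> Ly y f \<le> Ly z f"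
          using y by (auto simp: mom_minimizer_def)
        have y1: "Ly y 1 = 1" and ynn: "\<And>p. p \<in> qmod_trunc n G k \<Longrightarrow> 0 \<le> Ly y p"
          using yf by (auto simp: mom_feasible_def)
        have "pdeg f \<le> 2 * k" using k by (simp add: K_def)
        \<comment> \<open>The moments of the minimizer \<open>u0\<close> bound the optimal value
          from above by \<open>fmin\<close>. The certificate bounds it from below by
          \<open>fmin\<close> plus \<open>\<epsilon> * Ly y p\<close>, and \<open>Ly y p\<close> is
          a sum of nonnegative terms, so each of them is zero.\<close>
        then have "Ly y f \<le> fmin n f G"
          using ymin[OF point_moments_feasible(1)[OF G_dim G_sym G_poly u0(1)]]
            point_moments_feasible(2)[OF G_dim G_sym G_poly u0(1) f_poly] by (simp add: fm)
        moreover have "Ly y (F - pconst \<epsilon> * p) \<ge> 0" using k by (intro ynn k0[rule_format]) (simp add: K_def)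
        moreover have "Ly y (pconst (fmin n f G)) = fmin n f G"
          using Ly_pconst_mult[of y "fmin n f G" 1] y1 by simp
        ultimately have "\<epsilon> * Ly y p \<le> 0" by (simp add: F_def)
        then have "Ly y p \<le> 0" using \<epsilon> by (simp add: mult_le_0_iff)
        moreover have q2: "0 \<le> Ly y (q u i * q u i)" if "u \<in> U" "i < n" for u i
          using d(1)[OF that] k by (intro ynn square_mem_qmod_trunc q that) (simp add: K_def)
        ultimately have "(\<Sum>u\<in>U. \<Sum>i<n. Ly y (q u i * q u i)) = 0"
          by (intro antisym sum_nonneg) (auto simp: p_def)
        then have Lq: "Ly y (q u i * q u i) = 0" if "u \<in> U" "i < n" for u i
        proof -
          have "(\<Sum>i<n. Ly y (q u i * q u i)) = 0"
            using \<open>(\<Sum>u\<in>U. \<Sum>i<n. Ly y (q u i * q u i)) = 0\<close> q2 fin that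
            by (subst (asm) sum_nonneg_eq_0_iff) (auto intro: sum_nonneg)
          then show ?thesis using q2 that by (subst (asm) sum_nonneg_eq_0_iff) auto
        qed
        have null: "Ly y ((\<Prod>v\<in>U. xi v i) * h) = 0" if i: "i < n" and h: "is_poly n h" "pdeg h \<le> 2 * t" for i h
        proof -
          have "Ly y (q u i * (w u i * h)) = 0" if u: "u \<in> U" for u
          proof (rule moment_null[OF yf q[OF u i] _ Lq[OF u i]])
            show "pdeg (q u i) \<le> k" using d(1)[OF u i] k by (simp add: K_def)
            show "is_poly n (w u i * h)" using w[OF u i] h by simp
            show "pdeg (w u i * h) \<le> k" using pdeg_mult_le[of "w u i" h] d(2)[OF u i] h k by (simp add: K_def)
          qed
          then show ?thesis unfolding pi_eq sum_distrib_right by (simp add: mult.assoc)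
        qed
        have "mrank (moment_mat n t y) = mrank (moment_mat n s y)"
          by (rule mrank_moment_eq[OF _ monomial_reduction[OF fin _ s_def null]]) (use u0U in \<open>auto simp: t_def\<close>)
        then show "mrank (moment_mat n t y) = mrank (moment_mat n (t - dGdeg G) y)" by (simp add: t_def)
      qed
      then show ?thesis by (intro exI[of _ K]) blast
    qed
    ultimately show ?thesis using ideal by blast
  qed
qed

end
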